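(* Consider the multi-antenna NOMA downlink model described in the context, with feedback bits $B_{n,k}\ge 0$ for user $(n,k)$. Let $S^{(1)}_{n,k}=\frac{d_{n,k}^{-\alpha}}{\sigma_{n,k}^2}\sum_{j=1}^{k}P_{n,j}$, $S^{(2)}_{n,k}=\frac{d_{n,k}^{-\alpha}}{\sigma_{n,k}^2}\sum_{j=1}^{k-1}P_{n,j}$, $S^{(3)}_{n,k}=\frac{d_{n,k}^{-\alpha}}{\sigma_{n,k}^2}\sum_{i\ne n}\sum_{j=1}^{K}P_{i,j}$. Define the rate loss $\Delta R_{n,k}=R^{ideal}_{n,k}-R_{n,k}$, where $R^{ideal}_{n,k}=\mathbb E\Big[\log_2\frac{1+S^{(1)}_{n,k}|\mathbf h_{n,k}\mathbf w_n|^2}{1+S^{(2)}_{n,k}|\mathbf h_{n,k}\mathbf w_n|^2}\Big]$ and $R_{n,k}=\mathbb E[\log_2(1+\gamma_{n,k})]$. Then for all $n,k$, $$\Delta R_{n,k}\le \log_2\!\Big(1+S^{(2)}_{n,k}+\Gamma\!\Big(\tfrac{2M-1}{M-1}\Big)2^{-\frac{B_{n,k}}{M-1}}S^{(3)}_{n,k}\Big)-\log_2(e)\,e^{1/S^{(2)}_{n,k}}E_1\!\Big(\tfrac{1}{S^{(2)}_{n,k}}\Big),$$ where $E_1(x)=\int_1^\infty e^{-xt}t^{-1}dt$ and, for $k=1$ (where $S^{(2)}_{n,1}=0$), the last term is taken to be its limit value $0$.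
   Context: A base station with $M$ antennas serves $N$ clusters of $K\ge2$ single-antenna users, $M>(N-1)K$. User $(n,k)$ has distance $d_{n,k}$, path-loss exponent $\alpha>0$, noise variance $\sigma_{n,k}^2>0$, channel $d_{n,k}^{-\alpha/2}\mathbf h_{n,k}$ with $\mathbf h_{n,k}\in\mathbb C^{1\times M}$ i.i.d. $\mathcal{CN}(0,1)$ entries, and transmit power $P_{n,k}\ge0$. Random vector quantization: user $(n,k)$ has a codebook of $2^{B_{n,k}}$ i.i.d. isotropically distributed unit vectors in $\mathbb C^{M}$, independent of the channels, and feeds back $\hat{\mathbf h}_{n,k}=\arg\max_{\mathbf c}|\tilde{\mathbf h}_{n,k}\mathbf c^H|$ with $\tilde{\mathbf h}_{n,k}=\mathbf h_{n,k}/\|\mathbf h_{n,k}\|$; write $\tilde{\mathbf h}_{n,k}=\cos\theta_{n,k}\hat{\mathbf h}_{n,k}+\sin\theta_{n,k}\tilde{\mathbf e}_{n,k}$, $\tilde{\mathbf e}_{n,k}$ a unit vector orthogonal to $\hat{\mathbf h}_{n,k}$. Zero-forcing: $\mathbf w_n=\bar{\mathbf V}^{(0)}_n\mathbf p_n$ where the columns of $\bar{\mathbf V}^{(0)}_n$ form an orthonormal basis of the null space of the matrix stacking all $\hat{\mathbf h}_{m,j}$, $m\ne n$, and $\mathbf p_n$ is uniform on the unit sphere of $\mathbb C^{M-(N-1)K}$. After SIC of users $(n,j)$, $j>k$, the SINR of user $(n,k)$ is $\gamma_{n,k}=\dfrac{\frac{d_{n,k}^{-\alpha}}{\sigma_{n,k}^2}|\mathbf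 h_{n,k}\mathbf w_n|^2P_{n,k}}{1+S^{(2)}_{n,k}|\mathbf h_{n,k}\mathbf w_n|^2+\frac{d_{n,k}^{-\alpha}}{\sigma_{n,k}^2}\sin^2\theta_{n,k}\|\mathbf h_{n,k}\|^2\sum_{i\ne n}|\tilde{\mathbf e}_{n,k}\mathbf w_i|^2\sum_{l=1}^KP_{i,l}}$. *)

theory Defs
  imports "HOL-Probability.Probability"
begin

text \<open>Vectors in C^n are functions nat => complex, only indices 0..n-1 relevant.
  Row vectors (channels, codewords) and column vectors (beamformers) use the same type.\<close>

definition cvec_space :: "nat \<Rightarrow> (nat \<Rightarrow> complex) measure" where
  "cvec_space n = PiM {..<n} (\<lambda>_. borel)"

definition cmat_space :: "nat \<Rightarrow> nat \<Rightarrow> (nat \<Rightarrow> nat \<Rightarrow> complex) measure" where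
  "cmat_space r c = PiM {..<r} (\<lambda>_. cvec_space c)"

definition cvnorm :: "nat \<Rightarrow> (nat \<Rightarrow> complex) \<Rightarrow> real" where
  "cvnorm n x = sqrt (\<Sum>i<n. (cmod (x i))^2)"

definition cinner :: "nat \<Rightarrow> (nat \<Rightarrow> complex) \<Rightarrow> (nat \<Rightarrow> complex) \<Rightarrow> complex" where
  "cinner n x y = (\<Sum>i<n. x i * cnj (y i))"

definition rmul :: "nat \<Rightarrow> (nat \<Rightarrow> complex) \<Rightarrow> (nat \<Rightarrow> complex) \<Rightarrow> complex" where
  "rmul n x w = (\<Sum>i<n. x i * w i)"

definition cn01 :: "complex measure" where
  "cn01 = density lborel (\<lambda>z. ennreal (exp (- ((cmod z) ^ 2)) / pi))"

definition cgauss_vec :: "nat \<Rightarrow> (nat \<Rightarrow> complex) measure" where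
  "cgauss_vec n = PiM {..<n} (\<lambda>_. cn01)"

definition unitary_mat :: "nat \<Rightarrow> (nat \<Rightarrow> nat \<Rightarrow> complex) \<Rightarrow> bool" where
  "unitary_mat n U \<longleftrightarrow> (\<forall>i<n. \<forall>j<n. (\<Sum>k<n. cnj (U k i) * U k j) = (if i = j then 1 else 0))"

definition matvec :: "nat \<Rightarrow> (nat \<Rightarrow> nat \<Rightarrow> complex) \<Rightarrow> (nat \<Rightarrow> complex) \<Rightarrow> (nat \<Rightarrow> complex)" where
  "matvec n U x = (\<lambda>i\<in>{..<n}. \<Sum>j<n. U i j * x j)"

text \<open>isotropically distributed unit vector in C^n: a probability law on unit vectors
  invariant under every unitary transformation (= uniform law on the unit sphere)\<close>
definition isotropic_unit :: "nat \<Rightarrow> (nat \<Rightarrow> complex) measure \<Rightarrow> bool" where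
  "isotropic_unit n \<mu> \<longleftrightarrow> prob_space \<mu> \<and> sets \<mu> = sets (cvec_space n) \<and>
     (AE x in \<mu>. cvnorm n x = 1) \<and>
     (\<forall>U. unitary_mat n U \<longrightarrow> distr \<mu> (cvec_space n) (matvec n U) = \<mu>)"

definition htil :: "nat \<Rightarrow> (nat \<Rightarrow> complex) \<Rightarrow> (nat \<Rightarrow> complex)" where
  "htil M hv = (\<lambda>i. hv i / complex_of_real (cvnorm M hv))"

text \<open>RVQ: codebook C j, j < 2^B; feed back the maximizer of |htil c^H|
  (ties, a null event, broken by smallest index)\<close>
definition hhat :: "nat \<Rightarrow> nat \<Rightarrow> (nat \<Rightarrow> complex) \<Rightarrow> (nat \<Rightarrow> nat \<Rightarrow> complex) \<Rightarrow> (nat \<Rightarrow> complex)" where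
  "hhat M B hv C = C (LEAST j. j < 2^B \<and>
      (\<forall>i<2^B. cmod (cinner M (htil M hv) (C i)) \<le> cmod (cinner M (htil M hv) (C j))))"

text \<open>htil = cos(theta) hhat + sin(theta) etil: the component sin(theta) etil\<close>
definition errv :: "nat \<Rightarrow> (nat \<Rightarrow> complex) \<Rightarrow> (nat \<Rightarrow> complex) \<Rightarrow> (nat \<Rightarrow> complex)" where
  "errv M hv hh = (\<lambda>i. htil M hv i - cinner M (htil M hv) hh * hh i)"

definition sin2 :: "nat \<Rightarrow> (nat \<Rightarrow> complex) \<Rightarrow> (nat \<Rightarrow> complex) \<Rightarrow> real" where
  "sin2 M hv hh = (cvnorm M (errv M hv hh))^2"

definition etil :: "nat \<Rightarrow> (nat \<Rightarrow> complex) \<Rightarrow> (nat \<Rightarrow> complex) \<Rightarrow> (nat \<Rightarrow> complex)" where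
  "etil M hv hh = (\<lambda>i. errv M hv hh i / complex_of_real (cvnorm M (errv M hv hh)))"

definition onb_null :: "nat \<Rightarrow> nat \<Rightarrow> (nat \<Rightarrow> complex) set \<Rightarrow> (nat \<Rightarrow> nat \<Rightarrow> complex) \<Rightarrow> bool" where
  "onb_null M L A V \<longleftrightarrow>
     (\<forall>l<L. \<forall>l'<L. (\<Sum>i<M. cnj (V i l) * V i l') = (if l = l' then 1 else 0)) \<and>
     (\<forall>a\<in>A. \<forall>l<L. (\<Sum>i<M. a i * V i l) = 0) \<and>
     (\<forall>x. (\<forall>a\<in>A. (\<Sum>i<M. a i * x i) = 0) \<longrightarrow> (\<exists>c. \<forall>i<M. x i = (\<Sum>l<L. c l * V i l)))"

definition fb_others :: "nat \<Rightarrow> nat \<Rightarrow> nat \<Rightarrow> (nat \<Rightarrow> nat \<Rightarrow> nat \<Rightarrow> complex) \<Rightarrow> (nat \<Rightarrow> nat \<Rightarrow> nat \<Rightarrow> complex)" where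
  "fb_others N K n G = (\<lambda>m\<in>{1..N} - {n}. \<lambda>j\<in>{1..K}. G m j)"

definition fb_space :: "nat \<Rightarrow> nat \<Rightarrow> nat \<Rightarrow> nat \<Rightarrow> (nat \<Rightarrow> nat \<Rightarrow> nat \<Rightarrow> complex) measure" where
  "fb_space M N K n = PiM ({1..N} - {n}) (\<lambda>_. PiM {1..K} (\<lambda>_. cvec_space M))"

definition bf :: "nat \<Rightarrow> nat \<Rightarrow> (nat \<Rightarrow> nat \<Rightarrow> complex) \<Rightarrow> (nat \<Rightarrow> complex) \<Rightarrow> (nat \<Rightarrow> complex)" where
  "bf M L V p = (\<lambda>m\<in>{..<M}. \<Sum>l<L. V m l * p l)"

definition snr :: "(nat \<Rightarrow> nat \<Rightarrow> real) \<Rightarrow> real \<Rightarrow> (nat \<Rightarrow> nat \<Rightarrow> real) \<Rightarrow> nat \<Rightarrow> nat \<Rightarrow> real" where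
  "snr d \<alpha> \<sigma>2 n k = d n k powr (- \<alpha>) / \<sigma>2 n k"

definition S1 :: "(nat \<Rightarrow> nat \<Rightarrow> real) \<Rightarrow> real \<Rightarrow> (nat \<Rightarrow> nat \<Rightarrow> real) \<Rightarrow> (nat \<Rightarrow> nat \<Rightarrow> real) \<Rightarrow> nat \<Rightarrow> nat \<Rightarrow> real" where
  "S1 d \<alpha> \<sigma>2 P n k = snr d \<alpha> \<sigma>2 n k * (\<Sum>j\<in>{1..k}. P n j)"

definition S2 :: "(nat \<Rightarrow> nat \<Rightarrow> real) \<Rightarrow> real \<Rightarrow> (nat \<Rightarrow> nat \<Rightarrow> real) \<Rightarrow> (nat \<Rightarrow> nat \<Rightarrow> real) \<Rightarrow> nat \<Rightarrow> nat \<Rightarrow> real" where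
  "S2 d \<alpha> \<sigma>2 P n k = snr d \<alpha> \<sigma>2 n k * (\<Sum>j\<in>{1..<k}. P n j)"

definition S3 :: "nat \<Rightarrow> nat \<Rightarrow> (nat \<Rightarrow> nat \<Rightarrow> real) \<Rightarrow> real \<Rightarrow> (nat \<Rightarrow> nat \<Rightarrow> real) \<Rightarrow> (nat \<Rightarrow> nat \<Rightarrow> real) \<Rightarrow> nat \<Rightarrow> nat \<Rightarrow> real" where
  "S3 N K d \<alpha> \<sigma>2 P n k = snr d \<alpha> \<sigma>2 n k * (\<Sum>i\<in>{1..N} - {n}. \<Sum>j\<in>{1..K}. P i j)"

text \<open>SINR of user (n,k); hv = h_{n,k}, hh = hhat_{n,k}, w i = beamformer of cluster i\<close>
definition sinr :: "nat \<Rightarrow> nat \<Rightarrow> nat \<Rightarrow> (nat \<Rightarrow> nat \<Rightarrow> real) \<Rightarrow> real \<Rightarrow> (nat \<Rightarrow> nat \<Rightarrow> real) \<Rightarrow>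
    (nat \<Rightarrow> nat \<Rightarrow> real) \<Rightarrow> nat \<Rightarrow> nat \<Rightarrow> (nat \<Rightarrow> complex) \<Rightarrow> (nat \<Rightarrow> complex) \<Rightarrow>
    (nat \<Rightarrow> nat \<Rightarrow> complex) \<Rightarrow> real" where
  "sinr M N K d \<alpha> \<sigma>2 P n k hv hh w =
     (snr d \<alpha> \<sigma>2 n k * (cmod (rmul M hv (w n)))^2 * P n k) /
     (1 + S2 d \<alpha> \<sigma>2 P n k * (cmod (rmul M hv (w n)))^2 +
      snr d \<alpha> \<sigma>2 n k * sin2 M hv hh * (cvnorm M hv)^2 *
        (\<Sum>i\<in>{1..N} - {n}. (cmod (rmul M (etil M hv hh) (w i)))^2 * (\<Sum>l\<in>{1..K}. P i l)))"

definition E1 :: "real \<Rightarrow> real" where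
  "E1 x = (LBINT t:{1..}. exp (- x * t) / t)"

datatype rv_idx = Hc nat nat | Cb nat nat nat | Pv nat

end

theory Submission
  imports Defs
begin

text \<open>Write \<open>G\<close> for the beamforming gain and \<open>I\<close> for the interference term of the SINR. Since
  \<open>1 + \<gamma> = (1 + S1 G + I) / (1 + S2 G + I)\<close>, the rate loss is at most
  \<open>E log (1 + S2 G + I) - E log (1 + S2 G)\<close>. The beamformer is a unit vector independent of the
  Gaussian channel, so \<open>G\<close> is exponentially distributed, which gives the \<open>E1\<close> term, and by concavity
  it remains to bound \<open>E I\<close>. As \<open>w i\<close> annihilates the quantised channel \<open>g\<close>, each summand of \<open>I\<close> is
  just a multiple of \<open>|h w i|^2\<close>. Averaging over the uniform \<open>p i\<close> turns this into the squared
  projection of \<open>h\<close> onto the null space divided by \<open>L\<close>, and averaging over the other users' feedback,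
  whose law is unitarily invariant, gives \<open>(|h|^2 - |<h,g>|^2) / (M - 1)\<close>. The quantisation error
  is finally estimated from \<open>P (1 - |<u,c>|^2 > t) = 1 - t^(M-1)\<close>, \<open>1 - y \<le> exp (- y)\<close> and
  Euler's integral. Householder reflections are the only unitary maps that are needed.\<close>

section \<open>Householder reflections\<close>

text \<open>The obstacle is the choice of null-space bases: \<open>Vsel\<close> is an arbitrary
  measurable selection, so a basis need not rotate along with the vectors it annihilates. The
  squared projection does not depend on the basis, and \<open>gs_residual\<close> computes it from
  the feedback vectors alone, by a formula that is measurable and commutes with reflections; all
  invariance arguments are applied to that formula. The feedback \<open>g\<close> of a user depends
  on its channel \<open>h\<close>, so both are held fixed and only reflections that fix
  \<open>g\<close> are admissible. They leave one free constant, and the trace L of the projection,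
  spread over the M - 1 dimensions orthogonal to \<open>g\<close>, makes it L / (M - 1). This L
  cancels the 1 / L from the uniform \<open>p i\<close>. The constant of the theorem then arises
  from E |h|^2 = M and the factor Gamma(1 + 1/(M-1)) of the quantisation error: with x = 1 + 1/(M-1)
  = M/(M-1) their combination is x Gamma(x) = Gamma(x + 1) = Gamma((2M-1)/(M-1)).\<close>

lemma cinner_commute: "cinner n y x = cnj (cinner n x y)"
  by (simp add: cinner_def mult.commute)

lemma cinner_diff_left: "cinner n (\<lambda>i. x i - y i) z = cinner n x z - cinner n y z"
  by (simp add: cinner_def left_diff_distrib sum_subtractf)

lemma cinner_diff_right: "cinner n z (\<lambda>i. x i - y i) = cinner n z x - cinner n z y"
  by (simp add: cinner_def right_diff_distrib sum_subtractf)

lemma cinner_scale_left: "cinner n (\<lambda>i. c * x i) z = c * cinner n x z"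
  by (simp add: cinner_def sum_distrib_left mult.assoc)

lemma cinner_scale_right: "cinner n z (\<lambda>i. c * x i) = cnj c * cinner n z x"
  by (simp add: cinner_def sum_distrib_left mult_ac)

lemma cinner_cong:
  "(\<And>i. i < n \<Longrightarrow> x i = x' i) \<Longrightarrow> (\<And>i. i < n \<Longrightarrow> y i = y' i) \<Longrightarrow> cinner n x y = cinner n x' y'"
  by (auto simp: cinner_def intro!: sum.cong)

lemma cvnorm_nonneg [simp]: "0 \<le> cvnorm n x"
  by (simp add: cvnorm_def sum_nonneg)

lemma cvnorm_sq: "(cvnorm n x)^2 = (\<Sum>i<n. (cmod (x i))^2)"
  by (simp add: cvnorm_def sum_nonneg)

lemma cinner_self: "cinner n x x = complex_of_real ((cvnorm n x)^2)"
  unfolding cinner_def cvnorm_sq of_real_sum by (intro sum.cong) (auto simp: complex_norm_square[symmetric])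

lemma cvnorm_eq_0_iff: "cvnorm n x = 0 \<longleftrightarrow> (\<forall>i<n. x i = 0)"
proof -
  have "cvnorm n x = 0 \<longleftrightarrow> (\<Sum>i<n. (cmod (x i))^2) = 0"
    by (simp add: cvnorm_def)
  also have "\<dots> \<longleftrightarrow> (\<forall>i<n. x i = 0)"
    by (subst sum_nonneg_eq_0_iff) auto
  finally show ?thesis .
qed

lemma cvnorm_scale: "cvnorm n (\<lambda>i. c * x i) = cmod c * cvnorm n x"
  by (simp add: cvnorm_def norm_mult power_mult_distrib sum_distrib_left[symmetric] real_sqrt_mult)

lemma cvnorm_cong: "(\<And>i. i < n \<Longrightarrow> x i = y i) \<Longrightarrow> cvnorm n x = cvnorm n y"
  by (simp add: cvnorm_def)

text \<open>Division by zero yields 0, so an \<open>a\<close> that vanishes on \<open>{..<n}\<close>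
  gives the identity there and the lemmas below need no nonzero vector. The restriction keeps the
  values inside the space of \<open>cvec_space n\<close>.\<close>

definition householder :: "nat \<Rightarrow> (nat \<Rightarrow> complex) \<Rightarrow> (nat \<Rightarrow> complex) \<Rightarrow> nat \<Rightarrow> complex" where
  "householder n a x = (\<lambda>i\<in>{..<n}. x i - 2 * cinner n x a / cinner n a a * a i)"

text \<open>\<open>isotropic_unit\<close> speaks of matrices, so this form serves to instantiate its
  invariance clause.\<close>

definition householder_mat :: "nat \<Rightarrow> (nat \<Rightarrow> complex) \<Rightarrow> nat \<Rightarrow> nat \<Rightarrow> complex" where
  "householder_mat n a i j = (if i = j then 1 else 0) - 2 * a i * cnj (a j) / cinner n a a"

lemma matvec_householder: "matvec n (householder_mat n a) = householder n a"
proof (intro ext)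
  fix x i
  show "matvec n (householder_mat n a) x i = householder n a x i"
  proof (cases "i < n")
    case True
    have "(\<Sum>j<n. householder_mat n a i j * x j) =
      (\<Sum>j<n. (if i = j then x j else 0) - 2 / cinner n a a * a i * (x j * cnj (a j)))"
      by (intro sum.cong) (auto simp: householder_mat_def algebra_simps)
    also have "\<dots> = x i - 2 / cinner n a a * a i * cinner n x a"
      using True by (simp add: sum_subtractf cinner_def sum_distrib_left)
    finally show ?thesis using True by (simp add: matvec_def householder_def)
  qed (simp add: matvec_def householder_def)
qed

lemma householder_apply: "i < n \<Longrightarrow> householder n a x i = x i - 2 * cinner n x a / cinner n a a * a i"
  by (simp add: householder_def)

lemma householder_cong: "(\<And>i. i < n \<Longrightarrow> x i = y i) \<Longrightarrow> householder n a x = householder n a y"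
  using cinner_cong[of n x y a a] by (auto simp: householder_def fun_eq_iff)

lemma cinner_householder: "cinner n (householder n a x) (householder n a y) = cinner n x y"
proof -
  have 1: "cinner n (householder n a x) (householder n a y) =
     cinner n (\<lambda>i. x i - 2 * cinner n x a / cinner n a a * a i) (\<lambda>i. y i - 2 * cinner n y a / cinner n a a * a i)"
    by (intro cinner_cong) (auto simp: householder_apply)
  have c: "cnj (cinner n a a) = cinner n a a" by (simp add: cinner_self)
  show ?thesis
  proof (cases "cinner n a a = 0")
    case False
    then show ?thesis unfolding 1 cinner_diff_left cinner_diff_right cinner_scale_left cinner_scale_right
      using c cinner_commute[of n a y] by (simp add: field_simps)
  qed (simp add: 1)
qed

lemma cvnorm_householder: "cvnorm n (householder n a x) = cvnorm n x"
proof -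
  have "complex_of_real ((cvnorm n (householder n a x))^2) = complex_of_real ((cvnorm n x)^2)"
    unfolding cinner_self[symmetric] by (rule cinner_householder)
  then have "(cvnorm n (householder n a x))^2 = (cvnorm n x)^2" by (simp only: of_real_eq_iff)
  then show ?thesis by simp
qed

lemma householder_householder: "householder n a (householder n a x) = restrict x {..<n}"
proof (cases "cinner n a a = 0")
  case True then show ?thesis by (auto simp: householder_def fun_eq_iff)
next
  case False
  have "cinner n (householder n a x) a = cinner n (\<lambda>i. x i - 2 * cinner n x a / cinner n a a * a i) a"
    by (intro cinner_cong) (auto simp: householder_apply)
  also have "\<dots> = - cinner n x a"
    unfolding cinner_diff_left cinner_scale_left using False by simp
  finally show ?thesis by (auto simp: householder_def fun_eq_iff)
qed

lemma unitary_householder: "unitary_mat n (householder_mat n a)"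
proof -
  define u where "u j = (\<lambda>k::nat. if k = j then 1 else (0::complex))" for j
  have *: "householder_mat n a k j = householder n a (u j) k" if "j < n" "k < n" for j k
  proof -
    have "cinner n (u j) a = (\<Sum>i<n. if i = j then cnj (a i) else 0)"
      unfolding cinner_def u_def by (intro sum.cong) auto
    then have "cinner n (u j) a = cnj (a j)" using that by simp
    then show ?thesis using that by (simp add: householder_apply householder_mat_def u_def)
  qed
  have "(\<Sum>k<n. cnj (householder_mat n a k i) * householder_mat n a k j) = (if i = j then 1 else 0)"
    if "i < n" "j < n" for i j
  proof -
    have "(\<Sum>k<n. cnj (householder_mat n a k i) * householder_mat n a k j) = cinner n (householder n a (u j)) (householder n a (u i))"
      using that by (simp add: cinner_def * mult.commute)
    also have "\<dots> = (\<Sum>k<n. if k = j then (if k = i then 1 else 0) else 0)"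
      unfolding cinner_householder unfolding cinner_def u_def by (intro sum.cong) auto
    finally show ?thesis using that by simp
  qed
  then show ?thesis by (simp add: unitary_mat_def)
qed

lemma householder_fix: "cinner n g a = 0 \<Longrightarrow> householder n a g = restrict g {..<n}"
  by (auto simp: householder_def fun_eq_iff)

text \<open>Reflecting along \<open>a = x - \<psi> y\<close> ends in \<open>\<psi> y\<close> because
  2 <x,a> = <a,a>. For equal norms this holds iff <x, \<psi> y> is real, which is what the phase
  arranges. The phase disappears later, since only moduli of inner products are measured.\<close>

lemma householder_maps:
  assumes "cvnorm n x = cvnorm n y"
  obtains \<psi> where "cmod \<psi> = 1"
    "\<forall>i<n. householder n (\<lambda>i. x i - \<psi> * y i) x i = \<psi> * y i"
proof -
  define s where "s = cinner n x y"
  \<comment> \<open>For orthogonal vectors every phase will do; 1 avoids a division by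
    \<open>cmod 0\<close>, which would destroy the unit modulus.\<close>
  define \<psi> where "\<psi> = (if s = 0 then 1 else s / of_real (cmod s))"
  have n1: "cmod \<psi> = 1" by (simp add: \<psi>_def norm_divide)
  then have p1: "\<psi> * cnj \<psi> = 1" by (metis complex_norm_square of_real_1 one_power2)
  have ps: "cnj \<psi> * s = of_real (cmod s)"
  proof (cases "s = 0")
    case False
    have "cnj \<psi> * s = s * cnj s / of_real (cmod s)" using False by (simp add: \<psi>_def)
    also have "\<dots> = of_real (cmod s)"
      using False by (simp add: complex_norm_square[symmetric] power2_eq_square)
    finally show ?thesis .
  qed simp
  define a where "a = (\<lambda>i. x i - \<psi> * y i)"
  have ps': "\<psi> * cinner n y x = of_real (cmod s)"
    using arg_cong[OF ps, of cnj] cinner_commute[of n y x] by (simp add: s_def)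
  have xa: "cinner n x a = of_real ((cvnorm n x)^2) - of_real (cmod s)"
    unfolding a_def cinner_diff_right cinner_scale_right using ps by (simp add: s_def cinner_self)
  have aa: "cinner n a a = 2 * cinner n x a"
  proof -
    have "cinner n a a = cinner n x a - \<psi> * cinner n y a"
      by (subst (1) a_def) (simp only: cinner_diff_left cinner_scale_left)
    also have "\<psi> * cinner n y a = \<psi> * cinner n y x - \<psi> * cnj \<psi> * cinner n y y"
      unfolding a_def cinner_diff_right cinner_scale_right by (simp add: algebra_simps)
    also have "\<dots> = - cinner n x a" using ps' p1 assms xa by (simp add: cinner_self)
    finally show ?thesis by simp
  qed
  have "householder n a x i = \<psi> * y i" if "i < n" for i
  proof (cases "cinner n a a = 0")
    case True
    then have "a i = 0" using that by (simp add: cinner_self cvnorm_eq_0_iff)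
    then show ?thesis using that True by (simp add: householder_apply a_def)
  next
    case False
    then have "2 * cinner n x a / cinner n a a = 1" using aa by simp
    then show ?thesis using that by (simp add: householder_apply a_def)
  qed
  then show thesis using n1 that unfolding a_def by blast
qed

section \<open>Lebesgue measure on complex vectors\<close>

lemma space_cvec_space: "space (cvec_space n) = extensional {..<n}"
  by (simp add: cvec_space_def space_PiM PiE_def)

lemma measurable_cvec_component [measurable (raw)]: "i < n \<Longrightarrow> (\<lambda>x. x i) \<in> borel_measurable (cvec_space n)"
  unfolding cvec_space_def by (rule measurable_component_singleton) simp

lemma measurable_cvec_component' [measurable_dest]:
  "f \<in> N \<rightarrow>\<^sub>M cvec_space n \<Longrightarrow> g \<in> L \<rightarrow>\<^sub>M N \<Longrightarrow> i < n \<Longrightarrow> (\<lambda>w. f (g w) i) \<in> borel_measurable L"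
  using measurable_compose[OF measurable_compose[of g L N f "cvec_space n"] measurable_cvec_component] by blast

lemma measurable_cvec_spaceI:
  assumes "\<And>i. i < n \<Longrightarrow> (\<lambda>w. f w i) \<in> borel_measurable N"
  shows "(\<lambda>w. \<lambda>i\<in>{..<n}. f w i) \<in> N \<rightarrow>\<^sub>M cvec_space n"
  unfolding cvec_space_def using assms by (intro measurable_restrict) auto

lemma borel_measurable_cnj [measurable (raw)]:
  "f \<in> borel_measurable N \<Longrightarrow> (\<lambda>w. cnj (f w)) \<in> borel_measurable N"
  by (rule measurable_compose[where g=cnj]) (auto intro!: borel_measurable_continuous_onI continuous_intros)

lemma measurable_cinner [measurable (raw)]:
  assumes [measurable]: "f \<in> N \<rightarrow>\<^sub>M cvec_space n" "g \<in> N \<rightarrow>\<^sub>M cvec_space n"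
  shows "(\<lambda>w. cinner n (f w) (g w)) \<in> borel_measurable N"
  unfolding cinner_def by measurable

lemma measurable_rmul [measurable (raw)]:
  assumes [measurable]: "f \<in> N \<rightarrow>\<^sub>M cvec_space n" "g \<in> N \<rightarrow>\<^sub>M cvec_space n"
  shows "(\<lambda>w. rmul n (f w) (g w)) \<in> borel_measurable N"
  unfolding rmul_def by measurable

lemma measurable_cvnorm [measurable (raw)]:
  assumes [measurable]: "f \<in> N \<rightarrow>\<^sub>M cvec_space n"
  shows "(\<lambda>w. cvnorm n (f w)) \<in> borel_measurable N"
  unfolding cvnorm_def by measurable

lemma measurable_householder [measurable (raw)]:
  assumes [measurable]: "f \<in> N \<rightarrow>\<^sub>M cvec_space n"
  shows "(\<lambda>w. householder n a (f w)) \<in> N \<rightarrow>\<^sub>M cvec_space n"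
proof -
  have "(\<lambda>w. \<lambda>i\<in>{..<n}. f w i - 2 * (\<Sum>i<n. f w i * cnj (a i)) / cinner n a a * a i) \<in> N \<rightarrow>\<^sub>M cvec_space n"
    by (intro measurable_cvec_spaceI) measurable
  then show ?thesis by (simp add: householder_def cinner_def)
qed

definition clebesgue :: "nat \<Rightarrow> (nat \<Rightarrow> complex) measure" where
  "clebesgue n = PiM {..<n} (\<lambda>_. lborel)"

interpretation cleb_prod: product_sigma_finite "\<lambda>_::nat. lborel :: complex measure"
  by standard

lemma sets_clebesgue [measurable_cong, simp]: "sets (clebesgue n) = sets (cvec_space n)"
  unfolding clebesgue_def cvec_space_def by (intro sets_PiM_cong) auto

lemma space_clebesgue: "space (clebesgue n) = extensional {..<n}"
  by (simp add: clebesgue_def space_PiM PiE_def)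

lemma sigma_finite_clebesgue: "sigma_finite_measure (clebesgue n)"
  unfolding clebesgue_def by (rule cleb_prod.sigma_finite) simp

lemma clebesgue_translate: "distr (clebesgue n) (cvec_space n) (\<lambda>x. \<lambda>i\<in>{..<n}. x i + v i) = clebesgue n"
proof -
  have meas [measurable]: "(\<lambda>x. \<lambda>i\<in>{..<n}. x i + v i) \<in> clebesgue n \<rightarrow>\<^sub>M cvec_space n"
    by (intro measurable_cvec_spaceI) measurable
  have "distr (clebesgue n) (cvec_space n) (\<lambda>x. \<lambda>i\<in>{..<n}. x i + v i) = PiM {..<n} (\<lambda>_. lborel)"
  proof (rule cleb_prod.PiM_eqI)
    fix A :: "nat \<Rightarrow> complex set" assume A: "\<And>i. i \<in> {..<n} \<Longrightarrow> A i \<in> sets lborel"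
    have AA: "Pi\<^sub>E {..<n} A \<in> sets (cvec_space n)"
      unfolding cvec_space_def using A by (intro sets_PiM_I_finite) auto
    have "emeasure (distr (clebesgue n) (cvec_space n) (\<lambda>x. \<lambda>i\<in>{..<n}. x i + v i)) (Pi\<^sub>E {..<n} A)
      = emeasure (clebesgue n) ((\<lambda>x. \<lambda>i\<in>{..<n}. x i + v i) -` (Pi\<^sub>E {..<n} A) \<inter> space (clebesgue n))"
      using AA by (intro emeasure_distr meas)
    also have "(\<lambda>x. \<lambda>i\<in>{..<n}. x i + v i) -` (Pi\<^sub>E {..<n} A) \<inter> space (clebesgue n)
       = Pi\<^sub>E {..<n} (\<lambda>i. (\<lambda>z. v i + z) -` A i)"
      by (auto simp: space_clebesgue PiE_def Pi_def add.commute)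
    also have "emeasure (clebesgue n) \<dots> = (\<Prod>i<n. emeasure lborel ((\<lambda>z. v i + z) -` A i))"
    proof -
      have "(\<lambda>z. v i + z) -` A i \<in> sets lborel" if "i < n" for i
        using measurable_sets[of "\<lambda>z. v i + z" borel borel "A i"] A that by simp
      then show ?thesis unfolding clebesgue_def by (subst cleb_prod.emeasure_PiM) auto
    qed
    also have "\<dots> = (\<Prod>i<n. emeasure lborel (A i))"
    proof (intro prod.cong refl)
      fix i assume i: "i \<in> {..<n}"
      have "emeasure lborel (A i) = emeasure (distr lborel borel ((+) (v i))) (A i)"
        by (simp add: lborel_distr_plus)
      also have "\<dots> = emeasure lborel ((\<lambda>z. v i + z) -` A i)"
        using A[OF i] by (subst emeasure_distr) auto
      finally show "emeasure lborel ((\<lambda>z. v i + z) -` A i) = emeasure lborel (A i)" by simp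
    qed
    finally show "emeasure (distr (clebesgue n) (cvec_space n) (\<lambda>x. \<lambda>i\<in>{..<n}. x i + v i)) (Pi\<^sub>E {..<n} A)
      = (\<Prod>i<n. emeasure lborel (A i))" .
  qed (auto simp: sets_clebesgue[unfolded clebesgue_def])
  then show ?thesis by (simp add: clebesgue_def)
qed

lemma nn_integral_clebesgue_translate:
  assumes [measurable]: "f \<in> borel_measurable (cvec_space n)"
  shows "(\<integral>\<^sup>+x. f (\<lambda>i\<in>{..<n}. x i + v i) \<partial>clebesgue n) = (\<integral>\<^sup>+x. f x \<partial>clebesgue n)"
proof -
  have [measurable]: "(\<lambda>x. \<lambda>i\<in>{..<n}. x i + v i) \<in> clebesgue n \<rightarrow>\<^sub>M cvec_space n"
    by (intro measurable_cvec_spaceI) measurable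
  show ?thesis
    by (subst (2) clebesgue_translate[of n v, symmetric]) (simp add: nn_integral_distr)
qed

lemma measurable_vec_minus:
  assumes [measurable]: "f \<in> N \<rightarrow>\<^sub>M cvec_space n" "g \<in> N \<rightarrow>\<^sub>M cvec_space n"
  shows "(\<lambda>w. \<lambda>i\<in>{..<n}. f w i - g w i) \<in> N \<rightarrow>\<^sub>M cvec_space n"
  by (intro measurable_cvec_spaceI) measurable

lemma measurable_vec_plus:
  assumes [measurable]: "f \<in> N \<rightarrow>\<^sub>M cvec_space n" "g \<in> N \<rightarrow>\<^sub>M cvec_space n"
  shows "(\<lambda>w. \<lambda>i\<in>{..<n}. f w i + g w i) \<in> N \<rightarrow>\<^sub>M cvec_space n"
  by (intro measurable_cvec_spaceI) measurable

lemma cvnorm_minus_commute: "cvnorm n (\<lambda>i. x i - y i) = cvnorm n (\<lambda>i. y i - x i)"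
  by (simp add: cvnorm_def norm_minus_commute)

lemma householder_add: "householder n a (\<lambda>i. x i + y i) = (\<lambda>i\<in>{..<n}. householder n a x i + householder n a y i)"
  by (auto simp: householder_def fun_eq_iff cinner_def distrib_right sum.distrib add_divide_distrib algebra_simps)

lemma householder_diff: "householder n a (\<lambda>i. x i - y i) = (\<lambda>i\<in>{..<n}. householder n a x i - householder n a y i)"
  by (auto simp: householder_def fun_eq_iff cinner_diff_left diff_divide_distrib algebra_simps)

text \<open>Uniqueness of translation-invariant measures up to a constant, by exchanging the order of
  integration; a radial function of finite integral shows that the constant is 1.\<close>
lemma nn_integral_clebesgue_householder:
  assumes [measurable]: "g \<in> borel_measurable (cvec_space n)"
    and f [measurable]: "f \<in> borel_measurable (borel :: real measure)"
    and fin: "(\<integral>\<^sup>+x. f (cvnorm n x) \<partial>clebesgue n) \<noteq> 0" "(\<integral>\<^sup>+x. f (cvnorm n x) \<partial>clebesgue n) \<noteq> \<infinity>"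
  shows "(\<integral>\<^sup>+x. g (householder n a x) \<partial>clebesgue n) = (\<integral>\<^sup>+x. g x \<partial>clebesgue n)"
proof -
  let ?F = "\<lambda>x. f (cvnorm n x) :: ennreal"
  let ?H = "householder n a"
  interpret S: sigma_finite_measure "clebesgue n" by (rule sigma_finite_clebesgue)
  interpret P: pair_sigma_finite "clebesgue n" "clebesgue n" by standard
  note [measurable] = measurable_vec_plus measurable_vec_minus
  have [measurable]: "g \<in> borel_measurable (clebesgue n)"
    using measurable_cong_sets[OF sets_clebesgue refl] assms(1) by blast
  have "(\<integral>\<^sup>+x. ?F x \<partial>clebesgue n) * (\<integral>\<^sup>+y. g (?H y) \<partial>clebesgue n) = (\<integral>\<^sup>+x. \<integral>\<^sup>+y. ?F x * g (?H y) \<partial>clebesgue n \<partial>clebesgue n)"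
    by (simp add: nn_integral_cmult nn_integral_multc)
  also have "\<dots> = (\<integral>\<^sup>+x. \<integral>\<^sup>+y. ?F x * g (\<lambda>i\<in>{..<n}. ?H y i + x i) \<partial>clebesgue n \<partial>clebesgue n)"
  proof (rule nn_integral_cong)
    fix x assume x: "x \<in> space (clebesgue n)"
    \<comment> \<open>The shift is by \<open>?H x\<close> rather than by \<open>x\<close>: as
      \<open>?H\<close> is additive and its own inverse, the shift comes out of \<open>?H\<close> as
      \<open>x\<close>.\<close>
    have "(\<integral>\<^sup>+y. ?F x * g (?H y) \<partial>clebesgue n) = (\<integral>\<^sup>+y. ?F x * g (?H (\<lambda>i\<in>{..<n}. y i + ?H x i)) \<partial>clebesgue n)"
      by (rule nn_integral_clebesgue_translate[symmetric, where f="\<lambda>y. ?F x * g (?H y)"]) measurable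
    moreover have "?H (\<lambda>i\<in>{..<n}. y i + ?H x i) = (\<lambda>i\<in>{..<n}. ?H y i + x i)" for y
    proof -
      have "?H (\<lambda>i\<in>{..<n}. y i + ?H x i) = ?H (\<lambda>i. y i + ?H x i)" by (rule householder_cong) simp
      also have "\<dots> = (\<lambda>i\<in>{..<n}. ?H y i + x i)" by (auto simp: householder_add householder_householder fun_eq_iff)
      finally show ?thesis .
    qed
    ultimately show "(\<integral>\<^sup>+y. ?F x * g (?H y) \<partial>clebesgue n) = (\<integral>\<^sup>+y. ?F x * g (\<lambda>i\<in>{..<n}. ?H y i + x i) \<partial>clebesgue n)" by (simp only:)
  qed
  also have "\<dots> = (\<integral>\<^sup>+y. \<integral>\<^sup>+x. ?F x * g (\<lambda>i\<in>{..<n}. ?H y i + x i) \<partial>clebesgue n \<partial>clebesgue n)"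
    by (rule P.Fubini') measurable
  also have "\<dots> = (\<integral>\<^sup>+y. \<integral>\<^sup>+x. f (cvnorm n (\<lambda>i. x i - ?H y i)) * g x \<partial>clebesgue n \<partial>clebesgue n)"
  proof (rule nn_integral_cong)
    fix y assume y: "y \<in> space (clebesgue n)"
    have [measurable]: "?H y \<in> space (cvec_space n)" by (simp add: space_cvec_space householder_def)
    have "(\<integral>\<^sup>+x. f (cvnorm n (\<lambda>i\<in>{..<n}. x i - ?H y i)) * g x \<partial>clebesgue n)
       = (\<integral>\<^sup>+x. f (cvnorm n (\<lambda>i\<in>{..<n}. (\<lambda>i\<in>{..<n}. x i + ?H y i) i - ?H y i)) * g (\<lambda>i\<in>{..<n}. x i + ?H y i) \<partial>clebesgue n)"
      by (rule nn_integral_clebesgue_translate[symmetric, where f="\<lambda>x. f (cvnorm n (\<lambda>i\<in>{..<n}. x i - ?H y i)) * g x"]) measurable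
    moreover have "cvnorm n (\<lambda>i\<in>{..<n}. (\<lambda>i\<in>{..<n}. x i + ?H y i) i - ?H y i) = cvnorm n x"
      "(\<lambda>i\<in>{..<n}. x i + ?H y i) = (\<lambda>i\<in>{..<n}. ?H y i + x i)"
      "cvnorm n (\<lambda>i\<in>{..<n}. x i - ?H y i) = cvnorm n (\<lambda>i. x i - ?H y i)" for x
      by (auto intro!: cvnorm_cong simp: fun_eq_iff)
    ultimately show "(\<integral>\<^sup>+x. ?F x * g (\<lambda>i\<in>{..<n}. ?H y i + x i) \<partial>clebesgue n) =
       (\<integral>\<^sup>+x. f (cvnorm n (\<lambda>i. x i - ?H y i)) * g x \<partial>clebesgue n)" by (simp only:)
  qed
  also have "\<dots> = (\<integral>\<^sup>+y. \<integral>\<^sup>+x. f (cvnorm n (\<lambda>i\<in>{..<n}. y i - ?H x i)) * g x \<partial>clebesgue n \<partial>clebesgue n)"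
  proof -
    \<comment> \<open>Applying the isometric involution \<open>?H\<close> inside the norm exchanges
      the roles of \<open>x\<close> and \<open>y\<close>. This is where the reflection moves off the
      argument of \<open>g\<close> for good.\<close>
    have "cvnorm n (\<lambda>i. x i - ?H y i) = cvnorm n (\<lambda>i\<in>{..<n}. y i - ?H x i)" for x y
    proof -
      have "cvnorm n (\<lambda>i. x i - ?H y i) = cvnorm n (?H (\<lambda>i. x i - ?H y i))" by (simp add: cvnorm_householder)
      also have "\<dots> = cvnorm n (\<lambda>i. ?H x i - y i)"
        by (intro cvnorm_cong) (simp add: householder_diff householder_householder)
      also have "\<dots> = cvnorm n (\<lambda>i. y i - ?H x i)" by (rule cvnorm_minus_commute)
      also have "\<dots> = cvnorm n (\<lambda>i\<in>{..<n}. y i - ?H x i)" by (intro cvnorm_cong) auto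
      finally show ?thesis .
    qed
    then show ?thesis by simp
  qed
  also have "\<dots> = (\<integral>\<^sup>+x. \<integral>\<^sup>+y. f (cvnorm n (\<lambda>i\<in>{..<n}. y i - ?H x i)) * g x \<partial>clebesgue n \<partial>clebesgue n)"
    by (rule P.Fubini') measurable
  also have "\<dots> = (\<integral>\<^sup>+x. (\<integral>\<^sup>+y. ?F y \<partial>clebesgue n) * g x \<partial>clebesgue n)"
  proof (rule nn_integral_cong)
    fix x assume "x \<in> space (clebesgue n)"
    have [measurable]: "?H x \<in> space (cvec_space n)" by (simp add: space_cvec_space householder_def)
    have "(\<integral>\<^sup>+y. f (cvnorm n (\<lambda>i\<in>{..<n}. y i + (- ?H x i))) \<partial>clebesgue n) = (\<integral>\<^sup>+y. ?F y \<partial>clebesgue n)"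
      by (rule nn_integral_clebesgue_translate[where f="\<lambda>y. ?F y"]) measurable
    then show "(\<integral>\<^sup>+y. f (cvnorm n (\<lambda>i\<in>{..<n}. y i - ?H x i)) * g x \<partial>clebesgue n) = (\<integral>\<^sup>+y. ?F y \<partial>clebesgue n) * g x"
      by (subst nn_integral_multc) simp_all
  qed
  also have "\<dots> = (\<integral>\<^sup>+y. ?F y \<partial>clebesgue n) * (\<integral>\<^sup>+x. g x \<partial>clebesgue n)"
    by (simp add: nn_integral_cmult)
  finally show ?thesis using fin by (simp add: ennreal_mult_cancel_left)
qed

section \<open>Complex Gaussian and reflection-invariant vectors\<close>

abbreviation expo1 :: "real measure" where
  "expo1 \<equiv> density lborel (\<lambda>t. ennreal (exponential_density 1 t))"

lemma prob_space_expo1: "prob_space expo1"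
  by (rule prob_space_exponential_density) simp

text \<open>A disc of radius r has area pi r^2, so the squared modulus pushes Lebesgue measure to pi
  times Lebesgue measure on a half-line. The minus sign is there because
  \<open>measure_eqI_lessThan\<close> compares rays open to the right, which must have finite
  measure; without it they would be complements of discs.\<close>

lemma distr_cmod_sq_lborel:
  "distr lborel borel (\<lambda>z::complex. - ((cmod z)^2)) = density lborel (\<lambda>t. ennreal pi * indicator {..0} t)"
proof (rule measure_eqI_lessThan)
  have eq: "emeasure (distr lborel borel (\<lambda>z::complex. - ((cmod z)^2))) {x<..} = ennreal (pi * max 0 (- x))" for x
  proof -
    have "emeasure (distr lborel borel (\<lambda>z::complex. - ((cmod z)^2))) {x<..} = emeasure lborel {z::complex. (cmod z)^2 < - x}"
      by (subst emeasure_distr) (auto intro!: arg_cong[where f="emeasure lborel"])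
    also have "\<dots> = ennreal (pi * max 0 (- x))"
    proof (cases "x < 0")
      case True
      have "(cmod z)^2 < - x \<longleftrightarrow> cmod z < sqrt (- x)" for z
        using real_sqrt_less_iff[of "(cmod z)^2" "- x"] by (simp only: real_sqrt_abs abs_norm_cancel)
      then have "{z::complex. (cmod z)^2 < - x} = ball 0 (sqrt (- x))"
        by (simp only: ball_def dist_0_norm)
      then show ?thesis using True by (simp add: emeasure_ball unit_ball_vol_2)
    next
      case False
      then have "{z::complex. (cmod z)^2 < - x} = {}"
      proof -
        have "\<not> (cmod z)^2 < - x" for z :: complex
          using False zero_le_power2[of "cmod z"] by linarith
        then show ?thesis by auto
      qed
      with False show ?thesis by simp
    qed
    finally show ?thesis .
  qed
  show "emeasure (distr lborel borel (\<lambda>z::complex. - ((cmod z)^2))) {x<..} < \<infinity>" for x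
    by (simp add: eq)
  have "emeasure (density lborel (\<lambda>t. ennreal pi * indicator {..0} t)) {x<..} = ennreal (pi * max 0 (- x))" for x :: real
  proof -
    have "emeasure (density lborel (\<lambda>t. ennreal pi * indicator {..0} t)) {x<..} = (\<integral>\<^sup>+t. ennreal pi * indicator {x<..0} t \<partial>lborel)"
      by (subst emeasure_density) (auto intro!: nn_integral_cong split: split_indicator)
    also have "\<dots> = ennreal pi * emeasure lborel {x<..0}"
      by (subst nn_integral_cmult_indicator) auto
    also have "\<dots> = ennreal (pi * max 0 (- x))"
      by (cases "x \<le> 0") (auto simp: ennreal_mult'[symmetric])
    finally show ?thesis .
  qed
  then show "emeasure (distr lborel borel (\<lambda>z::complex. - ((cmod z)^2))) {x<..} =
      emeasure (density lborel (\<lambda>t. ennreal pi * indicator {..0} t)) {x<..}" for x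
    by (simp add: eq)
qed auto

lemma nn_integral_cmod_sq_lborel:
  fixes f :: "real \<Rightarrow> ennreal"
  assumes [measurable]: "f \<in> borel_measurable borel"
  shows "(\<integral>\<^sup>+(z::complex). f ((cmod z)^2) \<partial>lborel) = (\<integral>\<^sup>+t. ennreal pi * indicator {0..} t * f t \<partial>lborel)"
proof -
  have "(\<integral>\<^sup>+(z::complex). f ((cmod z)^2) \<partial>lborel) = (\<integral>\<^sup>+s. f (- s) \<partial>distr lborel borel (\<lambda>z::complex. - ((cmod z)^2)))"
    by (subst nn_integral_distr) auto
  also have "\<dots> = (\<integral>\<^sup>+s. ennreal pi * indicator {..0} s * f (- s) \<partial>lborel)"
    unfolding distr_cmod_sq_lborel by (subst nn_integral_density) auto
  also have "\<dots> = (\<integral>\<^sup>+t. ennreal pi * indicator {..0} (- t) * f t \<partial>lborel)"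
    using nn_integral_real_affine[of "\<lambda>s. ennreal pi * indicator {..0} s * f (- s)" "-1" 0] by simp
  also have "\<dots> = (\<integral>\<^sup>+t. ennreal pi * indicator {0..} t * f t \<partial>lborel)"
    by (intro nn_integral_cong) (auto split: split_indicator)
  finally show ?thesis .
qed

lemma cn01_density: "cn01 = density lborel (\<lambda>z. ennreal (exp (- ((cmod z)^2)) / pi))"
  unfolding cn01_def by (simp add: divide_ennreal)

lemma sets_cn01 [simp, measurable_cong]: "sets cn01 = sets borel"
  by (simp add: cn01_def)

text \<open>The pi from the area of discs cancels the normalisation of the Gaussian density, which
  leaves the density exp(-t) on the half-line.\<close>

lemma nn_integral_cn01_cmod_sq:
  fixes f :: "real \<Rightarrow> ennreal"
  assumes [measurable]: "f \<in> borel_measurable borel"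
  shows "(\<integral>\<^sup>+z. f ((cmod z)^2) \<partial>cn01) = (\<integral>\<^sup>+t. f t \<partial>expo1)"
proof -
  have "(\<integral>\<^sup>+z. f ((cmod z)^2) \<partial>cn01) = (\<integral>\<^sup>+z. ennreal (exp (- ((cmod z)^2)) / pi) * f ((cmod z)^2) \<partial>lborel)"
    unfolding cn01_density by (subst nn_integral_density) auto
  also have "\<dots> = (\<integral>\<^sup>+t. ennreal pi * indicator {0..} t * (ennreal (exp (- t) / pi) * f t) \<partial>lborel)"
    by (rule nn_integral_cmod_sq_lborel[where f="\<lambda>t. ennreal (exp (- t) / pi) * f t"]) measurable
  also have "\<dots> = (\<integral>\<^sup>+t. ennreal (exponential_density 1 t) * f t \<partial>lborel)"
  proof (intro nn_integral_cong)
    fix t :: real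
    have "ennreal pi * ennreal (exp (- t) / pi) = ennreal (exp (- t))"
      by (subst ennreal_mult[symmetric]) auto
    then show "ennreal pi * indicator {0..} t * (ennreal (exp (- t) / pi) * f t) = ennreal (exponential_density 1 t) * f t"
      by (auto simp: exponential_density_def mult.assoc[symmetric] split: split_indicator)
  qed
  also have "\<dots> = (\<integral>\<^sup>+t. f t \<partial>expo1)"
    by (subst nn_integral_density) auto
  finally show ?thesis .
qed

lemma prob_space_cn01: "prob_space cn01"
proof
  interpret E: prob_space expo1 by (rule prob_space_expo1)
  have "(\<integral>\<^sup>+z. 1 \<partial>cn01) = (\<integral>\<^sup>+t. 1 \<partial>expo1)"
    by (rule nn_integral_cn01_cmod_sq) simp
  then show "emeasure cn01 (space cn01) = 1" using E.emeasure_space_1 by simp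
qed

interpretation cn: product_sigma_finite "\<lambda>_::nat. cn01"
  by (simp add: product_sigma_finite_def prob_space_cn01 prob_space_imp_sigma_finite)

lemma sets_cgauss_vec [simp, measurable_cong]: "sets (cgauss_vec n) = sets (cvec_space n)"
  unfolding cgauss_vec_def cvec_space_def by (intro sets_PiM_cong) auto

lemma prob_space_cgauss_vec: "prob_space (cgauss_vec n)"
  unfolding cgauss_vec_def by (intro prob_space_PiM prob_space_cn01)

text \<open>A product of Gaussian densities depends on \<open>cvnorm\<close> alone. That is what
  transfers the invariance of Lebesgue measure to Gaussian vectors.\<close>

lemma cgauss_vec_density:
  "cgauss_vec n = density (clebesgue n) (\<lambda>x. ennreal (exp (- ((cvnorm n x)^2)) / pi ^ n))"
proof -
  have prod: "(\<Prod>i<n. ennreal (exp (- ((cmod (x i))^2)) / pi)) = ennreal (exp (- ((cvnorm n x)^2)) / pi ^ n)" for x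
  proof -
    have "(\<Prod>i<n. exp (- ((cmod (x i))^2)) / pi) = exp (\<Sum>i<n. - ((cmod (x i))^2)) / pi ^ n"
      by (simp add: prod_dividef exp_sum)
    then show ?thesis by (subst prod_ennreal) (simp_all only: cvnorm_sq sum_negf, auto)
  qed
  have "density (clebesgue n) (\<lambda>x. ennreal (exp (- ((cvnorm n x)^2)) / pi ^ n)) = PiM {..<n} (\<lambda>_. cn01)"
  proof (rule cn.PiM_eqI)
    fix A :: "nat \<Rightarrow> complex set" assume "\<And>i. i \<in> {..<n} \<Longrightarrow> A i \<in> sets cn01"
    then have A [measurable]: "i < n \<Longrightarrow> A i \<in> sets borel" for i by simp
    have AA: "Pi\<^sub>E {..<n} A \<in> sets (cvec_space n)"
      unfolding cvec_space_def using A by (intro sets_PiM_I_finite) auto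
    have "emeasure (density (clebesgue n) (\<lambda>x. ennreal (exp (- ((cvnorm n x)^2)) / pi ^ n))) (Pi\<^sub>E {..<n} A)
      = (\<integral>\<^sup>+x. ennreal (exp (- ((cvnorm n x)^2)) / pi ^ n) * indicator (Pi\<^sub>E {..<n} A) x \<partial>clebesgue n)"
      using AA by (subst emeasure_density) auto
    also have "\<dots> = (\<integral>\<^sup>+x. (\<Prod>i<n. ennreal (exp (- ((cmod (x i))^2)) / pi) * indicator (A i) (x i)) \<partial>clebesgue n)"
    proof (rule nn_integral_cong)
      fix x assume x: "x \<in> space (clebesgue n)"
      have "(\<Prod>i<n. indicator (A i) (x i)) = (indicator (Pi\<^sub>E {..<n} A) x :: ennreal)"
      proof (cases "x \<in> Pi\<^sub>E {..<n} A")
        case False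
        then obtain i where "i < n" "x i \<notin> A i" using x by (auto simp: space_clebesgue PiE_def Pi_def)
        then have "(\<Prod>i<n. indicator (A i) (x i)) = (0::ennreal)" by (intro prod_zero bexI[of _ i]) auto
        then show ?thesis using False by simp
      next
        case True
        then have "x i \<in> A i" if "i < n" for i using that by auto
        then have "(\<Prod>i<n. indicator (A i) (x i)) = (\<Prod>i<n. (1::ennreal))"
          by (intro prod.cong) auto
        then show ?thesis using True by simp
      qed
      then show "ennreal (exp (- ((cvnorm n x)^2)) / pi ^ n) * indicator (Pi\<^sub>E {..<n} A) x =
         (\<Prod>i<n. ennreal (exp (- ((cmod (x i))^2)) / pi) * indicator (A i) (x i))"
        by (simp add: prod.distrib prod)
    qed
    also have "\<dots> = (\<Prod>i<n. \<integral>\<^sup>+z. ennreal (exp (- ((cmod z)^2)) / pi) * indicator (A i) z \<partial>lborel)"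
      unfolding clebesgue_def by (rule cleb_prod.product_nn_integral_prod) auto
    also have "\<dots> = (\<Prod>i<n. emeasure cn01 (A i))"
      unfolding cn01_density by (intro prod.cong refl, subst emeasure_density) auto
    finally show "emeasure (density (clebesgue n) (\<lambda>x. ennreal (exp (- ((cvnorm n x)^2)) / pi ^ n))) (Pi\<^sub>E {..<n} A)
      = (\<Prod>i<n. emeasure cn01 (A i))" .
  qed (auto simp: sets_cgauss_vec[unfolded cgauss_vec_def])
  then show ?thesis by (simp add: cgauss_vec_def)
qed

text \<open>The property shared by the laws of channels, codewords, beamforming coefficients and
  feedback vectors. Unit length is not part of it, so that Gaussian vectors qualify too.\<close>

definition refl_invariant :: "nat \<Rightarrow> (nat \<Rightarrow> complex) measure \<Rightarrow> bool" where
  "refl_invariant n \<mu> \<longleftrightarrow> sets \<mu> = sets (cvec_space n) \<and> (\<forall>a. distr \<mu> (cvec_space n) (householder n a) = \<mu>)"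

lemma refl_invariantD:
  assumes "refl_invariant n \<mu>" and [measurable]: "f \<in> borel_measurable (cvec_space n)"
  shows "(\<integral>\<^sup>+x. f (householder n a x) \<partial>\<mu>) = (\<integral>\<^sup>+x. f x \<partial>\<mu>)"
proof -
  have [measurable_cong]: "sets \<mu> = sets (cvec_space n)" and d: "distr \<mu> (cvec_space n) (householder n a) = \<mu>"
    using assms(1) by (auto simp: refl_invariant_def)
  show ?thesis by (subst (2) d[symmetric], subst nn_integral_distr) auto
qed

lemma refl_invariant_isotropic_unit: "isotropic_unit n \<mu> \<Longrightarrow> refl_invariant n \<mu>"
proof -
  assume iso: "isotropic_unit n \<mu>"
  have "distr \<mu> (cvec_space n) (householder n a) = \<mu>" for a
    using iso unitary_householder[of n a] unfolding isotropic_unit_def matvec_householder[symmetric] by blast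
  then show "refl_invariant n \<mu>"
    using iso unfolding isotropic_unit_def refl_invariant_def by blast
qed

lemma refl_invariant_cgauss_vec: "refl_invariant n (cgauss_vec n)"
  unfolding refl_invariant_def
proof (intro conjI allI)
  fix a
  let ?d = "\<lambda>x. ennreal (exp (- (x^2)) / pi ^ n)"
  interpret G: prob_space "cgauss_vec n" by (rule prob_space_cgauss_vec)
  \<comment> \<open>The Gaussian density itself serves as the radial function with nonzero finite
    integral that \<open>nn_integral_clebesgue_householder\<close> asks for.\<close>
  have 1: "(\<integral>\<^sup>+x. ?d (cvnorm n x) \<partial>clebesgue n) = 1"
  proof -
    have "(\<integral>\<^sup>+x. ?d (cvnorm n x) \<partial>clebesgue n) = (\<integral>\<^sup>+x. 1 \<partial>cgauss_vec n)"
      unfolding cgauss_vec_density by (subst nn_integral_density) auto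
    then show ?thesis using G.emeasure_space_1 by simp
  qed
  have hm [measurable]: "householder n a \<in> cgauss_vec n \<rightarrow>\<^sub>M cvec_space n"
    using measurable_householder[of "\<lambda>x. x" "cgauss_vec n" n a] by simp
  show "distr (cgauss_vec n) (cvec_space n) (householder n a) = cgauss_vec n"
  proof (rule measure_eqI)
    fix A assume A [measurable]: "A \<in> sets (distr (cgauss_vec n) (cvec_space n) (householder n a))"
    then have A' [measurable]: "A \<in> sets (cvec_space n)" by simp
    have "emeasure (distr (cgauss_vec n) (cvec_space n) (householder n a)) A = (\<integral>\<^sup>+x. indicator A (householder n a x) \<partial>cgauss_vec n)"
      by (subst nn_integral_indicator[symmetric], simp, subst nn_integral_distr) auto
    also have "\<dots> = (\<integral>\<^sup>+x. ?d (cvnorm n (householder n a x)) * indicator A (householder n a x) \<partial>clebesgue n)"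
      unfolding cgauss_vec_density by (subst nn_integral_density) (auto simp: cvnorm_householder)
    also have "\<dots> = (\<integral>\<^sup>+x. ?d (cvnorm n x) * indicator A x \<partial>clebesgue n)"
      by (rule nn_integral_clebesgue_householder[where f="?d" and g="\<lambda>x. ?d (cvnorm n x) * indicator A x"]) (auto simp: 1)
    also have "\<dots> = (\<integral>\<^sup>+x. indicator A x \<partial>cgauss_vec n)"
      unfolding cgauss_vec_density by (subst nn_integral_density) auto
    finally show "emeasure (distr (cgauss_vec n) (cvec_space n) (householder n a)) A = emeasure (cgauss_vec n) A" by simp
  qed simp
qed simp


text \<open>A reflection carries \<open>x\<close> to a unimodular multiple of \<open>y\<close>, and
  neither the modulus of the inner product nor \<open>cvnorm n c\<close> notices it. Keeping
  \<open>cvnorm n c\<close> as a second argument of \<open>f\<close> admits events that are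
  homogeneous in \<open>c\<close>, as in \<open>isotropic_tail\<close>.\<close>

lemma refl_invariant_cinner:
  fixes f :: "real \<Rightarrow> real \<Rightarrow> ennreal"
  assumes inv: "refl_invariant n \<mu>" and [measurable]: "case_prod f \<in> borel_measurable (borel \<Otimes>\<^sub>M borel)"
    and xy: "cvnorm n x = cvnorm n y"
  shows "(\<integral>\<^sup>+c. f (cmod (cinner n x c)) (cvnorm n c) \<partial>\<mu>) = (\<integral>\<^sup>+c. f (cmod (cinner n y c)) (cvnorm n c) \<partial>\<mu>)"
proof -
  obtain \<psi> where \<psi>: "cmod \<psi> = 1" and H: "\<forall>i<n. householder n (\<lambda>i. x i - \<psi> * y i) x i = \<psi> * y i"
    using householder_maps[OF xy] by metis
  let ?H = "householder n (\<lambda>i. x i - \<psi> * y i)"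
  \<comment> \<open>\<open>y\<close> need not be extensional; its restriction is a point of
    \<open>cvec_space n\<close>, as the measurability of \<open>?g\<close> in \<open>c\<close>
    requires.\<close>
  let ?g = "\<lambda>c. f (cmod (cinner n (restrict y {..<n}) c)) (cvnorm n c)"
  have [measurable]: "restrict y {..<n} \<in> space (cvec_space n)" by (simp add: space_cvec_space)
  have g [measurable]: "?g \<in> borel_measurable (cvec_space n)"
  proof -
    have "(\<lambda>c. case_prod f (cmod (cinner n (restrict y {..<n}) c), cvnorm n c)) \<in> borel_measurable (cvec_space n)"
      by measurable
    then show ?thesis by simp
  qed
  have "f (cmod (cinner n x c)) (cvnorm n c) = ?g (?H c)" for c
  proof -
    have "cmod (cinner n x c) = cmod (cinner n (?H x) (?H c))" by (simp add: cinner_householder)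
    also have "cinner n (?H x) (?H c) = cinner n (\<lambda>i. \<psi> * restrict y {..<n} i) (?H c)"
      by (intro cinner_cong) (auto simp: H)
    also have "cmod \<dots> = cmod (cinner n (restrict y {..<n}) (?H c))"
      by (simp only: cinner_scale_left[of n \<psi> "restrict y {..<n}" "?H c"] norm_mult \<psi> mult_1_left)
    finally show ?thesis by (simp add: cvnorm_householder)
  qed
  then have "(\<integral>\<^sup>+c. f (cmod (cinner n x c)) (cvnorm n c) \<partial>\<mu>) = (\<integral>\<^sup>+c. ?g (?H c) \<partial>\<mu>)"
    by (rule nn_integral_cong)
  also have "\<dots> = (\<integral>\<^sup>+c. ?g c \<partial>\<mu>)" by (rule refl_invariantD[OF inv g])
  also have "\<dots> = (\<integral>\<^sup>+c. f (cmod (cinner n y c)) (cvnorm n c) \<partial>\<mu>)"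
  proof (rule nn_integral_cong)
    fix c
    have "cinner n (restrict y {..<n}) c = cinner n y c" by (intro cinner_cong) auto
    then show "?g c = f (cmod (cinner n y c)) (cvnorm n c)" by (simp only:)
  qed
  finally show ?thesis .
qed

section \<open>Integrals of the exponential distribution\<close>

lemma nn_integral_expo1:
  assumes [measurable]: "f \<in> borel_measurable borel"
  shows "(\<integral>\<^sup>+t. f t \<partial>expo1) = (\<integral>\<^sup>+t. ennreal (exp (- t)) * indicator {0..} t * f t \<partial>lborel)"
  by (subst nn_integral_density)
     (auto intro!: nn_integral_cong simp: exponential_density_def split: split_indicator)

lemma AE_expo1_nonneg: "AE t in expo1. 0 \<le> t"
  by (subst AE_density) (auto simp: exponential_density_def)

interpretation expo1: prob_space expo1
  by (rule prob_space_expo1)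

lemma expo1_exp: 
  assumes "0 \<le> s"
  shows "(\<integral>\<^sup>+t. ennreal (exp (- s * t)) \<partial>expo1) = ennreal (1 / (1 + s))"
proof -
  interpret E: prob_space "density lborel (\<lambda>t. ennreal (exponential_density (1 + s) t))"
    using assms by (intro prob_space_exponential_density) simp
  have "(\<integral>\<^sup>+t. ennreal (exp (- s * t)) \<partial>expo1) = (\<integral>\<^sup>+t. ennreal (1 / (1 + s)) * ennreal (exponential_density (1 + s) t) \<partial>lborel)"
  proof (subst nn_integral_expo1)
    have "exp (- t) * exp (- s * t) = 1 / (1 + s) * ((1 + s) * exp (- t * (1 + s)))" for t
    proof -
      have "exp (- t) * exp (- s * t) = exp (- t * (1 + s))"
        by (simp add: exp_add[symmetric] algebra_simps)
      then show ?thesis using assms by simp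
    qed
    then show "(\<integral>\<^sup>+t. ennreal (exp (- t)) * indicator {0..} t * ennreal (exp (- s * t)) \<partial>lborel)
       = (\<integral>\<^sup>+t. ennreal (1 / (1 + s)) * ennreal (exponential_density (1 + s) t) \<partial>lborel)"
      using assms by (intro nn_integral_cong)
        (auto simp: exponential_density_def ennreal_mult'[symmetric] split: split_indicator)
  qed simp
  also have "\<dots> = ennreal (1 / (1 + s)) * (\<integral>\<^sup>+t. 1 \<partial>density lborel (\<lambda>t. ennreal (exponential_density (1 + s) t)))"
    by (subst nn_integral_cmult, simp, subst nn_integral_density) auto
  also have "\<dots> = ennreal (1 / (1 + s))" using E.emeasure_space_1 by simp
  finally show ?thesis .
qed

lemma expo1_tail:
  assumes "0 \<le> a"
  shows "(\<integral>\<^sup>+t. indicator {a..} t \<partial>expo1) = ennreal (exp (- a))"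
proof -
  have "(\<integral>\<^sup>+t. indicator {a..} t \<partial>expo1) = (\<integral>\<^sup>+t. ennreal (exp (- t)) * indicator {0..} t * indicator {a..} t \<partial>lborel)"
    by (rule nn_integral_expo1) simp
  also have "\<dots> = (\<integral>\<^sup>+t. ennreal (exp (- (a + t))) * indicator {0..} (a + t) * indicator {a..} (a + t) \<partial>lborel)"
    using nn_integral_real_affine[of "\<lambda>t. ennreal (exp (- t)) * indicator {0..} t * indicator {a..} t" 1 a] by simp
  also have "\<dots> = (\<integral>\<^sup>+t. ennreal (exp (- a)) * (ennreal (exp (- t)) * indicator {0..} t * 1) \<partial>lborel)"
    using assms by (intro nn_integral_cong) (auto simp: exp_add[symmetric] ennreal_mult'[symmetric] split: split_indicator)
  also have "\<dots> = ennreal (exp (- a)) * (\<integral>\<^sup>+t. 1 \<partial>expo1)"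
    by (subst nn_integral_cmult, simp, subst nn_integral_expo1) auto
  finally show ?thesis using expo1.emeasure_space_1 by simp
qed

lemma expo1_tail_strict:
  assumes "0 \<le> a"
  shows "(\<integral>\<^sup>+t. indicator {a<..} t \<partial>expo1) = ennreal (exp (- a))"
proof -
  have "AE t in lborel. t \<noteq> a" by (rule AE_lborel_singleton)
  then have "AE t in expo1. t \<noteq> a" by (subst AE_density) auto
  then have "(\<integral>\<^sup>+t. indicator {a<..} t \<partial>expo1) = (\<integral>\<^sup>+t. indicator {a..} t \<partial>expo1)"
    by (intro nn_integral_cong_AE) (auto elim!: eventually_mono split: split_indicator)
  then show ?thesis using expo1_tail[OF assms] by simp
qed

lemma expo1_mean: "(\<integral>\<^sup>+t. ennreal t \<partial>expo1) = 1"
proof -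
  have "(\<integral>\<^sup>+t. ennreal t \<partial>expo1) = (\<integral>\<^sup>+t. ennreal (exponential_density 1 t * t ^ 1) \<partial>lborel)"
    by (subst nn_integral_density)
       (auto intro!: nn_integral_cong simp: exponential_density_def ennreal_mult'[symmetric])
  then show ?thesis using nn_integral_erlang_ith_moment[of 1 0 1] by simp
qed

lemma expo1_powr:
  assumes "0 \<le> r"
  shows "(\<integral>\<^sup>+t. ennreal (t powr r) \<partial>expo1) = ennreal (Gamma (1 + r))"
proof -
  have "(\<integral>\<^sup>+t. ennreal (t powr r) \<partial>expo1) = (\<integral>\<^sup>+t. ennreal (indicator {0..} t * t powr ((1 + r) - 1) / exp t) \<partial>lborel)"
    by (subst nn_integral_expo1)
       (auto intro!: nn_integral_cong simp: ennreal_mult'[symmetric] exp_minus field_simps split: split_indicator)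
  then show ?thesis using Gamma_conv_nn_integral_real[of "1 + r"] assms by simp
qed

text \<open>After 1 - y \<le> exp(-y) the integrand exp(-n t^m) is read as the probability that an
  exponential variable Y exceeds n t^m. Fubini then turns the t-integral into the length of the set
  of t > 0 with n t^m < Y, at most (Y/n)^(1/m), and the mean of Y^(1/m) is Gamma(1 + 1/m). This
  replaces a change of variables.\<close>

lemma beta_min_bound:
  assumes m: "m \<ge> 1" and n: "n \<ge> 1"
  shows "(\<integral>\<^sup>+t. indicator {0<..<1} t * ennreal (1 - t ^ m) ^ n \<partial>lborel)
     \<le> ennreal (Gamma (1 + 1 / real m) * real n powr (- 1 / real m))"
proof -
  interpret P: pair_sigma_finite lborel expo1
    by (intro pair_sigma_finite.intro expo1.sigma_finite_measure_axioms lborel.sigma_finite_measure_axioms)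
  have [measurable]: "Measurable.pred (lborel \<Otimes>\<^sub>M expo1) (\<lambda>z. real n * fst z ^ m < snd z)" 
     by measurable
  have "(\<integral>\<^sup>+t. indicator {0<..<1} t * ennreal (1 - t ^ m) ^ n \<partial>lborel)
    \<le> (\<integral>\<^sup>+t. \<integral>\<^sup>+y. indicator {0<..} t * indicator {z. real n * fst z ^ m < snd z} (t, y) \<partial>expo1 \<partial>lborel)"
  proof (rule nn_integral_mono)
    fix t :: real
    show "indicator {0<..<1} t * ennreal (1 - t ^ m) ^ n
      \<le> (\<integral>\<^sup>+y. indicator {0<..} t * indicator {z. real n * fst z ^ m < snd z} (t, y) \<partial>expo1)"
    proof (cases "t \<in> {0<..<1}")
      case True
      have le1: "t ^ m \<le> 1" using True by (simp add: power_le_one)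
      have "1 - t ^ m \<le> exp (- (t ^ m))" using exp_ge_add_one_self[of "- (t ^ m)"] by simp
      then have "(1 - t ^ m) ^ n \<le> exp (- (t ^ m)) ^ n" using le1 by (intro power_mono) auto
      also have "\<dots> = exp (- (real n * t ^ m))" by (simp add: exp_of_nat_mult[symmetric])
      finally have "ennreal (1 - t ^ m) ^ n \<le> ennreal (exp (- (real n * t ^ m)))"
        using le1 by (subst ennreal_power) (auto intro!: ennreal_leI)
      also have "\<dots> = (\<integral>\<^sup>+y. indicator {real n * t ^ m<..} y \<partial>expo1)"
        using True by (intro expo1_tail_strict[symmetric]) simp
      also have "\<dots> = (\<integral>\<^sup>+y. indicator {0<..} t * indicator {z. real n * fst z ^ m < snd z} (t, y) \<partial>expo1)"
        using True by (intro nn_integral_cong) (auto split: split_indicator)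
      finally show ?thesis using True by simp
    qed simp
  qed
  also have "\<dots> = (\<integral>\<^sup>+y. \<integral>\<^sup>+t. indicator {0<..} t * indicator {z. real n * fst z ^ m < snd z} (t, y) \<partial>lborel \<partial>expo1)"
    by (rule P.Fubini'[symmetric]) measurable
  also have "\<dots> \<le> (\<integral>\<^sup>+y. ennreal (real n powr (- 1 / real m)) * ennreal (y powr (1 / real m)) \<partial>expo1)"
  proof (rule nn_integral_mono_AE, use AE_expo1_nonneg in eventually_elim)
    fix y :: real assume y: "0 \<le> y"
    let ?b = "(y / real n) powr (1 / real m)"
    have "indicator {0<..} t * indicator {z. real n * fst z ^ m < snd z} (t, y) \<le> (indicator {0..?b} t :: ennreal)" for t
    proof (cases "0 < t \<and> real n * t ^ m < y")
      case True
      then have "t ^ m \<le> y / real n" using n by (simp add: field_simps)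
      then have "(t ^ m) powr (1 / real m) \<le> ?b" using True by (intro powr_mono2) auto
      moreover have "(t ^ m) powr (1 / real m) = t"
        using True m by (simp add: powr_powr flip: powr_realpow)
      ultimately show ?thesis using True by simp
    qed (auto split: split_indicator)
    then have "(\<integral>\<^sup>+t. indicator {0<..} t * indicator {z. real n * fst z ^ m < snd z} (t, y) \<partial>lborel)
       \<le> (\<integral>\<^sup>+t. indicator {0..?b} t \<partial>lborel)"
      by (intro nn_integral_mono)
    also have "\<dots> = ennreal ?b" by simp
    also have "?b = real n powr (- 1 / real m) * y powr (1 / real m)"
      using y by (simp add: powr_divide powr_minus_divide)
    finally show "(\<integral>\<^sup>+t. indicator {0<..} t * indicator {z. real n * fst z ^ m < snd z} (t, y) \<partial>lborel)
       \<le> ennreal (real n powr (- 1 / real m)) * ennreal (y powr (1 / real m))"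
      by (simp add: ennreal_mult')
  qed
  also have "\<dots> = ennreal (real n powr (- 1 / real m)) * ennreal (Gamma (1 + 1 / real m))"
    by (subst nn_integral_cmult, simp, subst expo1_powr) auto
  also have "\<dots> = ennreal (Gamma (1 + 1 / real m) * real n powr (- 1 / real m))"
    by (subst ennreal_mult'[symmetric]) (auto simp: mult.commute)
  finally show ?thesis .
qed

text \<open>Write ln(1 + s y) as the integral of s/(1 + s u) over 0 \<le> u \<le> y and exchange:
  the exponential tail contributes exp(-u). The substitution v = 1 + s u, starting at v = 1,
  produces \<open>E1\<close> together with the factor exp(1/s).\<close>

lemma expo1_ln:
  assumes s: "0 < s"
  shows "(\<integral>\<^sup>+t. ennreal (ln (1 + s * t)) \<partial>expo1) = ennreal (exp (1 / s) * E1 (1 / s))"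
proof -
  interpret P: pair_sigma_finite lborel expo1
    by (intro pair_sigma_finite.intro expo1.sigma_finite_measure_axioms lborel.sigma_finite_measure_axioms)
  have inner: "ennreal (ln (1 + s * y)) = (\<integral>\<^sup>+u. ennreal (s / (1 + s * u)) * indicator {0..y} u \<partial>lborel)" if y: "0 \<le> y" for y
  proof -
    have pos: "0 < 1 + s * u" if "0 \<le> u" for u
      using s that by (simp add: add_pos_nonneg)
    have "(\<integral>\<^sup>+u. ennreal (s / (1 + s * u)) * indicator {0..y} u \<partial>lborel) = ennreal (ln (1 + s * y) - ln (1 + s * 0))"
    proof (rule nn_integral_FTC_Icc)
      fix u assume u: "u \<in> {0..y}"
      show "((\<lambda>u. ln (1 + s * u)) has_real_derivative s / (1 + s * u)) (at u)"
        using pos[of u] u by (auto intro!: derivative_eq_intros)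
      show "0 \<le> s / (1 + s * u)" using pos[of u] u s by simp
    qed (use y in auto)
    then show ?thesis by simp
  qed
  have ln_le: "ln (1 + s * t) \<le> s * t" if "0 \<le> t" for t
    using s that ln_add_one_self_le_self[of "s * t"] by simp
  have fin: "(\<integral>\<^sup>+t. ennreal (ln (1 + s * t)) \<partial>expo1) \<le> ennreal s"
  proof -
    have "(\<integral>\<^sup>+t. ennreal (ln (1 + s * t)) \<partial>expo1) \<le> (\<integral>\<^sup>+t. ennreal s * ennreal t \<partial>expo1)"
      using s by (intro nn_integral_mono_AE eventually_mono[OF AE_expo1_nonneg])
        (auto simp: ennreal_mult'[symmetric] intro!: ennreal_leI ln_le)
    also have "\<dots> = ennreal s" by (subst nn_integral_cmult) (auto simp: expo1_mean)
    finally show ?thesis .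
  qed
  have "(\<integral>\<^sup>+t. ennreal (ln (1 + s * t)) \<partial>expo1) =
      (\<integral>\<^sup>+y. \<integral>\<^sup>+u. ennreal (s / (1 + s * u)) * indicator {0..} u * indicator {z. fst z \<le> snd z} (u, y) \<partial>lborel \<partial>expo1)"
  proof (rule nn_integral_cong_AE, use AE_expo1_nonneg in eventually_elim)
    fix y :: real assume y: "0 \<le> y"
    show "ennreal (ln (1 + s * y)) = (\<integral>\<^sup>+u. ennreal (s / (1 + s * u)) * indicator {0..} u * indicator {z. fst z \<le> snd z} (u, y) \<partial>lborel)"
      unfolding inner[OF y] by (intro nn_integral_cong) (auto split: split_indicator)
  qed
  also have "\<dots> = (\<integral>\<^sup>+u. \<integral>\<^sup>+y. ennreal (s / (1 + s * u)) * indicator {0..} u * indicator {z. fst z \<le> snd z} (u, y) \<partial>expo1 \<partial>lborel)"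
    by (rule P.Fubini') measurable
  also have "\<dots> = (\<integral>\<^sup>+u. ennreal (s / (1 + s * u) * exp (- u)) * indicator {0..} u \<partial>lborel)"
  proof (rule nn_integral_cong)
    fix u :: real
    have "(\<integral>\<^sup>+y. ennreal (s / (1 + s * u)) * indicator {0..} u * indicator {z. fst z \<le> snd z} (u, y) \<partial>expo1)
      = ennreal (s / (1 + s * u)) * indicator {0..} u * (\<integral>\<^sup>+y. indicator {u..} y \<partial>expo1)"
      by (subst nn_integral_cmult[symmetric]) (auto intro!: nn_integral_cong split: split_indicator)
    also have "\<dots> = ennreal (s / (1 + s * u) * exp (- u)) * indicator {0..} u"
    proof (cases "0 \<le> u")
      case True
      then show ?thesis unfolding expo1_tail[OF True] using s by (simp add: ennreal_mult'[symmetric])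
    qed simp
    finally show "(\<integral>\<^sup>+y. ennreal (s / (1 + s * u)) * indicator {0..} u * indicator {z. fst z \<le> snd z} (u, y) \<partial>expo1)
      = ennreal (s / (1 + s * u) * exp (- u)) * indicator {0..} u" .
  qed
  also have "\<dots> = ennreal (exp (1 / s)) * (\<integral>\<^sup>+v. ennreal (indicator {1..} v * (exp (- (1 / s) * v) / v)) \<partial>lborel)"
  proof -
    have "(\<integral>\<^sup>+v. ennreal (indicator {1..} v * (exp (- (1 / s) * v) / v)) \<partial>lborel)
       = ennreal s * (\<integral>\<^sup>+u. ennreal (indicator {1..} (1 + s * u) * (exp (- (1 / s) * (1 + s * u)) / (1 + s * u))) \<partial>lborel)"
      using s nn_integral_real_affine[of "\<lambda>v. ennreal (indicator {1..} v * (exp (- (1 / s) * v) / v))" s 1] by simp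
    also have "\<dots> = (\<integral>\<^sup>+u. ennreal s * ennreal (indicator {1..} (1 + s * u) * (exp (- (1 / s) * (1 + s * u)) / (1 + s * u))) \<partial>lborel)"
      by (rule nn_integral_cmult[symmetric]) measurable
    finally have "ennreal (exp (1 / s)) * (\<integral>\<^sup>+v. ennreal (indicator {1..} v * (exp (- (1 / s) * v) / v)) \<partial>lborel)
      = (\<integral>\<^sup>+u. ennreal (exp (1 / s)) * (ennreal s * ennreal (indicator {1..} (1 + s * u) * (exp (- (1 / s) * (1 + s * u)) / (1 + s * u)))) \<partial>lborel)"
      by (subst nn_integral_cmult) auto
    also have "\<dots> = (\<integral>\<^sup>+u. ennreal (s / (1 + s * u) * exp (- u)) * indicator {0..} u \<partial>lborel)"
    proof (rule nn_integral_cong)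
      fix u :: real
      have e: "exp (- (1 / s) * (1 + s * u)) = exp (- u) / exp (1 / s)"
        using s by (simp add: exp_diff[symmetric] algebra_simps)
      show "ennreal (exp (1 / s)) * (ennreal s * ennreal (indicator {1..} (1 + s * u) * (exp (- (1 / s) * (1 + s * u)) / (1 + s * u))))
        = ennreal (s / (1 + s * u) * exp (- u)) * indicator {0..} u"
        unfolding e using s
        by (auto simp: ennreal_mult'[symmetric] zero_le_mult_iff split: split_indicator)
    qed
    finally show ?thesis by simp
  qed
  finally have eq: "(\<integral>\<^sup>+t. ennreal (ln (1 + s * t)) \<partial>expo1) =
     ennreal (exp (1 / s)) * (\<integral>\<^sup>+v. ennreal (indicator {1..} v * (exp (- (1 / s) * v) / v)) \<partial>lborel)" .
  let ?I = "\<integral>\<^sup>+v. ennreal (indicator {1..} v * (exp (- (1 / s) * v) / v)) \<partial>lborel"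
  \<comment> \<open>\<open>E1\<close> is a Bochner integral and would be 0 by default if the
    integral diverged. Finiteness is inherited from ln(1 + s t) \<le> s t and the mean 1 of the
    exponential law.\<close>
  have "?I \<noteq> \<infinity>"
    using fin unfolding eq by (auto simp: ennreal_mult_top top_unique)
  moreover have "E1 (1 / s) = enn2real ?I"
    unfolding E1_def set_lebesgue_integral_def
    by (subst integral_eq_nn_integral) (auto split: split_indicator)
  ultimately have "ennreal (E1 (1 / s)) = ?I" by (simp add: ennreal_enn2real_if)
  then show ?thesis unfolding eq by (simp add: ennreal_mult')
qed

section \<open>Isotropic vectors and the quantisation error\<close>

definition unitv :: "nat \<Rightarrow> nat \<Rightarrow> complex" where
  "unitv j = (\<lambda>i. if i = j then 1 else 0)"

lemma cinner_unitv: "j < n \<Longrightarrow> cinner n (unitv j) x = cnj (x j)"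
proof -
  assume j: "j < n"
  have "cinner n (unitv j) x = (\<Sum>i<n. if i = j then cnj (x i) else 0)"
    unfolding cinner_def unitv_def by (intro sum.cong) auto
  then show ?thesis using j by simp
qed

lemma cvnorm_unitv: "j < n \<Longrightarrow> cvnorm n (unitv j) = 1"
proof -
  assume j: "j < n"
  have "(\<Sum>i<n. (cmod (unitv j i))^2) = (\<Sum>i<n. if i = j then 1 else 0)"
    unfolding unitv_def by (intro sum.cong) auto
  then show ?thesis using j by (simp add: cvnorm_def)
qed

lemma cinner_restrict_left [simp]: "cinner n (restrict x {..<n}) y = cinner n x y"
  by (intro cinner_cong) auto

lemma cvnorm_restrict [simp]: "cvnorm n (restrict x {..<n}) = cvnorm n x"
  by (intro cvnorm_cong) auto

lemma cmod_cinner_commute: "cmod (cinner n x y) = cmod (cinner n y x)"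
  using cinner_commute[of n x y] by simp

text \<open>By invariance \<open>u\<close> may be replaced by the first basis vector, and then the
  inner product is the conjugate of a single coordinate.\<close>

lemma nn_integral_cgauss_cinner:
  fixes f :: "real \<Rightarrow> ennreal"
  assumes n: "n \<ge> 1" and [measurable]: "f \<in> borel_measurable borel" and u: "cvnorm n u = 1"
  shows "(\<integral>\<^sup>+x. f ((cmod (cinner n u x))^2) \<partial>cgauss_vec n) = (\<integral>\<^sup>+t. f t \<partial>expo1)"
proof -
  have "(\<integral>\<^sup>+x. f ((cmod (cinner n u x))^2) \<partial>cgauss_vec n)
     = (\<integral>\<^sup>+x. f ((cmod (cinner n (unitv 0) x))^2) \<partial>cgauss_vec n)"
    using u n
    by (intro refl_invariant_cinner[where f="\<lambda>a b. f (a^2)"] refl_invariant_cgauss_vec)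
       (auto simp: cvnorm_unitv)
  also have "\<dots> = (\<integral>\<^sup>+x. f ((cmod (x 0))^2) \<partial>PiM {..<n} (\<lambda>_. cn01))"
    using n by (simp add: cinner_unitv cgauss_vec_def)
  also have "\<dots> = (\<integral>\<^sup>+z. f ((cmod z)^2) \<partial>distr (PiM {..<n} (\<lambda>_. cn01)) cn01 (\<lambda>x. x 0))"
  proof (subst nn_integral_distr)
    show "(\<lambda>x. x 0) \<in> PiM {..<n} (\<lambda>_. cn01) \<rightarrow>\<^sub>M cn01"
      using n by (intro measurable_component_singleton) auto
    show "(\<lambda>z. f ((cmod z)^2)) \<in> borel_measurable (distr (PiM {..<n} (\<lambda>_. cn01)) cn01 (\<lambda>x. x 0))"
      unfolding measurable_distr_eq1 by measurable
  qed simp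
  also have "distr (PiM {..<n} (\<lambda>_. cn01)) cn01 (\<lambda>x. x 0) = cn01"
    using n by (intro distr_PiM_component prob_space_cn01) auto
  also have "(\<integral>\<^sup>+z. f ((cmod z)^2) \<partial>cn01) = (\<integral>\<^sup>+t. f t \<partial>expo1)"
    by (rule nn_integral_cn01_cmod_sq) measurable
  finally show ?thesis .
qed

lemma cvnorm_sq_unitv: "(cvnorm n x)^2 = (\<Sum>j<n. (cmod (cinner n (unitv j) x))^2)"
  by (simp add: cvnorm_sq cinner_unitv)

lemma nn_integral_cgauss_norm: "(\<integral>\<^sup>+x. ennreal ((cvnorm n x)^2) \<partial>cgauss_vec n) = ennreal (real n)"
proof -
  have "(\<integral>\<^sup>+x. ennreal ((cvnorm n x)^2) \<partial>cgauss_vec n)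
     = (\<integral>\<^sup>+x. (\<Sum>j<n. ennreal ((cmod (cinner n (restrict (unitv j) {..<n}) x))^2)) \<partial>cgauss_vec n)"
    by (intro nn_integral_cong) (simp add: cvnorm_sq_unitv)
  also have "\<dots> = (\<Sum>j<n. \<integral>\<^sup>+x. ennreal ((cmod (cinner n (restrict (unitv j) {..<n}) x))^2) \<partial>cgauss_vec n)"
  proof (rule nn_integral_sum)
    fix j
    have [measurable]: "restrict (unitv j) {..<n} \<in> space (cvec_space n)" by (simp add: space_cvec_space)
    show "(\<lambda>x. ennreal ((cmod (cinner n (restrict (unitv j) {..<n}) x))^2)) \<in> borel_measurable (cgauss_vec n)"
      by measurable
  qed
  also have "\<dots> = (\<Sum>j<n. 1)"
  proof (intro sum.cong refl)
    fix j assume j: "j \<in> {..<n}"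
    have "cvnorm n (restrict (unitv j) {..<n}) = 1" using j by (simp add: cvnorm_unitv)
    then show "(\<integral>\<^sup>+x. ennreal ((cmod (cinner n (restrict (unitv j) {..<n}) x))^2) \<partial>cgauss_vec n) = 1"
      using j by (subst nn_integral_cgauss_cinner) (auto simp: expo1_mean)
  qed
  finally show ?thesis by (simp add: ennreal_of_nat_eq_real_of_nat)
qed

lemma AE_cgauss_nonzero: "n \<ge> 1 \<Longrightarrow> AE x in cgauss_vec n. cvnorm n x \<noteq> 0"
proof -
  assume n: "n \<ge> 1"
  have "AE z in cn01. z \<noteq> 0"
    unfolding cn01_def using AE_lborel_singleton[of "0::complex"] by (subst AE_density) auto
  then have "AE x in cgauss_vec n. x 0 \<noteq> 0"
    unfolding cgauss_vec_def using n by (intro AE_PiM_component prob_space_cn01) auto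
  then show ?thesis by eventually_elim (use n in \<open>auto simp: cvnorm_eq_0_iff intro!: exI[of _ 0]\<close>)
qed

text \<open>The event says that |x_0|^2 is at least s times the sum of the other m squared moduli,
  with s = (1-t)/t. Integrating out x_0 turns this into a product of m factors exp(-s |x_i|^2), each
  of mean 1/(1+s) = t.\<close>

lemma cgauss_ratio_tail:
  assumes t: "0 < t" "t \<le> 1"
  shows "(\<integral>\<^sup>+x. indicator {x. (1 - t) * (cvnorm (Suc m) x)^2 \<le> (cmod (x 0))^2} x \<partial>cgauss_vec (Suc m)) = ennreal (t ^ m)"
proof -
  define s where "s = (1 - t) / t"
  have s: "0 \<le> s" "1 / (1 + s) = t" using t by (auto simp: s_def field_simps)
  have ins: "{..<Suc m} = insert 0 {1..m}" by auto
  let ?f = "\<lambda>x. indicator {x. (1 - t) * (cvnorm (Suc m) x)^2 \<le> (cmod (x 0))^2} x :: ennreal"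
  have iff: "(1 - t) * (cvnorm (Suc m) (x(0 := y)))^2 \<le> (cmod y)^2 \<longleftrightarrow> s * (\<Sum>i=1..m. (cmod (x i))^2) \<le> (cmod y)^2" for x y
  proof -
    have "(cvnorm (Suc m) (x(0 := y)))^2 = (cmod y)^2 + (\<Sum>i=1..m. (cmod (x i))^2)"
      unfolding cvnorm_sq ins by (subst sum.insert) (auto intro!: sum.cong)
    then show ?thesis using t by (auto simp: s_def field_simps)
  qed
  have "(\<integral>\<^sup>+x. ?f x \<partial>cgauss_vec (Suc m)) = (\<integral>\<^sup>+x. ?f x \<partial>PiM (insert 0 {1..m}) (\<lambda>_. cn01))"
    by (simp only: cgauss_vec_def ins)
  also have "\<dots> = (\<integral>\<^sup>+x. \<integral>\<^sup>+y. ?f (x(0 := y)) \<partial>cn01 \<partial>PiM {1..m} (\<lambda>_. cn01))"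
  proof (rule cn.product_nn_integral_insert)
    have [measurable]: "(\<lambda>x. cmod (x 0)) \<in> borel_measurable (cvec_space (Suc m))"
      by measurable
    have [measurable]: "(\<lambda>x. (cmod (x 0))^2 - (1 - t) * (cvnorm (Suc m) x)^2) \<in> borel_measurable (cvec_space (Suc m))"
      by measurable
    have "(\<lambda>x. indicator {0..} ((cmod (x 0))^2 - (1 - t) * (cvnorm (Suc m) x)^2) :: ennreal)
        \<in> borel_measurable (cgauss_vec (Suc m))" by measurable
    then have "?f \<in> borel_measurable (cgauss_vec (Suc m))" by (simp add: indicator_def)
    then show "?f \<in> borel_measurable (PiM (insert 0 {1..m}) (\<lambda>_. cn01))"
      by (simp only: cgauss_vec_def ins)
  qed auto
  also have "\<dots> = (\<integral>\<^sup>+x. (\<Prod>i\<in>{1..m}. ennreal (exp (- s * (cmod (x i))^2))) \<partial>PiM {1..m} (\<lambda>_. cn01))"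
  proof (rule nn_integral_cong)
    fix x :: "nat \<Rightarrow> complex"
    let ?a = "s * (\<Sum>i=1..m. (cmod (x i))^2)"
    have a: "0 \<le> ?a" using s by (simp add: sum_nonneg)
    have "(\<integral>\<^sup>+y. ?f (x(0 := y)) \<partial>cn01) = (\<integral>\<^sup>+y. indicator {?a..} ((cmod y)^2) \<partial>cn01)"
      by (intro nn_integral_cong) (auto simp: iff indicator_def)
    also have "\<dots> = (\<integral>\<^sup>+y. indicator {?a..} y \<partial>expo1)"
      by (rule nn_integral_cn01_cmod_sq) measurable
    also have "\<dots> = ennreal (exp (- ?a))" by (rule expo1_tail[OF a])
    also have "exp (- ?a) = (\<Prod>i\<in>{1..m}. exp (- s * (cmod (x i))^2))"
      by (simp add: exp_sum[symmetric] sum_distrib_left sum_negf)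
    also have "ennreal \<dots> = (\<Prod>i\<in>{1..m}. ennreal (exp (- s * (cmod (x i))^2)))"
      by (rule prod_ennreal[symmetric]) simp
    finally show "(\<integral>\<^sup>+y. ?f (x(0 := y)) \<partial>cn01) = (\<Prod>i\<in>{1..m}. ennreal (exp (- s * (cmod (x i))^2)))" .
  qed
  also have "\<dots> = (\<Prod>i\<in>{1..m}. \<integral>\<^sup>+y. ennreal (exp (- s * (cmod y)^2)) \<partial>cn01)"
    by (rule cn.product_nn_integral_prod) auto
  also have "(\<integral>\<^sup>+y. ennreal (exp (- s * (cmod y)^2)) \<partial>cn01) = ennreal t"
    using nn_integral_cn01_cmod_sq[of "\<lambda>t. ennreal (exp (- s * t))"] expo1_exp[OF s(1)] s(2) by simp
  finally show ?thesis using t by (simp add: ennreal_power)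
qed

lemma isotropic_unitD:
  assumes "isotropic_unit n \<mu>"
  shows "prob_space \<mu>" "sets \<mu> = sets (cvec_space n)" "AE x in \<mu>. cvnorm n x = 1" "refl_invariant n \<mu>"
  using assms refl_invariant_isotropic_unit by (auto simp: isotropic_unit_def)

text \<open>An auxiliary Gaussian vector x, independent of c, is averaged over. For fixed x,
  invariance of \<mu> replaces x by |x| \<open>u\<close>; for fixed unit c, invariance of the
  Gaussian law replaces c by a basis vector. Comparing the two orders of integration transfers the
  Gaussian computation to \<mu> without identifying \<mu> as the uniform law on the sphere.\<close>

lemma isotropic_tail:
  assumes iso: "isotropic_unit (Suc m) \<mu>" and t: "0 < t" "t \<le> 1" and u: "cvnorm (Suc m) u = 1"
  shows "(\<integral>\<^sup>+c. indicator {1 - t..} ((cmod (cinner (Suc m) u c))^2) \<partial>\<mu>) = ennreal (t ^ m)"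
proof -
  let ?n = "Suc m"
  note I = isotropic_unitD[OF iso]
  note [measurable_cong] = I(2)
  interpret M: prob_space \<mu> by (rule I)
  interpret G: prob_space "cgauss_vec ?n" by (rule prob_space_cgauss_vec)
  interpret P: pair_sigma_finite "cgauss_vec ?n" \<mu> by standard
  \<comment> \<open>The event is homogeneous in \<open>x\<close>, so the length of the Gaussian
    vector drops out.\<close>
  let ?J = "\<lambda>x c. indicator {(a, b). (1 - t) * b^2 \<le> a^2} (cmod (cinner ?n x c), cvnorm ?n x) :: ennreal"
  have J: "(\<integral>\<^sup>+c. ?J x c \<partial>\<mu>) = (\<integral>\<^sup>+c. indicator {1 - t..} ((cmod (cinner ?n u c))^2) \<partial>\<mu>)"
    if x: "cvnorm ?n x \<noteq> 0" for x
  proof -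
    let ?r = "cvnorm ?n x"
    let ?y = "\<lambda>i. complex_of_real ?r * u i"
    have "(\<integral>\<^sup>+c. indicator {(1 - t) * ?r^2..} ((cmod (cinner ?n x c))^2) \<partial>\<mu>)
      = (\<integral>\<^sup>+c. (indicator {(1 - t) * ?r^2..} ((cmod (cinner ?n ?y c))^2) :: ennreal) \<partial>\<mu>)"
      using u by (intro refl_invariant_cinner[where f="\<lambda>a b. indicator {(1 - t) * ?r^2..} (a^2)"] I)
        (auto simp: cvnorm_scale)
    also have "\<dots> = (\<integral>\<^sup>+c. indicator {1 - t..} ((cmod (cinner ?n u c))^2) \<partial>\<mu>)"
    proof (rule nn_integral_cong)
      fix c
      have "0 < ?r^2" using x by simp
      then show "indicator {(1 - t) * ?r^2..} ((cmod (cinner ?n ?y c))^2) = indicator {1 - t..} ((cmod (cinner ?n u c))^2)"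
        unfolding cinner_scale_left norm_mult power_mult_distrib
        by (simp add: indicator_def mult.commute[of "(cvnorm ?n x)^2"])
    qed
    finally show ?thesis by (simp add: indicator_def cong: if_cong)
  qed
  have "(\<integral>\<^sup>+c. indicator {1 - t..} ((cmod (cinner ?n u c))^2) \<partial>\<mu>) =
     (\<integral>\<^sup>+x. (\<integral>\<^sup>+c. indicator {1 - t..} ((cmod (cinner ?n u c))^2) \<partial>\<mu>) \<partial>cgauss_vec ?n)"
    using G.emeasure_space_1 by simp
  also have "\<dots> = (\<integral>\<^sup>+x. \<integral>\<^sup>+c. ?J x c \<partial>\<mu> \<partial>cgauss_vec ?n)"
  proof (rule nn_integral_cong_AE, rule eventually_mono)
    show "AE x in cgauss_vec ?n. cvnorm ?n x \<noteq> 0" by (rule AE_cgauss_nonzero) simp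
  qed (rule J[symmetric])
  also have "\<dots> = (\<integral>\<^sup>+c. \<integral>\<^sup>+x. ?J x c \<partial>cgauss_vec ?n \<partial>\<mu>)"
    by (rule P.Fubini'[symmetric]) measurable
  also have "\<dots> = (\<integral>\<^sup>+c. ennreal (t ^ m) \<partial>\<mu>)"
  proof (rule nn_integral_cong_AE, rule eventually_mono[OF I(3)])
    fix c assume c: "cvnorm ?n c = 1"
    have "(\<integral>\<^sup>+x. ?J x c \<partial>cgauss_vec ?n) =
       (\<integral>\<^sup>+x. indicator {(a, b). (1 - t) * b^2 \<le> a^2} (cmod (cinner ?n c x), cvnorm ?n x) \<partial>cgauss_vec ?n)"
      by (simp only: cmod_cinner_commute)
    also have "\<dots> = (\<integral>\<^sup>+x. indicator {(a, b). (1 - t) * b^2 \<le> a^2} (cmod (cinner ?n (unitv 0) x), cvnorm ?n x) \<partial>cgauss_vec ?n)"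
      using c by (intro refl_invariant_cinner[where f="\<lambda>a b. indicator {(a, b). (1 - t) * b^2 \<le> a^2} (a, b)"] refl_invariant_cgauss_vec)
       (auto simp: cvnorm_unitv)
    also have "\<dots> = ennreal (t ^ m)"
      using cgauss_ratio_tail[OF t, of m] by (simp add: cinner_unitv indicator_def cong: if_cong)
    finally show "(\<integral>\<^sup>+x. ?J x c \<partial>cgauss_vec ?n) = ennreal (t ^ m)" .
  qed
  also have "\<dots> = ennreal (t ^ m)" using M.emeasure_space_1 by simp
  finally show ?thesis .
qed

text \<open>By invariance the second moment along \<open>a\<close> is |a|^2 times the one along any
  basis vector, and over a basis these add up to the mean of |p|^2, which is 1. The factor
  \<open>L\<close> stands on the left to avoid division in \<open>ennreal\<close>.\<close>

lemma isotropic_second_moment: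
  assumes iso: "isotropic_unit L \<mu>"
  shows "ennreal (real L) * (\<integral>\<^sup>+p. ennreal ((cmod (cinner L a p))^2) \<partial>\<mu>) = ennreal ((cvnorm L a)^2)"
proof -
  note I = isotropic_unitD[OF iso]
  note [measurable_cong] = I(2)
  interpret M: prob_space \<mu> by (rule I)
  let ?Q = "\<lambda>a. \<integral>\<^sup>+p. ennreal ((cmod (cinner L a p))^2) \<partial>\<mu>"
  have um: "(\<lambda>p. ennreal ((cmod (cinner L a p))^2)) \<in> borel_measurable \<mu>" for a
  proof -
    have [measurable]: "restrict a {..<L} \<in> space (cvec_space L)" by (simp add: space_cvec_space)
    have "(\<lambda>p. ennreal ((cmod (cinner L (restrict a {..<L}) p))^2)) \<in> borel_measurable \<mu>" by measurable
    then show ?thesis by simp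
  qed
  have sc: "?Q (\<lambda>i. complex_of_real r * a i) = ennreal (r^2) * ?Q a" for r a
    by (subst nn_integral_cmult[symmetric, OF um])
       (simp add: cinner_scale_left norm_mult power_mult_distrib ennreal_mult')
  have "?Q a = ennreal ((cvnorm L a)^2) * ?Q (unitv j)" if j: "j < L" for j
  proof -
    have "?Q a = ?Q (\<lambda>i. complex_of_real (cvnorm L a) * unitv j i)"
      using j by (intro refl_invariant_cinner[where f="\<lambda>a b. ennreal (a^2)"] I) (auto simp: cvnorm_scale cvnorm_unitv)
    then show ?thesis by (simp add: sc)
  qed
  then have "(\<Sum>j<L. ?Q a) = (\<Sum>j<L. ennreal ((cvnorm L a)^2) * ?Q (unitv j))" by (intro sum.cong) auto
  also have "\<dots> = ennreal ((cvnorm L a)^2) * (\<Sum>j<L. ?Q (unitv j))" by (simp add: sum_distrib_left)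
  also have "(\<Sum>j<L. ?Q (unitv j)) = (\<integral>\<^sup>+p. (\<Sum>j<L. ennreal ((cmod (cinner L (unitv j) p))^2)) \<partial>\<mu>)"
    by (rule nn_integral_sum[symmetric]) (rule um)
  also have "\<dots> = (\<integral>\<^sup>+p. 1 \<partial>\<mu>)"
    by (rule nn_integral_cong_AE, rule eventually_mono[OF I(3)]) (simp add: sum_ennreal cvnorm_sq_unitv[symmetric])
  also have "\<dots> = 1" using M.emeasure_space_1 by simp
  finally show ?thesis by (simp add: ennreal_of_nat_eq_real_of_nat)
qed

text \<open>\<open>S\<close> is to be the error of the codeword fed back, and all that matters is
  that it lies below the error of every codeword. Its value is the length of the interval of t with
  0 < t < S; such a t lies below all codeword errors, and for independent codewords the probability
  of this is the power (1 - t^m)^(card J).\<close>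

lemma quantization_error_bound:
  assumes m: "m \<ge> 1" and J: "finite J" "J \<noteq> {}"
    and iso: "\<And>l. l \<in> J \<Longrightarrow> isotropic_unit (Suc m) (\<mu> l)"
    and u: "cvnorm (Suc m) u = 1"
    and S: "\<And>C l. l \<in> J \<Longrightarrow> S C \<le> 1 - (cmod (cinner (Suc m) u (C l)))^2"
  shows "(\<integral>\<^sup>+C. ennreal (S C) \<partial>PiM J \<mu>) \<le> ennreal (Gamma (1 + 1 / real m) * real (card J) powr (- 1 / real m))"
proof -
  let ?N = "Suc m"
  \<comment> \<open>\<open>product_sigma_finite\<close> makes a demand at every index, so \<mu> is
    extended from \<open>J\<close> by one of its own members.\<close>
  define \<nu> where "\<nu> l = (if l \<in> J then \<mu> l else \<mu> (SOME l. l \<in> J))" for l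
  have iso': "isotropic_unit ?N (\<nu> l)" for l using iso some_in_eq[of J] J by (auto simp: \<nu>_def)
  have \<nu>: "prob_space (\<nu> l)" "sets (\<nu> l) = sets (cvec_space ?N)" for l
    using isotropic_unitD[OF iso'] by auto
  note [measurable_cong] = \<nu>(2)
  interpret N: product_sigma_finite \<nu>
    by (simp add: product_sigma_finite_def \<nu> prob_space_imp_sigma_finite)
  have pi: "PiM J \<mu> = PiM J \<nu>" by (intro PiM_cong) (auto simp: \<nu>_def)
  interpret F: finite_product_sigma_finite \<nu> J by standard (rule J)
  interpret P: pair_sigma_finite "PiM J \<nu>" lborel by standard
  let ?v = "restrict u {..<?N}"
  have vn: "cvnorm ?N ?v = 1" using u by simp
  have vs [measurable]: "?v \<in> space (cvec_space ?N)" by (simp add: space_cvec_space)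
  \<comment> \<open>The indicator of a set of pairs makes the integrand jointly measurable in
    \<open>t\<close> and \<open>c\<close>, as Fubini requires.\<close>
  let ?g = "\<lambda>t c. indicator {z. fst z < 1 - snd z} (t, (cmod (cinner ?N ?v c))^2) :: ennreal"
  have "(\<integral>\<^sup>+C. ennreal (S C) \<partial>PiM J \<nu>) \<le>
    (\<integral>\<^sup>+C. \<integral>\<^sup>+t. indicator {0<..<1} t * (\<Prod>l\<in>J. ?g t (C l)) \<partial>lborel \<partial>PiM J \<nu>)"
  proof (rule nn_integral_mono)
    fix C
    have "ennreal (S C) = (\<integral>\<^sup>+t. indicator {0<..<S C} t \<partial>lborel)"
      by (cases "0 \<le> S C") (auto simp: ennreal_neg)
    also have "\<dots> \<le> (\<integral>\<^sup>+t. indicator {0<..<1} t * (\<Prod>l\<in>J. ?g t (C l)) \<partial>lborel)"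
    proof (rule nn_integral_mono)
      fix t :: real
      show "indicator {0<..<S C} t \<le> indicator {0<..<1} t * (\<Prod>l\<in>J. ?g t (C l))"
      proof (cases "t \<in> {0<..<S C}")
        case True
        have "t < 1 - (cmod (cinner ?N ?v (C l)))^2" if "l \<in> J" for l
          using S[OF that, of C] True by auto
        then have "(\<Prod>l\<in>J. ?g t (C l)) = (\<Prod>l\<in>J. 1)" by (intro prod.cong) auto
        moreover obtain l where l: "l \<in> J" using J by blast
        have "t < 1" using S[OF l, of C] True zero_le_power2[of "cmod (cinner ?N u (C l))"]
          by (simp only: greaterThanLessThan_iff) linarith
        ultimately show ?thesis using True by simp
      qed simp
    qed
    finally show "ennreal (S C) \<le> (\<integral>\<^sup>+t. indicator {0<..<1} t * (\<Prod>l\<in>J. ?g t (C l)) \<partial>lborel)" .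
  qed
  also have "\<dots> = (\<integral>\<^sup>+t. \<integral>\<^sup>+C. indicator {0<..<1} t * (\<Prod>l\<in>J. ?g t (C l)) \<partial>PiM J \<nu> \<partial>lborel)"
    by (rule P.Fubini'[symmetric]) measurable
  also have "\<dots> = (\<integral>\<^sup>+t. indicator {0<..<1} t * ennreal (1 - t ^ m) ^ card J \<partial>lborel)"
  proof (rule nn_integral_cong)
    fix t :: real
    show "(\<integral>\<^sup>+C. indicator {0<..<1} t * (\<Prod>l\<in>J. ?g t (C l)) \<partial>PiM J \<nu>) = indicator {0<..<1} t * ennreal (1 - t ^ m) ^ card J"
    proof (cases "t \<in> {0<..<1}")
      case t: True
      have one: "(\<integral>\<^sup>+c. ?g t c \<partial>\<nu> l) = ennreal (1 - t ^ m)" if "l \<in> J" for l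
      proof -
        interpret M: prob_space "\<nu> l" by (rule \<nu>)
        let ?A = "{c \<in> space (\<nu> l). 1 - t \<le> (cmod (cinner ?N ?v c))^2}"
        have A [measurable]: "?A \<in> sets (\<nu> l)" by measurable
        have "(\<integral>\<^sup>+c. indicator {1 - t..} ((cmod (cinner ?N ?v c))^2) \<partial>\<nu> l) = emeasure (\<nu> l) ?A"
          by (subst nn_integral_indicator[symmetric, OF A]) (auto intro!: nn_integral_cong split: split_indicator)
        then have "emeasure (\<nu> l) ?A = ennreal (t ^ m)"
          using isotropic_tail[OF iso' _ _ vn, of t l] t by simp
        then have pA: "M.prob ?A = t ^ m" using t by (simp add: measure_def)
        have "(\<integral>\<^sup>+c. ?g t c \<partial>\<nu> l) = emeasure (\<nu> l) (space (\<nu> l) - ?A)"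
          by (subst nn_integral_indicator[symmetric], measurable) (auto intro!: nn_integral_cong split: split_indicator)
        also have "\<dots> = ennreal (1 - t ^ m)"
          using M.prob_compl[OF A] pA by (simp only: M.emeasure_eq_measure)
        finally show ?thesis .
      qed
      have "(\<integral>\<^sup>+C. (\<Prod>l\<in>J. ?g t (C l)) \<partial>PiM J \<nu>) = (\<Prod>l\<in>J. \<integral>\<^sup>+c. ?g t c \<partial>\<nu> l)"
      proof (rule N.product_nn_integral_prod)
        show "?g t \<in> borel_measurable (\<nu> l)" for l by measurable
      qed (rule J)
      also have "\<dots> = (\<Prod>l\<in>J. ennreal (1 - t ^ m))" by (intro prod.cong refl) (rule one, simp)
      also have "\<dots> = ennreal (1 - t ^ m) ^ card J" by simp
      finally show ?thesis using t by simp
    qed simp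
  qed
  also have "\<dots> \<le> ennreal (Gamma (1 + 1 / real m) * real (card J) powr (- 1 / real m))"
    using J by (intro beta_min_bound[OF m]) (simp add: Suc_le_eq card_gt_0_iff)
  finally show ?thesis by (simp add: pi)
qed

section \<open>Projection onto a null space by Gram-Schmidt residuals\<close>

text \<open>The component of \<open>x\<close> orthogonal to the span of the list, in closed form:
  each step removes the component along the residual of the next vector. Division by zero yields 0,
  so a vector that depends linearly on the later entries of the list removes nothing.\<close>

fun gs_residual :: "nat \<Rightarrow> (nat \<Rightarrow> complex) list \<Rightarrow> (nat \<Rightarrow> complex) \<Rightarrow> nat \<Rightarrow> complex" where
  "gs_residual n [] x = x"
| "gs_residual n (a # as) x = (\<lambda>i. gs_residual n as x i -
     cinner n (gs_residual n as x) (gs_residual n as a) / cinner n (gs_residual n as a) (gs_residual n as a) * gs_residual n as a i)"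

text \<open>Agreement is asked on the first \<open>n\<close> coordinates because reflections
  restrict their values to these, while the residual is formed for total functions.\<close>

lemma gs_residual_cong:
  assumes "list_all2 (\<lambda>a b. \<forall>i<n. a i = b i) as bs" "\<forall>i<n. x i = y i"
  shows "\<forall>i<n. gs_residual n as x i = gs_residual n bs y i"
  using assms
proof (induction as bs arbitrary: x y rule: list_all2_induct)
  case (Cons a as b bs)
  have 1: "\<forall>i<n. gs_residual n as x i = gs_residual n bs y i" "\<forall>i<n. gs_residual n as a i = gs_residual n bs b i"
    using Cons by auto
  then have "cinner n (gs_residual n as x) (gs_residual n as a) = cinner n (gs_residual n bs y) (gs_residual n bs b)"
    "cinner n (gs_residual n as a) (gs_residual n as a) = cinner n (gs_residual n bs b) (gs_residual n bs b)"
    by (auto intro!: cinner_cong)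
  then show ?case using 1 by simp
qed simp

lemma gs_residual_linear:
  "gs_residual n as (\<lambda>i. x i - c * y i) = (\<lambda>i. gs_residual n as x i - c * gs_residual n as y i)"
proof (induction as arbitrary: x y c)
  case (Cons a as)
  show ?case
    by (auto simp: Cons fun_eq_iff cinner_diff_left cinner_scale_left diff_divide_distrib algebra_simps)
qed simp

lemma gs_residual_scale: "gs_residual n as (\<lambda>i. c * y i) = (\<lambda>i. c * gs_residual n as y i)"
proof (induction as arbitrary: y c)
  case (Cons a as)
  show ?case by (auto simp: Cons fun_eq_iff cinner_scale_left algebra_simps)
qed simp

lemma cinner_self_eq_0_iff: "cinner n x x = 0 \<longleftrightarrow> (\<forall>i<n. x i = 0)"
  by (simp add: cinner_self cvnorm_eq_0_iff)

text \<open>The two facts need each other. Orthogonality to the head \<open>b\<close> is reduced to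
  orthogonality to the residual of \<open>b\<close>, and this exchange is the second fact for the
  shorter list. The second fact says that a vector orthogonal to the list does not see what was
  removed.\<close>

lemma gs_residual_orth: "a \<in> set as \<Longrightarrow> cinner n (gs_residual n as x) a = 0"
  and gs_residual_orth_conv: "(\<And>c. c \<in> set as \<Longrightarrow> cinner n c v = 0) \<Longrightarrow> cinner n (gs_residual n as x) v = cinner n x v"
proof (induction as arbitrary: x a v)
  case (Cons b bs)
  {
    case 1
    let ?r = "gs_residual n bs x" and ?b = "gs_residual n bs b"
    let ?k = "cinner n ?r ?b / cinner n ?b ?b"
    show ?case
    proof (cases "a = b")
      case False
      with 1 have "a \<in> set bs" by simp
      then show ?thesis
        by (simp only: gs_residual.simps cinner_diff_left cinner_scale_left Cons.IH(1)[of a]) simp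
    next
      case True
      have o: "cinner n c (\<lambda>i. ?r i - ?k * ?b i) = 0" if "c \<in> set bs" for c
        unfolding cinner_diff_right cinner_scale_right
        using Cons.IH(1)[OF that, of x] Cons.IH(1)[OF that, of b] by (simp add: cinner_commute[of n c])
      have "cinner n b (\<lambda>i. ?r i - ?k * ?b i) = cinner n ?b (\<lambda>i. ?r i - ?k * ?b i)"
        by (rule Cons.IH(2)[OF o, symmetric])
      also have "\<dots> = cnj (cinner n (\<lambda>i. ?r i - ?k * ?b i) ?b)" by (rule cinner_commute)
      also have "cinner n (\<lambda>i. ?r i - ?k * ?b i) ?b = 0"
      proof (cases "cinner n ?b ?b = 0")
        case True
        then have "\<forall>i<n. ?b i = 0" by (simp only: cinner_self_eq_0_iff)
        then have "cinner n ?r ?b = 0" by (simp add: cinner_def)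
        then show ?thesis by (simp only: cinner_diff_left cinner_scale_left) simp
      next
        case False
        then show ?thesis by (simp only: cinner_diff_left cinner_scale_left) simp
      qed
      finally show ?thesis unfolding True using cinner_commute[of n "\<lambda>i. ?r i - ?k * ?b i" b] by simp
    qed
  next
    case 2
    have "cinner n (gs_residual n bs y) a = cinner n y a" for y
      using 2 by (intro Cons.IH(2)) simp
    moreover have "cinner n b a = 0" using 2 by simp
    ultimately show ?case by (simp only: gs_residual.simps cinner_diff_left cinner_scale_left) simp
  }
qed simp_all

text \<open>With r the residual of \<open>a\<close>, r is orthogonal to the list, hence <r,r> =
  <a,r> = 0.\<close>

lemma gs_residual_eq_0:
  assumes "a \<in> set as" "i < n"
  shows "gs_residual n as a i = 0"
proof -
  have "cinner n (gs_residual n as a) (gs_residual n as a) = cinner n a (gs_residual n as a)"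
    by (rule gs_residual_orth_conv) (metis cinner_commute complex_cnj_zero gs_residual_orth)
  also have "\<dots> = 0" using gs_residual_orth[OF assms(1)] by (metis cinner_commute complex_cnj_zero)
  finally show ?thesis using assms(2) by (simp add: cinner_self_eq_0_iff)
qed

lemma householder_scale: "householder n a (\<lambda>i. c * x i) = (\<lambda>i\<in>{..<n}. c * householder n a x i)"
  by (auto simp: householder_def fun_eq_iff cinner_scale_left algebra_simps)

text \<open>The coefficients in the recursion are built from inner products, which a reflection
  preserves. An arbitrary selection of null-space bases offers no such equivariance.\<close>

lemma gs_residual_householder: "\<forall>i<n. gs_residual n (map (householder n a) as) (householder n a x) i = householder n a (gs_residual n as x) i"
proof (induction as arbitrary: x)
  case (Cons b bs)
  let ?r = "gs_residual n bs x" and ?b = "gs_residual n bs b"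
  let ?k = "cinner n ?r ?b / cinner n ?b ?b"
  have "cinner n (gs_residual n (map (householder n a) bs) (householder n a x)) (gs_residual n (map (householder n a) bs) (householder n a b)) = cinner n (householder n a ?r) (householder n a ?b)"
     "cinner n (gs_residual n (map (householder n a) bs) (householder n a b)) (gs_residual n (map (householder n a) bs) (householder n a b)) = cinner n (householder n a ?b) (householder n a ?b)"
    using Cons by (auto intro!: cinner_cong)
  moreover have "householder n a (\<lambda>i. ?r i - ?k * ?b i) i = householder n a ?r i - ?k * householder n a ?b i" if "i < n" for i
    using that by (simp only: householder_diff householder_scale) simp
  ultimately show ?case using Cons by (simp add: cinner_householder)
qed simp

lemma cvnorm_gs_residual_householder:
  "cvnorm n (gs_residual n (map (householder n a) as) (householder n a x)) = cvnorm n (gs_residual n as x)"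
proof -
  have "cvnorm n (gs_residual n (map (householder n a) as) (householder n a x)) = cvnorm n (householder n a (gs_residual n as x))"
    using gs_residual_householder by (intro cvnorm_cong) auto
  then show ?thesis by (simp add: cvnorm_householder)
qed

lemma borel_measurable_cinner_comp:
  assumes "\<And>i. i < n \<Longrightarrow> (\<lambda>w. f w i) \<in> borel_measurable N" "\<And>i. i < n \<Longrightarrow> (\<lambda>w. g w i) \<in> borel_measurable N"
  shows "(\<lambda>w. cinner n (f w) (g w)) \<in> borel_measurable N"
  unfolding cinner_def using assms by (intro borel_measurable_sum borel_measurable_times borel_measurable_cnj) auto

text \<open>The list of labels \<open>us\<close> is fixed while the labelled vectors
  \<open>f w u\<close> vary with \<open>w\<close>; the induction thus runs over a list that does not
  depend on the outcome.\<close>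

lemma borel_measurable_gs_residual:
  assumes "\<And>u i. u \<in> set us \<Longrightarrow> i < n \<Longrightarrow> (\<lambda>w. f w u i) \<in> borel_measurable N"
    and "\<And>i. i < n \<Longrightarrow> (\<lambda>w. x w i) \<in> borel_measurable N" and "i < n"
  shows "(\<lambda>w. gs_residual n (map (f w) us) (x w) i) \<in> borel_measurable N"
  using assms
proof (induction us arbitrary: x i)
  case (Cons u us)
  have [measurable]: "(\<lambda>w. gs_residual n (map (f w) us) (x w) i) \<in> borel_measurable N"
    "(\<lambda>w. gs_residual n (map (f w) us) (f w u) i) \<in> borel_measurable N" if "i < n" for i
    using Cons that by auto
  have [measurable]: "(\<lambda>w. cinner n (gs_residual n (map (f w) us) (x w)) (gs_residual n (map (f w) us) (f w u))) \<in> borel_measurable N"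
    "(\<lambda>w. cinner n (gs_residual n (map (f w) us) (f w u)) (gs_residual n (map (f w) us) (f w u))) \<in> borel_measurable N"
    by (intro borel_measurable_cinner_comp; measurable)+
  show ?case using Cons.prems(3) by simp measurable
qed simp

lemma borel_measurable_cvnorm_gs_residual:
  assumes "\<And>u. u \<in> set us \<Longrightarrow> (\<lambda>w. f w u) \<in> N \<rightarrow>\<^sub>M cvec_space n"
    and "\<And>i. i < n \<Longrightarrow> (\<lambda>w. x w i) \<in> borel_measurable N"
  shows "(\<lambda>w. cvnorm n (gs_residual n (map (f w) us) (x w))) \<in> borel_measurable N"
proof -
  have [measurable]: "(\<lambda>w. gs_residual n (map (f w) us) (x w) i) \<in> borel_measurable N" if "i < n" for i
    using assms that
    by (intro borel_measurable_gs_residual) (auto intro: measurable_compose[OF _ measurable_cvec_component])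
  show ?thesis unfolding cvnorm_def by measurable
qed

lemma onb_null_expand:
  assumes V: "onb_null M L A V" and z: "\<forall>a\<in>A. (\<Sum>i<M. a i * z i) = 0" and i: "i < M"
  shows "z i = (\<Sum>l<L. cinner M z (\<lambda>j. V j l) * V i l)"
proof -
  from V z obtain c where c: "\<forall>i<M. z i = (\<Sum>l<L. c l * V i l)" unfolding onb_null_def by blast
  have "cinner M z (\<lambda>j. V j m) = c m" if m: "m < L" for m
  proof -
    have "cinner M z (\<lambda>j. V j m) = (\<Sum>i<M. \<Sum>l<L. c l * V i l * cnj (V i m))"
      unfolding cinner_def using c by (intro sum.cong) (auto simp: sum_distrib_right)
    also have "\<dots> = (\<Sum>l<L. c l * (\<Sum>i<M. cnj (V i m) * V i l))"
      by (subst sum.swap) (simp add: sum_distrib_left mult_ac)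
    also have "\<dots> = (\<Sum>l<L. if l = m then c l else 0)"
      using V m unfolding onb_null_def by (intro sum.cong) auto
    finally show ?thesis using m by simp
  qed
  then show ?thesis using c i by simp
qed

text \<open>The columns of \<open>V\<close> are annihilated bilinearly, so their conjugates are
  orthogonal to \<open>as\<close>; hence \<open>x\<close> may be replaced by its residual r. The
  conjugate of r lies in the null space, and Parseval in the basis \<open>V\<close> gives
  |r|^2.\<close>

lemma onb_null_gain:
  assumes V: "onb_null M L (set as) V"
  shows "(\<Sum>l<L. (cmod (\<Sum>i<M. x i * V i l))^2) = (cvnorm M (gs_residual M as x))^2"
proof -
  let ?r = "gs_residual M as x"
  let ?z = "\<lambda>i. cnj (?r i)"
  have conv: "(\<Sum>i<M. y i * v i) = cinner M y (\<lambda>i. cnj (v i))" for y v by (simp add: cinner_def)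
  have xr: "(\<Sum>i<M. x i * V i l) = (\<Sum>i<M. ?r i * V i l)" if "l < L" for l
    unfolding conv using V that
    by (intro gs_residual_orth_conv[symmetric]) (auto simp: onb_null_def cinner_def)
  have "(\<Sum>i<M. a i * ?z i) = 0" if "a \<in> set as" for a
    using gs_residual_orth[OF that, of M x] cinner_commute[of M a ?r] by (simp add: cinner_def)
  then have "\<forall>a\<in>set as. (\<Sum>i<M. a i * ?z i) = 0" by (rule ballI)
  note z = onb_null_expand[OF V this]
  have zc: "cinner M ?z (\<lambda>j. V j l) = cnj (\<Sum>i<M. ?r i * V i l)" for l
    by (simp add: cinner_def)
  have "complex_of_real ((cvnorm M ?r)^2) = (\<Sum>i<M. ?r i * ?z i)"
    unfolding cinner_self[symmetric] by (simp add: cinner_def)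
  also have "\<dots> = (\<Sum>i<M. \<Sum>l<L. ?r i * (cnj (\<Sum>i<M. ?r i * V i l) * V i l))"
    by (intro sum.cong refl) (simp add: z zc sum_distrib_left)
  also have "\<dots> = (\<Sum>l<L. cnj (\<Sum>i<M. ?r i * V i l) * (\<Sum>i<M. ?r i * V i l))"
    by (subst sum.swap, intro sum.cong refl, subst sum_distrib_left, intro sum.cong refl) (simp only: mult_ac)
  also have "\<dots> = complex_of_real (\<Sum>l<L. (cmod (\<Sum>i<M. ?r i * V i l))^2)"
    unfolding of_real_sum by (intro sum.cong refl) (simp only: complex_norm_square mult.commute)
  finally have "(cvnorm M ?r)^2 = (\<Sum>l<L. (cmod (\<Sum>i<M. ?r i * V i l))^2)"
    by (simp only: of_real_eq_iff)
  moreover have "(\<Sum>l<L. (cmod (\<Sum>i<M. x i * V i l))^2) = (\<Sum>l<L. (cmod (\<Sum>i<M. ?r i * V i l))^2)"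
    by (intro sum.cong refl) (simp only: xr lessThan_iff)
  ultimately show ?thesis by simp
qed

text \<open>Both sides are the trace of the projection: the sum of all |V_jl|^2, taken along the
  rows on the left and along the normalised columns on the right.\<close>

lemma onb_null_trace:
  assumes V: "onb_null M L (set as) V"
  shows "(\<Sum>j<M. (cvnorm M (gs_residual M as (unitv j)))^2) = real L"
proof -
  have V1: "(\<Sum>i<M. (cmod (V i l))^2) = 1" if "l < L" for l
  proof -
    have "complex_of_real (\<Sum>i<M. (cmod (V i l))^2) = (\<Sum>i<M. cnj (V i l) * V i l)"
      unfolding of_real_sum by (intro sum.cong refl) (simp only: complex_norm_square mult.commute)
    also have "\<dots> = 1" using V that by (auto simp: onb_null_def)
    finally show ?thesis by (metis of_real_eq_1_iff)
  qed
  have u: "(\<Sum>i<M. unitv j i * V i l) = V j l" if "j < M" for j l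
  proof -
    have "(\<Sum>i<M. unitv j i * V i l) = (\<Sum>i<M. if i = j then V i l else 0)"
      unfolding unitv_def by (intro sum.cong) auto
    then show ?thesis using that by simp
  qed
  have "(\<Sum>j<M. (cvnorm M (gs_residual M as (unitv j)))^2) = (\<Sum>j<M. \<Sum>l<L. (cmod (V j l))^2)"
    by (intro sum.cong refl) (simp add: onb_null_gain[OF V, symmetric] u)
  also have "\<dots> = (\<Sum>l<L. \<Sum>j<M. (cmod (V j l))^2)" by (rule sum.swap)
  also have "\<dots> = real L" by (simp add: V1)
  finally show ?thesis .
qed

lemma distr_PiM_compose_householder:
  assumes J: "finite J" and \<mu>: "\<And>u. u \<in> J \<Longrightarrow> prob_space (\<mu> u)" "\<And>u. u \<in> J \<Longrightarrow> refl_invariant n (\<mu> u)"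
  shows "distr (PiM J \<mu>) (PiM J (\<lambda>_. cvec_space n)) (compose J (householder n a)) = PiM J \<mu>"
proof -
  \<comment> \<open>\<open>cgauss_vec n\<close> fills the indices outside \<open>J\<close>, where
    nothing is assumed about \<mu>, with a reflection-invariant probability law.\<close>
  define \<nu> where "\<nu> u = (if u \<in> J then \<mu> u else cgauss_vec n)" for u
  have \<nu>: "prob_space (\<nu> u)" "refl_invariant n (\<nu> u)" for u
    using \<mu> prob_space_cgauss_vec refl_invariant_cgauss_vec by (auto simp: \<nu>_def)
  have pi: "PiM J \<mu> = PiM J \<nu>" by (intro PiM_cong) (auto simp: \<nu>_def)
  have s: "sets (\<nu> u) = sets (cvec_space n)" for u using \<nu>(2) by (simp add: refl_invariant_def)
  have "distr (PiM J \<nu>) (PiM J \<nu>) (compose J (householder n a)) = PiM J (\<lambda>u. distr (\<nu> u) (\<nu> u) (householder n a))"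
  proof (rule distr_PiM_finite_prob_space[OF J])
    show "product_prob_space \<nu>" "product_prob_space \<nu>" using \<nu> by (auto intro: product_prob_spaceI)
    show "householder n a \<in> \<nu> u \<rightarrow>\<^sub>M \<nu> u" for u
      using measurable_householder[of "\<lambda>x. x" "cvec_space n" n a] measurable_cong_sets[OF s s] by auto
  qed
  also have "(\<lambda>u. distr (\<nu> u) (\<nu> u) (householder n a)) = \<nu>"
  proof
    fix u
    have "distr (\<nu> u) (\<nu> u) (householder n a) = distr (\<nu> u) (cvec_space n) (householder n a)"
      by (intro distr_cong s refl)
    also have "\<dots> = \<nu> u" using \<nu>(2) by (simp add: refl_invariant_def)
    finally show "distr (\<nu> u) (\<nu> u) (householder n a) = \<nu> u" .
  qed
  also have "distr (PiM J \<nu>) (PiM J \<nu>) (compose J (householder n a)) = distr (PiM J \<nu>) (PiM J (\<lambda>_. cvec_space n)) (compose J (householder n a))"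
    by (intro distr_cong sets_PiM_cong s refl)
  finally show ?thesis by (simp add: pi)
qed

section \<open>Mean of the projection, and the quantised channel\<close>

lemma cvnorm_minus_proj:
  assumes g: "cvnorm n g = 1"
  shows "(cvnorm n (\<lambda>i. x i - cinner n x g * g i))^2 = (cvnorm n x)^2 - (cmod (cinner n x g))^2"
    and "cinner n (\<lambda>i. x i - cinner n x g * g i) g = 0"
proof -
  let ?p = "\<lambda>i. x i - cinner n x g * g i"
  have gg: "cinner n g g = 1" using g by (simp add: cinner_self)
  show o: "cinner n ?p g = 0" by (simp add: cinner_diff_left cinner_scale_left gg)
  have "cinner n ?p ?p = cinner n ?p x - cnj (cinner n x g) * cinner n ?p g"
    by (simp add: cinner_diff_right cinner_scale_right)
  also have "\<dots> = cinner n x x - cinner n x g * cinner n g x"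
    by (simp add: o) (simp add: cinner_diff_left cinner_scale_left)
  also have "cinner n x g * cinner n g x = complex_of_real ((cmod (cinner n x g))^2)"
    unfolding complex_norm_square using cinner_commute[of n g x] by simp
  finally have "complex_of_real ((cvnorm n ?p)^2) = complex_of_real ((cvnorm n x)^2 - (cmod (cinner n x g))^2)"
    by (simp add: cinner_self)
  then show "(cvnorm n ?p)^2 = (cvnorm n x)^2 - (cmod (cinner n x g))^2"
    by (simp only: of_real_eq_iff)
qed

text \<open>Averaged over invariant \<open>Y\<close>, the squared residual of \<open>x\<close> depends only on the norm of the
  component of \<open>x\<close> orthogonal to \<open>g\<close>; the factor is then determined by the trace.\<close>
lemma mean_gs_residual:
  assumes \<mu>: "\<And>u. u \<in> set us \<Longrightarrow> prob_space (\<mu> u)" "\<And>u. u \<in> set us \<Longrightarrow> refl_invariant M (\<mu> u)"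
    and g: "cvnorm M g = 1"
    and trace: "AE Y in PiM (set us) \<mu>. (\<Sum>j<M. (cvnorm M (gs_residual M (g # map Y us) (unitv j)))^2) = real L"
  shows "ennreal (real M - 1) * (\<integral>\<^sup>+Y. ennreal ((cvnorm M (gs_residual M (g # map Y us) x))^2) \<partial>PiM (set us) \<mu>)
    = ennreal (real L * ((cvnorm M x)^2 - (cmod (cinner M x g))^2))"
proof -
  let ?J = "set us"
  let ?P = "PiM ?J \<mu>"
  have s [measurable_cong]: "sets ?P = sets (PiM ?J (\<lambda>_. cvec_space M))"
    using \<mu>(2) by (intro sets_PiM_cong) (auto simp: refl_invariant_def)
  interpret P: prob_space ?P by (intro prob_space_PiM \<mu>)
  let ?q = "\<lambda>x Y. (cvnorm M (gs_residual M (g # map Y us) x))^2"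
  let ?Q = "\<lambda>x. \<integral>\<^sup>+Y. ennreal (?q x Y) \<partial>?P"
  let ?perp = "\<lambda>x i. x i - cinner M x g * g i"
  have meas: "(\<lambda>Y. ?q x Y) \<in> borel_measurable (PiM ?J (\<lambda>_. cvec_space M))" for x
  proof -
    \<comment> \<open>The label \<open>None\<close> stands for the constant \<open>g\<close> and
      \<open>Some u\<close> for \<open>Y u\<close>. This brings the list into the shape
      \<open>map (f w) us\<close> with a fixed label list.\<close>
    have "(\<lambda>Y. cvnorm M (gs_residual M (map (\<lambda>v. case v of None \<Rightarrow> restrict g {..<M} | Some u \<Rightarrow> Y u) (None # map Some us)) x))
        \<in> borel_measurable (PiM ?J (\<lambda>_. cvec_space M))"
    proof (rule borel_measurable_cvnorm_gs_residual)
      fix v assume v: "v \<in> set (None # map Some us)"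
      show "(\<lambda>Y. case v of None \<Rightarrow> restrict g {..<M} | Some u \<Rightarrow> Y u) \<in> PiM ?J (\<lambda>_. cvec_space M) \<rightarrow>\<^sub>M cvec_space M"
        using v by (auto split: option.split intro!: measurable_component_singleton simp: space_cvec_space)
    qed simp
    moreover have "cvnorm M (gs_residual M (map (\<lambda>v. case v of None \<Rightarrow> restrict g {..<M} | Some u \<Rightarrow> Y u) (None # map Some us)) x)
       = cvnorm M (gs_residual M (g # map Y us) x)" for Y
      by (intro cvnorm_cong gs_residual_cong[rule_format])
         (auto simp: list_all2_map1 list_all2_map2 comp_def intro!: list.rel_refl_strong)
    ultimately have [measurable]: "(\<lambda>Y. cvnorm M (gs_residual M (g # map Y us) x)) \<in> borel_measurable (PiM ?J (\<lambda>_. cvec_space M))"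
      by (simp only:)
    show ?thesis by (intro borel_measurable_power) measurable
  qed
  have meas' [measurable]: "(\<lambda>Y. ?q x Y) \<in> borel_measurable ?P" for x
    using meas measurable_cong_sets[OF s refl] by blast
  have scale: "?Q (\<lambda>i. complex_of_real r * x i) = ennreal (r^2) * ?Q x" for r x
    unfolding gs_residual_scale cvnorm_scale power_mult_distrib
    by (subst nn_integral_cmult[symmetric]) (auto simp: ennreal_mult' simp del: gs_residual.simps)
  have phase: "?Q (\<lambda>i. \<psi> * x i) = ?Q x" if "cmod \<psi> = 1" for \<psi> x
    unfolding gs_residual_scale cvnorm_scale that by simp
  have perp: "?Q (?perp x) = ?Q x" for x
  proof -
    have "cvnorm M (gs_residual M (g # map Y us) (?perp x)) = cvnorm M (gs_residual M (g # map Y us) x)" for Y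
    proof (rule cvnorm_cong)
      fix i assume "i < M"
      then have "gs_residual M (g # map Y us) g i = 0" by (intro gs_residual_eq_0) auto
      then show "gs_residual M (g # map Y us) (?perp x) i = gs_residual M (g # map Y us) x i"
        unfolding gs_residual_linear by simp
    qed
    then show ?thesis by (simp del: gs_residual.simps)
  qed
  \<comment> \<open>The reflection vector \<open>x - \<psi> y\<close> is orthogonal to
    \<open>g\<close>, so the reflection fixes \<open>g\<close> and acts only on \<open>Y\<close>,
    whose law it preserves.\<close>
  have rot: "?Q x = ?Q y" if xg: "cinner M x g = 0" and yg: "cinner M y g = 0" and xy: "cvnorm M x = cvnorm M y" for x y
  proof -
    obtain \<psi> where \<psi>: "cmod \<psi> = 1" and H: "\<forall>i<M. householder M (\<lambda>i. x i - \<psi> * y i) x i = \<psi> * y i"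
      using householder_maps[OF xy] by metis
    let ?a = "\<lambda>i. x i - \<psi> * y i"
    have "cinner M ?a g = 0" using xg yg by (simp add: cinner_diff_left cinner_scale_left)
    then have ga: "cinner M g ?a = 0" using cinner_commute[of M g ?a] by simp
    have eqv: "?q (\<lambda>i. \<psi> * y i) (compose ?J (householder M ?a) Y) = ?q x Y" for Y
    proof -
      have "cvnorm M (gs_residual M (g # map (compose ?J (householder M ?a) Y) us) (\<lambda>i. \<psi> * y i))
         = cvnorm M (gs_residual M (map (householder M ?a) (g # map Y us)) (householder M ?a x))"
      proof (rule cvnorm_cong, rule gs_residual_cong[rule_format])
        show "list_all2 (\<lambda>a b. \<forall>i<M. a i = b i) (g # map (compose ?J (householder M ?a) Y) us) (map (householder M ?a) (g # map Y us))"
          by (auto simp: householder_fix[OF ga] list_all2_map1 list_all2_map2 compose_def intro!: list.rel_refl_strong)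
      qed (use H in auto)
      then show ?thesis by (simp only: cvnorm_gs_residual_householder)
    qed
    have "?Q y = ?Q (\<lambda>i. \<psi> * y i)" using phase[OF \<psi>] by simp
    also have "\<dots> = (\<integral>\<^sup>+Y. ennreal (?q (\<lambda>i. \<psi> * y i) Y) \<partial>distr ?P (PiM ?J (\<lambda>_. cvec_space M)) (compose ?J (householder M ?a)))"
      by (subst distr_PiM_compose_householder) (auto intro: \<mu>)
    also have "\<dots> = (\<integral>\<^sup>+Y. ennreal (?q (\<lambda>i. \<psi> * y i) (compose ?J (householder M ?a) Y)) \<partial>?P)"
    proof (rule nn_integral_distr)
      show "compose ?J (householder M ?a) \<in> ?P \<rightarrow>\<^sub>M PiM ?J (\<lambda>_. cvec_space M)"
        unfolding compose_def
        by (intro measurable_restrict measurable_householder) (auto simp: measurable_cong_sets[OF s refl])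
      show "(\<lambda>Y. ennreal (?q (\<lambda>i. \<psi> * y i) Y)) \<in> borel_measurable (distr ?P (PiM ?J (\<lambda>_. cvec_space M)) (compose ?J (householder M ?a)))"
        using meas by (simp del: gs_residual.simps)
    qed
    also have "\<dots> = ?Q x" by (simp only: eqv)
    finally show ?thesis by simp
  qed
  \<comment> \<open>Both orthogonal components are scaled to the same norm, the product of their
    norms, so that \<open>rot\<close> applies. In this cross-multiplied form a vanishing component
    needs no separate case.\<close>
  have key: "?Q x * ennreal ((cvnorm M (?perp y))^2) = ennreal ((cvnorm M (?perp x))^2) * ?Q y" for x y
  proof -
    have "?Q x * ennreal ((cvnorm M (?perp y))^2) = ?Q (\<lambda>i. complex_of_real (cvnorm M (?perp y)) * ?perp x i)"
      unfolding scale perp by (rule mult.commute)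
    also have "\<dots> = ?Q (\<lambda>i. complex_of_real (cvnorm M (?perp x)) * ?perp y i)"
      by (rule rot) (simp_all add: cinner_scale_left cvnorm_minus_proj[OF g] cvnorm_scale)
    also have "\<dots> = ennreal ((cvnorm M (?perp x))^2) * ?Q y"
      by (simp only: scale perp)
    finally show ?thesis .
  qed
  \<comment> \<open>Now \<open>y\<close> runs through the standard basis. The squared orthogonal
    components add up to M - |g|^2 = M - 1, and the squared residuals to L by
    \<open>trace\<close>.\<close>
  have "(\<Sum>j<M. ?Q x * ennreal ((cvnorm M (?perp (unitv j)))^2)) = ?Q x * ennreal (\<Sum>j<M. (cvnorm M (?perp (unitv j)))^2)"
    by (simp add: sum_distrib_left[symmetric] sum_ennreal)
  also have "(\<Sum>j<M. (cvnorm M (?perp (unitv j)))^2) = real M - 1"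
  proof -
    have "(\<Sum>j<M. (cvnorm M (?perp (unitv j)))^2) = (\<Sum>j<M. 1 - (cmod (g j))^2)"
      unfolding cvnorm_minus_proj[OF g] by (intro sum.cong refl) (simp add: cvnorm_unitv cinner_unitv)
    also have "\<dots> = real M - (cvnorm M g)^2" by (simp add: sum_subtractf cvnorm_sq)
    finally show ?thesis using g by simp
  qed
  finally have "ennreal (real M - 1) * ?Q x = (\<Sum>j<M. ?Q x * ennreal ((cvnorm M (?perp (unitv j)))^2))"
    by (simp only: mult.commute)
  also have "\<dots> = (\<Sum>j<M. ennreal ((cvnorm M (?perp x))^2) * ?Q (unitv j))" by (simp only: key)
  also have "\<dots> = ennreal ((cvnorm M (?perp x))^2) * (\<integral>\<^sup>+Y. (\<Sum>j<M. ennreal (?q (unitv j) Y)) \<partial>?P)"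
    by (subst nn_integral_sum) (auto simp: sum_distrib_left simp del: gs_residual.simps)
  also have "(\<integral>\<^sup>+Y. (\<Sum>j<M. ennreal (?q (unitv j) Y)) \<partial>?P) = (\<integral>\<^sup>+Y. ennreal (real L) \<partial>?P)"
    by (rule nn_integral_cong_AE, use trace in eventually_elim) (simp add: sum_ennreal del: gs_residual.simps)
  also have "\<dots> = ennreal (real L)" using P.emeasure_space_1 by simp
  finally show ?thesis
    unfolding cvnorm_minus_proj[OF g] by (simp add: ennreal_mult''[symmetric] mult.commute[of _ "real L"] del: gs_residual.simps)
qed

section \<open>Random vector quantisation: equivariance and measurability of the feedback\<close>

definition best_index :: "nat \<Rightarrow> nat \<Rightarrow> (nat \<Rightarrow> complex) \<Rightarrow> (nat \<Rightarrow> nat \<Rightarrow> complex) \<Rightarrow> nat" where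
  "best_index M B hv C = (LEAST j. j < 2^B \<and>
      (\<forall>i<2^B. cmod (cinner M (htil M hv) (C i)) \<le> cmod (cinner M (htil M hv) (C j))))"

lemma hhat_eq: "hhat M B hv C = C (best_index M B hv C)"
  by (simp add: hhat_def best_index_def)

lemma best_index:
  shows "best_index M B hv C < 2^B"
    and "i < 2^B \<Longrightarrow> cmod (cinner M (htil M hv) (C i)) \<le> cmod (cinner M (htil M hv) (C (best_index M B hv C)))"
proof -
  let ?f = "\<lambda>i. cmod (cinner M (htil M hv) (C i))"
  have "finite (?f ` {..<2^B})" "?f ` {..<2^B} \<noteq> {}" by (auto simp: lessThan_empty_iff)
  then have "Max (?f ` {..<2^B}) \<in> ?f ` {..<2^B}" by (rule Max_in)
  then obtain j where j: "j < 2^B" "?f j = Max (?f ` {..<2^B})" by auto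
  then have "j < 2^B \<and> (\<forall>i<2^B. ?f i \<le> ?f j)" by (auto intro!: Max_ge)
  from LeastI[of "\<lambda>j. j < 2^B \<and> (\<forall>i<2^B. ?f i \<le> ?f j)", OF this]
  show "best_index M B hv C < 2^B" "i < 2^B \<Longrightarrow> ?f i \<le> ?f (best_index M B hv C)"
    by (auto simp: best_index_def)
qed

lemma best_index_cong:
  assumes "\<And>i. i < 2^B \<Longrightarrow> cmod (cinner M (htil M hv) (C i)) = cmod (cinner M (htil M hv') (C' i))"
  shows "best_index M B hv C = best_index M B hv' C'"
  unfolding best_index_def using assms by (intro arg_cong[where f=Least] ext conj_cong refl) auto

text \<open>The selected index is below \<open>2^B\<close>, so values of the codebook function
  beyond the codebook are never read. This permits restricting a family to the indices of one
  user.\<close>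

lemma hhat_cong: "(\<And>i. i < 2^B \<Longrightarrow> C i = C' i) \<Longrightarrow> hhat M B hv C = hhat M B hv C'"
  using best_index_cong[of B M hv C hv C'] best_index(1)[of M B hv C] by (simp add: hhat_eq)

lemma htil_householder: "i < M \<Longrightarrow> htil M (householder M a x) i = householder M a (htil M x) i"
  by (simp add: htil_def cvnorm_householder householder_apply cinner_def sum_divide_distrib[symmetric] diff_divide_distrib)

text \<open>Reflecting channel and codewords together leaves all correlations unchanged, hence also
  the selected index, even in case of ties.\<close>

lemma hhat_householder: "hhat M B (householder M a hv) (\<lambda>l. householder M a (C l)) = householder M a (hhat M B hv C)"
proof -
  have "cinner M (htil M (householder M a hv)) (householder M a (C i)) = cinner M (htil M hv) (C i)" for i
  proof -
    have "cinner M (htil M (householder M a hv)) (householder M a (C i)) = cinner M (householder M a (htil M hv)) (householder M a (C i))"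
      by (intro cinner_cong) (auto simp: htil_householder)
    then show ?thesis by (simp add: cinner_householder)
  qed
  then have "best_index M B (householder M a hv) (\<lambda>l. householder M a (C l)) = best_index M B hv C"
    by (intro best_index_cong) simp
  then show ?thesis by (simp add: hhat_eq)
qed

lemma measurable_htil [measurable (raw)]:
  assumes [measurable]: "f \<in> N \<rightarrow>\<^sub>M cvec_space M" and "i < M"
  shows "(\<lambda>w. htil M (f w) i) \<in> borel_measurable N"
  using assms(2) unfolding htil_def by measurable

lemma measurable_best_index:
  assumes [measurable]: "hv \<in> N \<rightarrow>\<^sub>M cvec_space M" and C: "\<And>l. l < 2^B \<Longrightarrow> (\<lambda>w. C w l) \<in> N \<rightarrow>\<^sub>M cvec_space M"
  shows "(\<lambda>w. best_index M B (hv w) (C w)) \<in> N \<rightarrow>\<^sub>M count_space UNIV"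
proof -
  have c: "(\<lambda>w. cmod (cinner M (htil M (hv w)) (C w l))) \<in> borel_measurable N" if l: "l < 2^B" for l
  proof -
    note [measurable] = C[OF l]
    have [measurable]: "(\<lambda>w. cinner M (htil M (hv w)) (C w l)) \<in> borel_measurable N"
      by (rule borel_measurable_cinner_comp) measurable
    show ?thesis by measurable
  qed
  have "(\<lambda>w. LEAST j. j < 2^B \<and> (\<forall>i\<in>{..<2^B}. cmod (cinner M (htil M (hv w)) (C w i)) \<le> cmod (cinner M (htil M (hv w)) (C w j))))
      \<in> N \<rightarrow>\<^sub>M count_space UNIV"
  proof (rule measurable_Least)
    fix j :: nat
    show "Measurable.pred N (\<lambda>w. j < 2^B \<and> (\<forall>i\<in>{..<2^B}. cmod (cinner M (htil M (hv w)) (C w i)) \<le> cmod (cinner M (htil M (hv w)) (C w j))))"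
    proof (cases "j < 2^B")
      case True
      have "Measurable.pred N (\<lambda>w. \<forall>i\<in>{..<2^B}. cmod (cinner M (htil M (hv w)) (C w i)) \<le> cmod (cinner M (htil M (hv w)) (C w j)))"
      proof (rule pred_intros_finite(3))
        fix i :: nat assume "i \<in> {..<2^B}"
        then have "i < 2^B" by simp
        from borel_measurable_le[OF c[OF this] c[OF True]]
        show "Measurable.pred N (\<lambda>w. cmod (cinner M (htil M (hv w)) (C w i)) \<le> cmod (cinner M (htil M (hv w)) (C w j)))"
          by (simp only: pred_def)
      qed simp
      then show ?thesis by (simp only: True simp_thms)
    next
      case False
      show ?thesis by (simp only: False simp_thms) measurable
    qed
  qed
  then show ?thesis by (simp only: best_index_def Ball_def lessThan_iff)
qed

text \<open>The feedback is a measurable family evaluated at a measurable index with finitely many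
  values.\<close>

lemma measurable_hhat:
  assumes hv: "hv \<in> N \<rightarrow>\<^sub>M cvec_space M" and C: "\<And>l. l < 2^B \<Longrightarrow> (\<lambda>w. C w l) \<in> N \<rightarrow>\<^sub>M cvec_space M"
  shows "(\<lambda>w. hhat M B (hv w) (C w)) \<in> N \<rightarrow>\<^sub>M cvec_space M"
  unfolding hhat_eq
proof (rule measurable_compose_countable'[where I="{..<2^B}" and f="\<lambda>l w. C w l"])
  show "(\<lambda>w. best_index M B (hv w) (C w)) \<in> N \<rightarrow>\<^sub>M count_space {..<2^B}"
  proof -
    have "(\<lambda>w. best_index M B (hv w) (C w)) \<in> N \<rightarrow>\<^sub>M restrict_space (count_space UNIV) {..<2^B}"
      using measurable_best_index[OF hv C] best_index(1)
      by (intro measurable_restrict_space2) auto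
    then show ?thesis by (simp only: restrict_count_space Int_UNIV_right)
  qed
qed (use C in auto)

section \<open>The downlink model\<close>

text \<open>Unlike \<^const>\<open>prob_space.indep_var\<close>, this allows values of different types.\<close>
definition (in prob_space) indep_pair where
  "indep_pair S X T Y \<longleftrightarrow> random_variable S X \<and> random_variable T Y \<and>
    distr M S X \<Otimes>\<^sub>M distr M T Y = distr M (S \<Otimes>\<^sub>M T) (\<lambda>x. (X x, Y x))"

text \<open>Restrictions of one family to disjoint index sets have a common type and fit
  \<open>indep_var\<close>; the images under \<open>f\<close> and \<open>g\<close> may differ in
  type. Every independence statement about the model is obtained in this way.\<close>

lemma (in prob_space) indep_pair_compose:
  assumes ind: "indep_var S X T Y" and f: "f \<in> S \<rightarrow>\<^sub>M S'" and g: "g \<in> T \<rightarrow>\<^sub>M T'"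
  shows "indep_pair S' (f \<circ> X) T' (g \<circ> Y)"
proof -
  have X: "X \<in> M \<rightarrow>\<^sub>M S" and Y: "Y \<in> M \<rightarrow>\<^sub>M T"
    and D: "distr M S X \<Otimes>\<^sub>M distr M T Y = distr M (S \<Otimes>\<^sub>M T) (\<lambda>x. (X x, Y x))"
    using ind unfolding indep_var_distribution_eq by auto
  interpret DY: prob_space "distr (distr M T Y) T' g"
    using Y g by (intro prob_space.prob_space_distr prob_space_distr) auto
  have fg: "(\<lambda>(x, y). (f x, g y)) \<in> S \<Otimes>\<^sub>M T \<rightarrow>\<^sub>M S' \<Otimes>\<^sub>M T'"
    using f g by measurable
  have "distr M S' (f \<circ> X) \<Otimes>\<^sub>M distr M T' (g \<circ> Y) = distr (distr M S X) S' f \<Otimes>\<^sub>M distr (distr M T Y) T' g"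
    by (simp only: distr_distr[OF f X] distr_distr[OF g Y])
  also have "\<dots> = distr (distr M S X \<Otimes>\<^sub>M distr M T Y) (S' \<Otimes>\<^sub>M T') (\<lambda>(x, y). (f x, g y))"
    using f g by (intro pair_measure_distr DY.sigma_finite_measure_axioms) simp_all
  also have "\<dots> = distr M (S' \<Otimes>\<^sub>M T') (\<lambda>x. ((f \<circ> X) x, (g \<circ> Y) x))"
    unfolding D by (subst distr_distr[OF fg measurable_Pair[OF X Y]]) (simp add: comp_def)
  finally show ?thesis using measurable_comp[OF X f] measurable_comp[OF Y g] by (simp add: indep_pair_def)
qed

lemma (in prob_space) indep_pair_rv1: "indep_pair S X T Y \<Longrightarrow> X \<in> M \<rightarrow>\<^sub>M S"
  and indep_pair_rv2: "indep_pair S X T Y \<Longrightarrow> Y \<in> M \<rightarrow>\<^sub>M T"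
  by (simp_all add: indep_pair_def)

text \<open>Because the joint law is a product, \<open>X\<close> may be frozen at its value while
  \<open>Y\<close> is averaged over its own law.\<close>

lemma (in prob_space) indep_pair_nn_integral:
  assumes ind: "indep_pair S X T Y" and f: "f \<in> borel_measurable (S \<Otimes>\<^sub>M T)"
  shows "(\<integral>\<^sup>+\<omega>. f (X \<omega>, Y \<omega>) \<partial>M) = (\<integral>\<^sup>+\<omega>. \<integral>\<^sup>+y. f (X \<omega>, y) \<partial>distr M T Y \<partial>M)"
proof -
  have X [measurable]: "X \<in> M \<rightarrow>\<^sub>M S" and Y [measurable]: "Y \<in> M \<rightarrow>\<^sub>M T"
    and D: "distr M S X \<Otimes>\<^sub>M distr M T Y = distr M (S \<Otimes>\<^sub>M T) (\<lambda>x. (X x, Y x))"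
    using ind unfolding indep_pair_def by auto
  interpret DY: prob_space "distr M T Y" by (rule prob_space_distr) (rule Y)
  have m [measurable]: "f \<in> borel_measurable (S \<Otimes>\<^sub>M distr M T Y)"
    using f measurable_cong_sets[OF sets_pair_measure_cong[OF refl sets_distr] refl] by blast
  have m' [measurable]: "f \<in> borel_measurable (distr M S X \<Otimes>\<^sub>M distr M T Y)"
    using f measurable_cong_sets[OF sets_pair_measure_cong[OF sets_distr sets_distr] refl] by blast
  have "(\<integral>\<^sup>+\<omega>. f (X \<omega>, Y \<omega>) \<partial>M) = (\<integral>\<^sup>+z. f z \<partial>distr M (S \<Otimes>\<^sub>M T) (\<lambda>x. (X x, Y x)))"
    using f by (subst nn_integral_distr) auto
  also have "\<dots> = (\<integral>\<^sup>+x. \<integral>\<^sup>+y. f (x, y) \<partial>distr M T Y \<partial>distr M S X)"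
    unfolding D[symmetric] by (rule DY.nn_integral_fst[symmetric]) (rule m')
  also have "\<dots> = (\<integral>\<^sup>+\<omega>. \<integral>\<^sup>+y. f (X \<omega>, y) \<partial>distr M T Y \<partial>M)"
    by (subst nn_integral_distr) (auto intro: DY.borel_measurable_nn_integral_fst)
  finally show ?thesis .
qed

text \<open>Meant for the rank condition in \<open>onb_null\<close>: it is assumed almost surely for
  all feedback jointly, but is used with one user's feedback held fixed.\<close>

lemma (in prob_space) indep_pair_AE:
  assumes ind: "indep_pair S X T Y" and P: "Measurable.pred (S \<Otimes>\<^sub>M T) P" and ae: "AE \<omega> in M. P (X \<omega>, Y \<omega>)"
  shows "AE \<omega> in M. AE y in distr M T Y. P (X \<omega>, y)"
proof -
  have X [measurable]: "X \<in> M \<rightarrow>\<^sub>M S" and Y [measurable]: "Y \<in> M \<rightarrow>\<^sub>M T"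
    and D: "distr M S X \<Otimes>\<^sub>M distr M T Y = distr M (S \<Otimes>\<^sub>M T) (\<lambda>x. (X x, Y x))"
    using ind unfolding indep_pair_def by auto
  interpret DY: prob_space "distr M T Y" by (rule prob_space_distr) (rule Y)
  interpret DX: prob_space "distr M S X" by (rule prob_space_distr) (rule X)
  interpret P: pair_sigma_finite "distr M S X" "distr M T Y" by standard
  have "AE z in distr M (S \<Otimes>\<^sub>M T) (\<lambda>x. (X x, Y x)). P z"
  proof (subst AE_distr_iff)
    show "{z \<in> space (S \<Otimes>\<^sub>M T). P z} \<in> sets (S \<Otimes>\<^sub>M T)" using P by (simp only: pred_def)
  qed (use ae in simp_all)
  then have "AE x in distr M S X. AE y in distr M T Y. P (x, y)"
    unfolding D[symmetric] by (rule P.AE_pair)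
  then show ?thesis by (rule AE_distrD[OF X])
qed

section \<open>Beamformers built from an orthonormal basis\<close>

lemma measurable_cmat_row:
  assumes V: "V \<in> N \<rightarrow>\<^sub>M cmat_space M L" and m: "m < M"
  shows "(\<lambda>w. V w m) \<in> N \<rightarrow>\<^sub>M cvec_space L"
proof (rule measurable_compose[OF V])
  show "(\<lambda>x. x m) \<in> cmat_space M L \<rightarrow>\<^sub>M cvec_space L"
    unfolding cmat_space_def using m by (intro measurable_component_singleton) simp
qed

lemma measurable_bf:
  assumes V: "V \<in> N \<rightarrow>\<^sub>M cmat_space M L" and p: "p \<in> N \<rightarrow>\<^sub>M cvec_space L"
  shows "(\<lambda>w. bf M L (V w) (p w)) \<in> N \<rightarrow>\<^sub>M cvec_space M"
  unfolding bf_def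
proof (rule measurable_cvec_spaceI)
  fix m assume m: "m < M"
  have [measurable]: "(\<lambda>w. V w m) \<in> N \<rightarrow>\<^sub>M cvec_space L"
    by (rule measurable_cmat_row[OF V m])
  show "(\<lambda>w. \<Sum>l<L. V w m l * p w l) \<in> borel_measurable N"
    using p by measurable
qed

lemma rmul_bf: "rmul M x (bf M L V p) = (\<Sum>l<L. (\<Sum>i<M. x i * V i l) * p l)"
proof -
  have "rmul M x (bf M L V p) = (\<Sum>i<M. \<Sum>l<L. x i * V i l * p l)"
    by (simp add: rmul_def bf_def sum_distrib_left mult.assoc)
  then show ?thesis by (subst (asm) sum.swap) (simp add: sum_distrib_right)
qed

lemma cvnorm_bf:
  assumes V: "onb_null M L A V"
  shows "cvnorm M (bf M L V p) = cvnorm L p"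
proof -
  have "complex_of_real ((cvnorm M (bf M L V p))^2) = (\<Sum>i<M. (\<Sum>l<L. V i l * p l) * (\<Sum>l'<L. cnj (V i l') * cnj (p l')))"
    unfolding cinner_self[symmetric] by (simp add: cinner_def bf_def)
  also have "\<dots> = (\<Sum>i<M. \<Sum>l<L. \<Sum>l'<L. p l * cnj (p l') * (cnj (V i l') * V i l))"
    unfolding sum_product by (simp only: mult_ac)
  also have "\<dots> = (\<Sum>l<L. \<Sum>i<M. \<Sum>l'<L. p l * cnj (p l') * (cnj (V i l') * V i l))"
    by (rule sum.swap)
  also have "\<dots> = (\<Sum>l<L. \<Sum>l'<L. p l * cnj (p l') * (\<Sum>i<M. cnj (V i l') * V i l))"
    unfolding sum_distrib_left by (intro sum.cong[OF refl] sum.swap)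
  also have "\<dots> = (\<Sum>l<L. \<Sum>l'<L. if l' = l then p l * cnj (p l') else 0)"
    using V unfolding onb_null_def by (intro sum.cong refl) auto
  also have "\<dots> = complex_of_real ((cvnorm L p)^2)"
    unfolding cinner_self[symmetric] by (simp add: cinner_def)
  finally have "(cvnorm M (bf M L V p))^2 = (cvnorm L p)^2" by (simp only: of_real_eq_iff)
  then show ?thesis by simp
qed

lemma rmul_cinner: "rmul M x w = cinner M x (\<lambda>i. cnj (w i))"
  by (simp add: rmul_def cinner_def)

lemma cvnorm_cnj [simp]: "cvnorm n (\<lambda>i. cnj (x i)) = cvnorm n x"
  by (simp add: cvnorm_def)

lemma cvnorm_htil: "cvnorm M x \<noteq> 0 \<Longrightarrow> cvnorm M (htil M x) = 1"
  using cvnorm_scale[of M "1 / complex_of_real (cvnorm M x)" x] by (simp add: htil_def norm_divide)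

text \<open>Feedback, bases and beamformers are parameters tied down by equations, so that an
  interpretation can match them with the abbreviations that the theorem introduces by
  \<open>defines\<close>.\<close>

locale noma = prob_space \<Omega> for \<Omega> :: "'w measure" +
  fixes M N K L :: nat and B :: "nat \<Rightarrow> nat \<Rightarrow> nat"
    and h :: "nat \<Rightarrow> nat \<Rightarrow> 'w \<Rightarrow> nat \<Rightarrow> complex"
    and c :: "nat \<Rightarrow> nat \<Rightarrow> nat \<Rightarrow> 'w \<Rightarrow> nat \<Rightarrow> complex"
    and p :: "nat \<Rightarrow> 'w \<Rightarrow> nat \<Rightarrow> complex"
    and Vsel :: "nat \<Rightarrow> (nat \<Rightarrow> nat \<Rightarrow> nat \<Rightarrow> complex) \<Rightarrow> nat \<Rightarrow> nat \<Rightarrow> complex"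
    and hh V w
  assumes hh_def: "hh = (\<lambda>m j \<omega>. hhat M (B m j) (h m j \<omega>) (\<lambda>l. c m j l \<omega>))"
    and V_def: "V = (\<lambda>i \<omega>. Vsel i (fb_others N K i (\<lambda>m j. hh m j \<omega>)))"
    and w_def: "w = (\<lambda>i \<omega>. bf M L (V i \<omega>) (p i \<omega>))"
    and L: "L = M - (N - 1) * K"
    and K: "K \<ge> 2" and M: "M > (N - 1) * K"
    and indep: "indep_vars
        (\<lambda>i. cvec_space (case i of Pv _ \<Rightarrow> L | _ \<Rightarrow> M))
        (\<lambda>i \<omega>. case i of Hc m j \<Rightarrow> h m j \<omega> | Cb m j l \<Rightarrow> c m j l \<omega> | Pv m \<Rightarrow> p m \<omega>)
        ({Hc m j |m j. m \<in> {1..N} \<and> j \<in> {1..K}} \<union>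
         {Cb m j l |m j l. m \<in> {1..N} \<and> j \<in> {1..K} \<and> l < 2 ^ B m j} \<union>
         {Pv m |m. m \<in> {1..N}})"
    and h_gauss: "\<forall>m\<in>{1..N}. \<forall>j\<in>{1..K}. distr \<Omega> (cvec_space M) (h m j) = cgauss_vec M"
    and c_iso: "\<forall>m\<in>{1..N}. \<forall>j\<in>{1..K}. \<forall>l<2 ^ B m j.
                  isotropic_unit M (distr \<Omega> (cvec_space M) (c m j l))"
    and p_iso: "\<forall>m\<in>{1..N}. isotropic_unit L (distr \<Omega> (cvec_space L) (p m))"
    and Vsel_meas: "\<forall>i\<in>{1..N}. Vsel i \<in> fb_space M N K i \<rightarrow>\<^sub>M cmat_space M L"
    and Vsel_onb: "AE \<omega> in \<Omega>. \<forall>i\<in>{1..N}.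
                  onb_null M L {hh m j \<omega> |m j. m \<in> {1..N} - {i} \<and> j \<in> {1..K}} (V i \<omega>)"
begin

definition X where
  "X = (\<lambda>i \<omega>. case i of Hc m j \<Rightarrow> h m j \<omega> | Cb m j l \<Rightarrow> c m j l \<omega> | Pv m \<Rightarrow> p m \<omega>)"

definition MS where
  "MS = (\<lambda>i. cvec_space (case i of Pv _ \<Rightarrow> L | _ \<Rightarrow> M))"

text \<open>The indices of the variables owned by one user: its channel and its codebook. The blocks
  of distinct users are disjoint and each feedback vector is a function of its block, which is how
  independence across users enters.\<close>

definition idx where
  "idx u = insert (Hc (fst u) (snd u)) (Cb (fst u) (snd u) ` {..<2 ^ B (fst u) (snd u)})"

definition users where
  "users = {1..N} \<times> {1..K}"

definition I where
  "I = (\<Union>u\<in>users. idx u) \<union> Pv ` {1..N}"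

text \<open>The feedback as a function of the family of variables rather than of the outcome, so
  that independence of restricted families can be pushed through it. \<open>null_basis\<close> has
  the same purpose.\<close>

definition feedback where
  "feedback u Z = hhat M (B (fst u) (snd u)) (Z (Hc (fst u) (snd u))) (\<lambda>l. Z (Cb (fst u) (snd u) l))"

definition null_basis where
  "null_basis i Z = Vsel i (fb_others N K i (\<lambda>m j. feedback (m, j) Z))"

lemma X_simps [simp]: "X (Hc m j) = h m j" "X (Cb m j l) = c m j l" "X (Pv m) = p m"
  by (simp_all add: X_def)

lemma MS_simps [simp]: "MS (Hc m j) = cvec_space M" "MS (Cb m j l) = cvec_space M" "MS (Pv m) = cvec_space L"
  by (simp_all add: MS_def)

lemma M_pos: "M \<ge> 1" using M by linarith

lemma L_pos: "L \<ge> 1" using M L by linarith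

lemma indep_X: "indep_vars MS X I"
proof -
  have "I = {Hc m j |m j. m \<in> {1..N} \<and> j \<in> {1..K}} \<union>
         {Cb m j l |m j l. m \<in> {1..N} \<and> j \<in> {1..K} \<and> l < 2 ^ B m j} \<union>
         {Pv m |m. m \<in> {1..N}}"
  proof (rule set_eqI)
    fix x show "x \<in> I \<longleftrightarrow> x \<in> {Hc m j |m j. m \<in> {1..N} \<and> j \<in> {1..K}} \<union>
         {Cb m j l |m j l. m \<in> {1..N} \<and> j \<in> {1..K} \<and> l < 2 ^ B m j} \<union>
         {Pv m |m. m \<in> {1..N}}"
      by (cases x) (auto simp: I_def users_def idx_def image_iff)
  qed
  then show ?thesis using indep by (simp only: X_def MS_def)
qed

lemma X_meas: "i \<in> I \<Longrightarrow> X i \<in> \<Omega> \<rightarrow>\<^sub>M MS i"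
  using indep_X by (auto simp: indep_vars_def)

lemma idx_subset: "u \<in> users \<Longrightarrow> idx u \<subseteq> I"
  by (auto simp: I_def)

lemma Hc_mem: "u \<in> users \<Longrightarrow> Hc (fst u) (snd u) \<in> I"
  by (auto simp: I_def idx_def)

lemma h_meas [measurable]: "(m, j) \<in> users \<Longrightarrow> h m j \<in> \<Omega> \<rightarrow>\<^sub>M cvec_space M"
  using X_meas[OF Hc_mem[of "(m, j)"]] by simp

lemma p_meas [measurable]: "i \<in> {1..N} \<Longrightarrow> p i \<in> \<Omega> \<rightarrow>\<^sub>M cvec_space L"
  using X_meas[of "Pv i"] by (simp add: I_def)

lemma c_meas: "(m, j) \<in> users \<Longrightarrow> l < 2 ^ B m j \<Longrightarrow> c m j l \<in> \<Omega> \<rightarrow>\<^sub>M cvec_space M"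
  using X_meas[of "Cb m j l"] by (force simp: I_def idx_def)

lemma hh_meas [measurable]: "(m, j) \<in> users \<Longrightarrow> hh m j \<in> \<Omega> \<rightarrow>\<^sub>M cvec_space M"
  unfolding hh_def by (intro measurable_hhat h_meas c_meas)

lemma feedback_meas:
  assumes D: "idx u \<subseteq> D"
  shows "feedback u \<in> PiM D MS \<rightarrow>\<^sub>M cvec_space M"
  unfolding feedback_def
proof (rule measurable_hhat)
  show "(\<lambda>Z. Z (Hc (fst u) (snd u))) \<in> PiM D MS \<rightarrow>\<^sub>M cvec_space M"
    using D measurable_component_singleton[of "Hc (fst u) (snd u)" D MS] by (simp add: idx_def)
  show "(\<lambda>Z. Z (Cb (fst u) (snd u) l)) \<in> PiM D MS \<rightarrow>\<^sub>M cvec_space M" if "l < 2 ^ B (fst u) (snd u)" for l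
    using D measurable_component_singleton[of "Cb (fst u) (snd u) l" D MS] that by (auto simp: idx_def)
qed

lemma feedback_restrict:
  assumes D: "idx u \<subseteq> D"
  shows "feedback u (restrict (\<lambda>i. X i \<omega>) D) = hh (fst u) (snd u) \<omega>"
proof -
  have "restrict (\<lambda>i. X i \<omega>) D (Hc (fst u) (snd u)) = h (fst u) (snd u) \<omega>"
    using D by (auto simp: idx_def)
  moreover have "restrict (\<lambda>i. X i \<omega>) D (Cb (fst u) (snd u) l) = c (fst u) (snd u) l \<omega>"
    if "l < 2 ^ B (fst u) (snd u)" for l
    using D that by (auto simp: idx_def)
  ultimately show ?thesis
    unfolding feedback_def hh_def by (auto intro!: hhat_cong)
qed

lemma null_basis_meas:
  assumes i: "i \<in> {1..N}" and D: "\<And>u. u \<in> users \<Longrightarrow> fst u \<noteq> i \<Longrightarrow> idx u \<subseteq> D"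
  shows "null_basis i \<in> PiM D MS \<rightarrow>\<^sub>M cmat_space M L"
proof -
  have "(\<lambda>Z. fb_others N K i (\<lambda>m j. feedback (m, j) Z)) \<in> PiM D MS \<rightarrow>\<^sub>M fb_space M N K i"
    unfolding fb_others_def fb_space_def
    by (intro measurable_restrict feedback_meas D) (auto simp: users_def)
  from measurable_compose[OF this bspec[OF Vsel_meas i]] show ?thesis
    unfolding null_basis_def .
qed

lemma null_basis_restrict:
  assumes D: "\<And>u. u \<in> users \<Longrightarrow> fst u \<noteq> i \<Longrightarrow> idx u \<subseteq> D"
  shows "null_basis i (restrict (\<lambda>i. X i \<omega>) D) = V i \<omega>"
proof -
  have "fb_others N K i (\<lambda>m j. feedback (m, j) (restrict (\<lambda>i. X i \<omega>) D)) = fb_others N K i (\<lambda>m j. hh m j \<omega>)"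
    unfolding fb_others_def
  proof (intro restrict_ext)
    fix m j assume "m \<in> {1..N} - {i}" "j \<in> {1..K}"
    then have "idx (m, j) \<subseteq> D" by (intro D) (auto simp: users_def)
    from feedback_restrict[OF this] show "feedback (m, j) (restrict (\<lambda>i. X i \<omega>) D) = hh m j \<omega>" by simp
  qed
  then show ?thesis by (simp add: null_basis_def V_def)
qed

lemma V_meas: "i \<in> {1..N} \<Longrightarrow> V i \<in> \<Omega> \<rightarrow>\<^sub>M cmat_space M L"
proof -
  assume i: "i \<in> {1..N}"
  have "(\<lambda>\<omega>. null_basis i (restrict (\<lambda>i. X i \<omega>) I)) \<in> \<Omega> \<rightarrow>\<^sub>M cmat_space M L"
    by (rule measurable_compose[OF measurable_restrict[OF X_meas] null_basis_meas[OF i idx_subset]])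
  then show ?thesis by (simp add: null_basis_restrict[OF idx_subset])
qed

lemma w_meas [measurable]: "i \<in> {1..N} \<Longrightarrow> w i \<in> \<Omega> \<rightarrow>\<^sub>M cvec_space M"
  unfolding w_def by (intro measurable_bf V_meas p_meas)

lemma AE_hh_unit: 
  assumes u: "(m, j) \<in> users"
  shows "AE \<omega> in \<Omega>. cvnorm M (hh m j \<omega>) = 1"
proof -
  have "AE \<omega> in \<Omega>. cvnorm M (c m j l \<omega>) = 1" if "l \<in> {..<2 ^ B m j}" for l
  proof -
    have "isotropic_unit M (distr \<Omega> (cvec_space M) (c m j l))"
      using c_iso u that by (auto simp: users_def)
    from isotropic_unitD(3)[OF this] show ?thesis
      using c_meas[OF u] that by (intro AE_distrD[of "c m j l" \<Omega> "cvec_space M"]) auto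
  qed
  then have "AE \<omega> in \<Omega>. \<forall>l\<in>{..<2 ^ B m j}. cvnorm M (c m j l \<omega>) = 1"
    by (intro AE_finite_allI) auto
  then show ?thesis by eventually_elim (use best_index(1) in \<open>auto simp: hh_def hhat_eq\<close>)
qed

lemma AE_w_unit:
  assumes i: "i \<in> {1..N}"
  shows "AE \<omega> in \<Omega>. cvnorm M (w i \<omega>) = 1"
proof -
  have "AE \<omega> in \<Omega>. cvnorm L (p i \<omega>) = 1"
    using p_iso i isotropic_unitD(3) by (intro AE_distrD[OF p_meas[OF i]]) blast
  with Vsel_onb show ?thesis
  proof eventually_elim
    case (elim \<omega>)
    from cvnorm_bf[OF bspec[OF elim(1) i]] elim(2) show ?case by (simp add: w_def)
  qed
qed

text \<open>The basis for cluster \<open>n\<close> depends on the feedback of other clusters only.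
  Dropping the single index \<open>Hc n k\<close> therefore leaves everything that
  \<open>w n\<close> is made of, and given \<open>w n\<close> the channel is still Gaussian.\<close>

lemma nn_integral_gain:
  fixes f :: "real \<Rightarrow> ennreal"
  assumes n: "n \<in> {1..N}" and k: "k \<in> {1..K}" and [measurable]: "f \<in> borel_measurable borel"
  shows "(\<integral>\<^sup>+\<omega>. f ((cmod (rmul M (h n k \<omega>) (w n \<omega>)))^2) \<partial>\<Omega>) = (\<integral>\<^sup>+t. f t \<partial>expo1)"
proof -
  let ?D = "I - {Hc n k}"
  have D: "idx u \<subseteq> ?D" if "u \<in> users" "fst u \<noteq> n" for u
    using idx_subset[OF that(1)] that(2) by (auto simp: idx_def)
  have nk: "(n, k) \<in> users" using n k by (simp add: users_def)
  have Pn: "Pv n \<in> ?D" using n by (auto simp: I_def)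
  have "indep_var (PiM ?D MS) (\<lambda>\<omega>. restrict (\<lambda>i. X i \<omega>) ?D) (PiM {Hc n k} MS) (\<lambda>\<omega>. restrict (\<lambda>i. X i \<omega>) {Hc n k})"
    using Hc_mem[OF nk] by (intro indep_var_restrict[OF indep_X]) auto
  then have "indep_pair (cvec_space M) ((\<lambda>Z. bf M L (null_basis n Z) (Z (Pv n))) \<circ> (\<lambda>\<omega>. restrict (\<lambda>i. X i \<omega>) ?D))
     (cvec_space M) ((\<lambda>Z. Z (Hc n k)) \<circ> (\<lambda>\<omega>. restrict (\<lambda>i. X i \<omega>) {Hc n k}))"
  proof (rule indep_pair_compose)
    show "(\<lambda>Z. bf M L (null_basis n Z) (Z (Pv n))) \<in> PiM ?D MS \<rightarrow>\<^sub>M cvec_space M"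
      using measurable_component_singleton[OF Pn, of MS] by (intro measurable_bf null_basis_meas[OF n D]) simp_all
    show "(\<lambda>Z. Z (Hc n k)) \<in> PiM {Hc n k} MS \<rightarrow>\<^sub>M cvec_space M"
      using measurable_component_singleton[of "Hc n k" "{Hc n k}" MS] by simp
  qed
  also have "(\<lambda>Z. bf M L (null_basis n Z) (Z (Pv n))) \<circ> (\<lambda>\<omega>. restrict (\<lambda>i. X i \<omega>) ?D) = w n"
    using Pn by (simp add: fun_eq_iff w_def null_basis_restrict[OF D])
  also have "(\<lambda>Z. Z (Hc n k)) \<circ> (\<lambda>\<omega>. restrict (\<lambda>i. X i \<omega>) {Hc n k}) = h n k"
    by (simp add: fun_eq_iff)
  finally have ind: "indep_pair (cvec_space M) (w n) (cvec_space M) (h n k)" .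
  have "(\<integral>\<^sup>+\<omega>. f ((cmod (rmul M (h n k \<omega>) (w n \<omega>)))^2) \<partial>\<Omega>)
     = (\<integral>\<^sup>+\<omega>. \<integral>\<^sup>+x. f ((cmod (rmul M x (w n \<omega>)))^2) \<partial>distr \<Omega> (cvec_space M) (h n k) \<partial>\<Omega>)"
    using indep_pair_nn_integral[OF ind, of "\<lambda>z. f ((cmod (rmul M (snd z) (fst z)))^2)"] by simp
  also have "distr \<Omega> (cvec_space M) (h n k) = cgauss_vec M" using h_gauss n k by simp
  also have "(\<integral>\<^sup>+\<omega>. \<integral>\<^sup>+x. f ((cmod (rmul M x (w n \<omega>)))^2) \<partial>cgauss_vec M \<partial>\<Omega>) = (\<integral>\<^sup>+\<omega>. (\<integral>\<^sup>+t. f t \<partial>expo1) \<partial>\<Omega>)"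
  proof (rule nn_integral_cong_AE, use AE_w_unit[OF n] in eventually_elim)
    fix \<omega> assume "cvnorm M (w n \<omega>) = 1"
    then show "(\<integral>\<^sup>+x. f ((cmod (rmul M x (w n \<omega>)))^2) \<partial>cgauss_vec M) = (\<integral>\<^sup>+t. f t \<partial>expo1)"
      unfolding rmul_cinner cmod_cinner_commute[of M _ "\<lambda>i. cnj (w n \<omega> i)"]
      by (intro nn_integral_cgauss_cinner M_pos) simp_all
  qed
  also have "\<dots> = (\<integral>\<^sup>+t. f t \<partial>expo1)" using emeasure_space_1 by simp
  finally show ?thesis .
qed

text \<open>Given all channels and codebooks, the received amplitude has the modulus of an inner
  product of the effective channel with the independent isotropic vector \<open>p i\<close>, so its
  second moment is the squared length of the effective channel divided by L.\<close>

lemma nn_integral_beam: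
  assumes i: "i \<in> {1..N}" and u: "(m, j) \<in> users"
  shows "ennreal (real L) * (\<integral>\<^sup>+\<omega>. ennreal ((cmod (rmul M (h m j \<omega>) (w i \<omega>)))^2) \<partial>\<Omega>)
    = (\<integral>\<^sup>+\<omega>. ennreal (\<Sum>l<L. (cmod (\<Sum>q<M. h m j \<omega> q * V i \<omega> q l))^2) \<partial>\<Omega>)"
proof -
  let ?D = "\<Union>u\<in>users. idx u"
  \<comment> \<open>The conjugate makes the sesquilinear \<open>cinner\<close> of \<open>a\<close>
    and \<open>p i\<close> the conjugate of the received amplitude.\<close>
  define a where "a \<omega> = (\<lambda>l\<in>{..<L}. cnj (\<Sum>q<M. h m j \<omega> q * V i \<omega> q l))" for \<omega>
  define az where "az Z = (\<lambda>l\<in>{..<L}. cnj (\<Sum>q<M. Z (Hc m j) q * null_basis i Z q l))" for Z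
  have H: "Hc m j \<in> ?D" using u by (force simp: idx_def)
  have "indep_var (PiM ?D MS) (\<lambda>\<omega>. restrict (\<lambda>i. X i \<omega>) ?D) (PiM {Pv i} MS) (\<lambda>\<omega>. restrict (\<lambda>i. X i \<omega>) {Pv i})"
    using i by (intro indep_var_restrict[OF indep_X]) (auto simp: I_def idx_def)
  then have "indep_pair (cvec_space L) (az \<circ> (\<lambda>\<omega>. restrict (\<lambda>i. X i \<omega>) ?D))
     (cvec_space L) ((\<lambda>Z. Z (Pv i)) \<circ> (\<lambda>\<omega>. restrict (\<lambda>i. X i \<omega>) {Pv i}))"
  proof (rule indep_pair_compose)
    show "az \<in> PiM ?D MS \<rightarrow>\<^sub>M cvec_space L"
      unfolding az_def
    proof (rule measurable_cvec_spaceI)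
      fix l assume l: "l < L"
      have [measurable]: "(\<lambda>Z. Z (Hc m j)) \<in> PiM ?D MS \<rightarrow>\<^sub>M cvec_space M"
        using measurable_component_singleton[OF H, of MS] by simp
      have Vm: "null_basis i \<in> PiM ?D MS \<rightarrow>\<^sub>M cmat_space M L" by (rule null_basis_meas[OF i]) auto
      have [measurable]: "(\<lambda>Z. null_basis i Z q l) \<in> borel_measurable (PiM ?D MS)" if "q < M" for q
      proof -
        have "(\<lambda>Z. null_basis i Z q) \<in> PiM ?D MS \<rightarrow>\<^sub>M cvec_space L"
          by (rule measurable_cmat_row[OF Vm that])
        then show ?thesis by (rule measurable_compose[OF _ measurable_cvec_component[OF l]])
      qed
      show "(\<lambda>Z. cnj (\<Sum>q<M. Z (Hc m j) q * null_basis i Z q l)) \<in> borel_measurable (PiM ?D MS)"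
        by measurable
    qed
    show "(\<lambda>Z. Z (Pv i)) \<in> PiM {Pv i} MS \<rightarrow>\<^sub>M cvec_space L"
      using measurable_component_singleton[of "Pv i" "{Pv i}" MS] by simp
  qed
  also have "az \<circ> (\<lambda>\<omega>. restrict (\<lambda>i. X i \<omega>) ?D) = a"
  proof
    fix \<omega>
    have "null_basis i (restrict (\<lambda>i. X i \<omega>) ?D) = V i \<omega>" by (rule null_basis_restrict) auto
    then show "(az \<circ> (\<lambda>\<omega>. restrict (\<lambda>i. X i \<omega>) ?D)) \<omega> = a \<omega>"
      using H by (simp add: az_def a_def)
  qed
  also have "(\<lambda>Z. Z (Pv i)) \<circ> (\<lambda>\<omega>. restrict (\<lambda>i. X i \<omega>) {Pv i}) = p i"
    by (simp add: fun_eq_iff)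
  finally have ind: "indep_pair (cvec_space L) a (cvec_space L) (p i)" .
  have [measurable]: "a \<in> \<Omega> \<rightarrow>\<^sub>M cvec_space L" using indep_pair_rv1[OF ind] .
  have aw: "cmod (rmul M (h m j \<omega>) (w i \<omega>)) = cmod (cinner L (a \<omega>) (p i \<omega>))" for \<omega>
  proof -
    have "cinner L (a \<omega>) (p i \<omega>) = cnj (rmul M (h m j \<omega>) (w i \<omega>))"
      unfolding w_def rmul_bf by (simp add: cinner_def a_def)
    then show ?thesis by simp
  qed
  have "ennreal (real L) * (\<integral>\<^sup>+\<omega>. ennreal ((cmod (rmul M (h m j \<omega>) (w i \<omega>)))^2) \<partial>\<Omega>)
     = ennreal (real L) * (\<integral>\<^sup>+\<omega>. \<integral>\<^sup>+q. ennreal ((cmod (cinner L (a \<omega>) q))^2) \<partial>distr \<Omega> (cvec_space L) (p i) \<partial>\<Omega>)"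
    unfolding aw using indep_pair_nn_integral[OF ind, of "\<lambda>z. ennreal ((cmod (cinner L (fst z) (snd z)))^2)"] by simp
  also have "\<dots> = (\<integral>\<^sup>+\<omega>. ennreal (real L) * (\<integral>\<^sup>+q. ennreal ((cmod (cinner L (a \<omega>) q))^2) \<partial>distr \<Omega> (cvec_space L) (p i)) \<partial>\<Omega>)"
  proof (rule nn_integral_cmult[symmetric])
    interpret DY: prob_space "distr \<Omega> (cvec_space L) (p i)" by (rule prob_space_distr) (rule p_meas[OF i])
    show "(\<lambda>\<omega>. \<integral>\<^sup>+q. ennreal ((cmod (cinner L (a \<omega>) q))^2) \<partial>distr \<Omega> (cvec_space L) (p i)) \<in> borel_measurable \<Omega>"
      by measurable
  qed
  also have "\<dots> = (\<integral>\<^sup>+\<omega>. ennreal ((cvnorm L (a \<omega>))^2) \<partial>\<Omega>)"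
    using p_iso i by (simp add: isotropic_second_moment)
  also have "\<dots> = (\<integral>\<^sup>+\<omega>. ennreal (\<Sum>l<L. (cmod (\<Sum>q<M. h m j \<omega> q * V i \<omega> q l))^2) \<partial>\<Omega>)"
  proof -
    have "(cvnorm L (a \<omega>))^2 = (\<Sum>l<L. (cmod (\<Sum>q<M. h m j \<omega> q * V i \<omega> q l))^2)" for \<omega>
      unfolding cvnorm_sq
    proof (rule sum.cong)
      fix l assume "l \<in> {..<L}"
      then have "a \<omega> l = cnj (\<Sum>q<M. h m j \<omega> q * V i \<omega> q l)" by (simp only: a_def restrict_apply if_True)
      then show "(cmod (a \<omega> l))^2 = (cmod (\<Sum>q<M. h m j \<omega> q * V i \<omega> q l))^2" by (simp only: complex_mod_cnj)
    qed simp
    then show ?thesis by (simp only:)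
  qed
  finally show ?thesis .
qed

end

section \<open>Mean interference under quantised feedback\<close>

context noma
begin

lemma hh_indep: "indep_vars (\<lambda>_. cvec_space M) (\<lambda>u. hh (fst u) (snd u)) users"
  and group_indep: "indep_vars (\<lambda>u. PiM (idx u) MS) (\<lambda>u \<omega>. restrict (\<lambda>i. X i \<omega>) (idx u)) users"
proof -
  show g: "indep_vars (\<lambda>u. PiM (idx u) MS) (\<lambda>u \<omega>. restrict (\<lambda>i. X i \<omega>) (idx u)) users"
  proof (rule indep_vars_restrict[OF indep_X])
    show "disjoint_family_on idx users"
      by (auto simp: disjoint_family_on_def idx_def)
  qed (rule idx_subset)
  have "indep_vars (\<lambda>_. cvec_space M) (\<lambda>u \<omega>. feedback u (restrict (\<lambda>i. X i \<omega>) (idx u))) users"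
    by (rule indep_vars_compose2[OF g]) (rule feedback_meas, simp)
  then show "indep_vars (\<lambda>_. cvec_space M) (\<lambda>u. hh (fst u) (snd u)) users"
    by (simp add: feedback_restrict)
qed

lemma distr_restrict_X:
  assumes "D \<subseteq> I" "D \<noteq> {}"
  shows "distr \<Omega> (PiM D MS) (\<lambda>\<omega>. restrict (\<lambda>i. X i \<omega>) D) = PiM D (\<lambda>i. distr \<Omega> (MS i) (X i))"
  using indep_vars_subset[OF indep_X assms(1)] assms
  by (subst (asm) indep_vars_iff_distr_eq_PiM') (auto intro: X_meas)

text \<open>Reflect the channel and the whole codebook of a user at once. The components are
  independent and each invariant, so the joint law of the block is kept, while by
  \<open>hhat_householder\<close> the feedback is reflected.\<close>

lemma hh_refl_invariant:
  assumes u: "u \<in> users"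
  shows "refl_invariant M (distr \<Omega> (cvec_space M) (hh (fst u) (snd u)))"
  unfolding refl_invariant_def
proof (intro conjI allI)
  fix a
  let ?R = "\<lambda>\<omega>. restrict (\<lambda>i. X i \<omega>) (idx u)"
  let ?law = "\<lambda>i. distr \<Omega> (MS i) (X i)"
  have MS: "MS i = cvec_space M" if "i \<in> idx u" for i using that by (auto simp: idx_def)
  have P: "PiM (idx u) MS = PiM (idx u) (\<lambda>_. cvec_space M)" by (intro PiM_cong) (auto simp: MS)
  have R: "?R \<in> \<Omega> \<rightarrow>\<^sub>M PiM (idx u) MS"
    using idx_subset[OF u] by (intro measurable_restrict X_meas) auto
  have feedback: "feedback u \<in> PiM (idx u) MS \<rightarrow>\<^sub>M cvec_space M" by (rule feedback_meas) simp
  have C: "compose (idx u) (householder M a) \<in> PiM (idx u) MS \<rightarrow>\<^sub>M PiM (idx u) MS"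
    unfolding compose_def P by (intro measurable_restrict measurable_householder measurable_component_singleton)
  have H: "householder M a \<in> cvec_space M \<rightarrow>\<^sub>M cvec_space M"
    using measurable_householder[of "\<lambda>x. x" "cvec_space M" M a] by simp
  have law: "prob_space (?law i)" "refl_invariant M (?law i)" if i: "i \<in> idx u" for i
  proof -
    show "prob_space (?law i)" using idx_subset[OF u] i by (intro prob_space_distr X_meas) auto
    have un: "fst u \<in> {1..N}" "snd u \<in> {1..K}" using u by (auto simp: users_def)
    show "refl_invariant M (?law i)"
      using i h_gauss c_iso un refl_invariant_cgauss_vec refl_invariant_isotropic_unit by (auto simp: idx_def)
  qed
  have D: "distr \<Omega> (PiM (idx u) MS) ?R = PiM (idx u) ?law"
    by (rule distr_restrict_X[OF idx_subset[OF u]]) (auto simp: idx_def)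
  have hh: "hh (fst u) (snd u) = feedback u \<circ> ?R"
    using feedback_restrict[of u "idx u"] by (auto simp: fun_eq_iff)
  have hH: "householder M a (feedback u Z) = feedback u (compose (idx u) (householder M a) Z)" for Z
    unfolding feedback_def hhat_householder[symmetric] by (auto simp: compose_def idx_def intro!: hhat_cong)
  have "distr (distr \<Omega> (cvec_space M) (hh (fst u) (snd u))) (cvec_space M) (householder M a)
     = distr (distr (PiM (idx u) ?law) (PiM (idx u) MS) (compose (idx u) (householder M a))) (cvec_space M) (feedback u)"
    unfolding D[symmetric] hh
    by (subst distr_distr[OF H measurable_comp[OF R feedback]], subst distr_distr[OF C R], subst distr_distr[OF feedback measurable_comp[OF R C]])
       (simp add: comp_def hH)
  also have "distr (PiM (idx u) ?law) (PiM (idx u) MS) (compose (idx u) (householder M a)) = PiM (idx u) ?law"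
    unfolding P by (rule distr_PiM_compose_householder) (auto simp: law, auto simp: idx_def)
  also have "distr (PiM (idx u) ?law) (cvec_space M) (feedback u) = distr \<Omega> (cvec_space M) (hh (fst u) (snd u))"
    unfolding D[symmetric] hh by (rule distr_distr[OF feedback R])
  finally show "distr (distr \<Omega> (cvec_space M) (hh (fst u) (snd u))) (cvec_space M) (householder M a)
     = distr \<Omega> (cvec_space M) (hh (fst u) (snd u))" .
qed simp

text \<open>Channel and feedback of a user are dependent, so the conditioning is on both. As
  \<open>i \<noteq> n\<close>, the vectors annihilated for cluster \<open>i\<close> include
  \<open>hh n k\<close>; the remaining ones, indexed by \<open>J\<close>, are independent of the
  pair and become the random \<open>Y\<close> of \<open>mean_gs_residual\<close>.\<close>

lemma nn_integral_nullspace_gain: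
  assumes i: "i \<in> {1..N}" and n: "n \<in> {1..N}" and k: "k \<in> {1..K}" and ne: "i \<noteq> n"
  shows "ennreal (real M - 1) * (\<integral>\<^sup>+\<omega>. ennreal (\<Sum>l<L. (cmod (\<Sum>q<M. h n k \<omega> q * V i \<omega> q l))^2) \<partial>\<Omega>)
    = (\<integral>\<^sup>+\<omega>. ennreal (real L * ((cvnorm M (h n k \<omega>))^2 - (cmod (cinner M (h n k \<omega>) (hh n k \<omega>)))^2)) \<partial>\<Omega>)"
proof -
  define J where "J = ({1..N} - {i}) \<times> {1..K} - {(n, k)}"
  have "finite J" by (simp add: J_def)
  then obtain js where js: "set js = J" using finite_list by blast
  have Ju: "J \<subseteq> users" by (auto simp: J_def users_def)
  have nk: "(n, k) \<in> users" using n k by (simp add: users_def)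
  have Jne: "J \<noteq> {}"
  proof -
    \<comment> \<open>The witness is another user of cluster \<open>n\<close>, which exists because
      \<open>K \<ge> 2\<close>. A nonempty index set is required to write the joint law of
      independent variables as a product measure.\<close>
    have "(n, if k = 1 then 2 else 1) \<in> J" using n k K ne by (auto simp: J_def)
    then show ?thesis by blast
  qed
  let ?R = "\<lambda>u \<omega>. restrict (\<lambda>i. X i \<omega>) (idx u)"
  let ?Y = "\<lambda>\<omega>. \<lambda>u\<in>J. hh (fst u) (snd u) \<omega>"
  let ?S = "cvec_space M \<Otimes>\<^sub>M cvec_space M" and ?T = "PiM J (\<lambda>_. cvec_space M)"
  have "indep_var (PiM {(n, k)} (\<lambda>u. PiM (idx u) MS)) (\<lambda>\<omega>. restrict (\<lambda>u. ?R u \<omega>) {(n, k)})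
     (PiM J (\<lambda>u. PiM (idx u) MS)) (\<lambda>\<omega>. restrict (\<lambda>u. ?R u \<omega>) J)"
    using nk Ju by (intro indep_var_restrict[OF group_indep]) (auto simp: J_def)
  then have "indep_pair ?S ((\<lambda>W. (W (n, k) (Hc n k), feedback (n, k) (W (n, k)))) \<circ> (\<lambda>\<omega>. restrict (\<lambda>u. ?R u \<omega>) {(n, k)}))
     ?T ((\<lambda>W. \<lambda>u\<in>J. feedback u (W u)) \<circ> (\<lambda>\<omega>. restrict (\<lambda>u. ?R u \<omega>) J))"
  proof (rule indep_pair_compose)
    have 1: "(\<lambda>W. W (n, k)) \<in> PiM {(n, k)} (\<lambda>u. PiM (idx u) MS) \<rightarrow>\<^sub>M PiM (idx (n, k)) MS"
      by (intro measurable_component_singleton) simp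
    have 2: "(\<lambda>Z. Z (Hc n k)) \<in> PiM (idx (n, k)) MS \<rightarrow>\<^sub>M cvec_space M"
      using measurable_component_singleton[of "Hc n k" "idx (n, k)" MS] by (simp add: idx_def)
    show "(\<lambda>W. (W (n, k) (Hc n k), feedback (n, k) (W (n, k)))) \<in> PiM {(n, k)} (\<lambda>u. PiM (idx u) MS) \<rightarrow>\<^sub>M ?S"
      by (intro measurable_Pair measurable_compose[OF 1 2] measurable_compose[OF 1 feedback_meas]) simp
    show "(\<lambda>W. \<lambda>u\<in>J. feedback u (W u)) \<in> PiM J (\<lambda>u. PiM (idx u) MS) \<rightarrow>\<^sub>M ?T"
    proof (rule measurable_restrict)
      fix u assume u: "u \<in> J"
      show "(\<lambda>W. feedback u (W u)) \<in> PiM J (\<lambda>u. PiM (idx u) MS) \<rightarrow>\<^sub>M cvec_space M"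
        by (rule measurable_compose[OF measurable_component_singleton[OF u] feedback_meas]) simp
    qed
  qed
  also have "(\<lambda>W. (W (n, k) (Hc n k), feedback (n, k) (W (n, k)))) \<circ> (\<lambda>\<omega>. restrict (\<lambda>u. ?R u \<omega>) {(n, k)})
     = (\<lambda>\<omega>. (h n k \<omega>, hh n k \<omega>))"
    using feedback_restrict[of "(n, k)" "idx (n, k)"] by (auto simp: fun_eq_iff idx_def)
  also have "(\<lambda>W. \<lambda>u\<in>J. feedback u (W u)) \<circ> (\<lambda>\<omega>. restrict (\<lambda>u. ?R u \<omega>) J) = ?Y"
    by (auto simp: fun_eq_iff feedback_restrict)
  finally have ind: "indep_pair ?S (\<lambda>\<omega>. (h n k \<omega>, hh n k \<omega>)) ?T ?Y" .
  let ?law = "\<lambda>u. distr \<Omega> (cvec_space M) (hh (fst u) (snd u))"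
  have law: "distr \<Omega> ?T ?Y = PiM J ?law"
    using indep_vars_subset[OF hh_indep Ju] Jne Ju
    by (subst (asm) indep_vars_iff_distr_eq_PiM') (auto intro: hh_meas)
  let ?g = "\<lambda>g Y x. (cvnorm M (gs_residual M (g # map Y js) x))^2"
  have gm: "(\<lambda>z. ?g (snd (fst z)) (snd z) (x z)) \<in> borel_measurable (?S \<Otimes>\<^sub>M ?T)"
    if x: "\<And>i. i < M \<Longrightarrow> (\<lambda>z. x z i) \<in> borel_measurable (?S \<Otimes>\<^sub>M ?T)" for x
  proof -
    have "(\<lambda>z. cvnorm M (gs_residual M (map (\<lambda>v. case v of None \<Rightarrow> snd (fst z) | Some u \<Rightarrow> snd z u) (None # map Some js)) (x z)))
        \<in> borel_measurable (?S \<Otimes>\<^sub>M ?T)"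
    proof (rule borel_measurable_cvnorm_gs_residual[OF _ x])
      fix v assume v: "v \<in> set (None # map Some js)"
      show "(\<lambda>z. case v of None \<Rightarrow> snd (fst z) | Some u \<Rightarrow> snd z u) \<in> ?S \<Otimes>\<^sub>M ?T \<rightarrow>\<^sub>M cvec_space M"
      proof (cases v)
        case (Some u)
        then have "u \<in> J" using v js by auto
        then show ?thesis using Some
          by (auto intro: measurable_compose[OF measurable_snd measurable_component_singleton])
      qed simp
    qed
    then show ?thesis
      by (intro borel_measurable_power) (simp add: comp_def del: gs_residual.simps)
  qed
  have set_eq: "{hh m j \<omega> |m j. m \<in> {1..N} - {i} \<and> j \<in> {1..K}} = set (hh n k \<omega> # map (?Y \<omega>) js)" for \<omega>
  proof -
    have "{hh m j \<omega> |m j. m \<in> {1..N} - {i} \<and> j \<in> {1..K}} = (\<lambda>u. hh (fst u) (snd u) \<omega>) ` (({1..N} - {i}) \<times> {1..K})"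
      by force
    also have "({1..N} - {i}) \<times> {1..K} = insert (n, k) J" using n k ne by (auto simp: J_def)
    also have "(\<lambda>u. hh (fst u) (snd u) \<omega>) ` insert (n, k) J = insert (hh n k \<omega>) (?Y \<omega> ` J)"
      by auto
    finally show ?thesis by (simp only: list.set set_map js)
  qed
  have onb: "AE \<omega> in \<Omega>. onb_null M L (set (hh n k \<omega> # map (?Y \<omega>) js)) (V i \<omega>)"
    using Vsel_onb
  proof eventually_elim
    case (elim \<omega>)
    from bspec[OF elim i] show ?case by (simp only: set_eq)
  qed
  have gain: "(\<integral>\<^sup>+\<omega>. ennreal (\<Sum>l<L. (cmod (\<Sum>q<M. h n k \<omega> q * V i \<omega> q l))^2) \<partial>\<Omega>)
    = (\<integral>\<^sup>+\<omega>. ennreal (?g (hh n k \<omega>) (?Y \<omega>) (h n k \<omega>)) \<partial>\<Omega>)"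
    by (rule nn_integral_cong_AE, use onb in eventually_elim) (simp only: onb_null_gain)
  \<comment> \<open>The dimension L of the null space is known almost surely for the actual
    feedback; here it is passed on to almost every independent copy \<open>Y\<close> next to a
    frozen \<open>hh n k\<close>.\<close>
  have trace: "AE \<omega> in \<Omega>. AE Y in distr \<Omega> ?T ?Y. (\<Sum>j<M. ?g (hh n k \<omega>) Y (unitv j)) = real L"
  proof -
    have "AE \<omega> in \<Omega>. AE Y in distr \<Omega> ?T ?Y. (\<lambda>z. (\<Sum>j<M. ?g (snd (fst z)) (snd z) (unitv j)) = real L) ((h n k \<omega>, hh n k \<omega>), Y)"
    proof (rule indep_pair_AE[OF ind])
      have sm: "(\<lambda>z. \<Sum>j<M. ?g (snd (fst z)) (snd z) (unitv j)) \<in> borel_measurable (?S \<Otimes>\<^sub>M ?T)"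
        by (intro borel_measurable_sum gm) simp
      show "Measurable.pred (?S \<Otimes>\<^sub>M ?T) (\<lambda>z. (\<Sum>j<M. ?g (snd (fst z)) (snd z) (unitv j)) = real L)"
        by (rule measurable_compose[OF sm, where g="\<lambda>y. y = real L"]) measurable
      show "AE \<omega> in \<Omega>. (\<Sum>j<M. ?g (snd (fst ((h n k \<omega>, hh n k \<omega>), ?Y \<omega>))) (snd ((h n k \<omega>, hh n k \<omega>), ?Y \<omega>)) (unitv j)) = real L"
        using onb by eventually_elim (simp only: onb_null_trace fst_conv snd_conv)
    qed
    then show ?thesis by (simp only: fst_conv snd_conv)
  qed
  have fm: "(\<lambda>z. ennreal (?g (snd (fst z)) (snd z) (fst (fst z)))) \<in> borel_measurable (?S \<Otimes>\<^sub>M ?T)"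
    by (intro measurable_compose[OF gm measurable_ennreal] measurable_compose[OF _ measurable_cvec_component]) measurable
  have "ennreal (real M - 1) * (\<integral>\<^sup>+\<omega>. ennreal (?g (hh n k \<omega>) (?Y \<omega>) (h n k \<omega>)) \<partial>\<Omega>)
    = ennreal (real M - 1) * (\<integral>\<^sup>+\<omega>. \<integral>\<^sup>+Y. ennreal (?g (hh n k \<omega>) Y (h n k \<omega>)) \<partial>distr \<Omega> ?T ?Y \<partial>\<Omega>)"
    using indep_pair_nn_integral[OF ind fm] by (simp only: fst_conv snd_conv)
  also have "\<dots> = (\<integral>\<^sup>+\<omega>. ennreal (real M - 1) * (\<integral>\<^sup>+Y. ennreal (?g (hh n k \<omega>) Y (h n k \<omega>)) \<partial>distr \<Omega> ?T ?Y) \<partial>\<Omega>)"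
  proof (rule nn_integral_cmult[symmetric])
    interpret DY: prob_space "distr \<Omega> ?T ?Y" by (rule prob_space_distr) (rule indep_pair_rv2[OF ind])
    have "(\<lambda>z. ennreal (?g (snd (fst z)) (snd z) (fst (fst z)))) \<in> borel_measurable (?S \<Otimes>\<^sub>M distr \<Omega> ?T ?Y)"
      using fm measurable_cong_sets[OF sets_pair_measure_cong[OF refl sets_distr] refl] by blast
    from DY.borel_measurable_nn_integral_fst[OF this]
    have "(\<lambda>x. \<integral>\<^sup>+Y. ennreal (?g (snd x) Y (fst x)) \<partial>distr \<Omega> ?T ?Y) \<in> borel_measurable ?S"
      by (simp only: fst_conv snd_conv)
    from measurable_compose[OF indep_pair_rv1[OF ind] this]
    show "(\<lambda>\<omega>. \<integral>\<^sup>+Y. ennreal (?g (hh n k \<omega>) Y (h n k \<omega>)) \<partial>distr \<Omega> ?T ?Y) \<in> borel_measurable \<Omega>"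
      by (simp only: fst_conv snd_conv)
  qed
  also have "\<dots> = (\<integral>\<^sup>+\<omega>. ennreal (real L * ((cvnorm M (h n k \<omega>))^2 - (cmod (cinner M (h n k \<omega>) (hh n k \<omega>)))^2)) \<partial>\<Omega>)"
  proof (rule nn_integral_cong_AE, use AE_hh_unit[OF nk] trace in eventually_elim)
    case (elim \<omega>)
    have pr: "prob_space (?law u)" if "u \<in> set js" for u
      using that Ju js by (auto intro!: prob_space_distr hh_meas)
    have ri: "refl_invariant M (?law u)" if "u \<in> set js" for u
      using that Ju js by (auto intro!: hh_refl_invariant)
    have "AE Y in PiM (set js) ?law. (\<Sum>j<M. ?g (hh n k \<omega>) Y (unitv j)) = real L"
      using elim(2) by (simp only: law js)
    from mean_gs_residual[OF pr ri elim(1) this] show ?case by (simp only: law js)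
  qed
  finally show ?thesis unfolding gain .
qed

text \<open>For a frozen channel the squared norm splits off by homogeneity, and the bound for the
  codebook is the same for every direction. The mean squared norm M therefore appears as a factor
  without any appeal to independence of norm and direction.\<close>

lemma nn_integral_quantization:
  assumes n: "n \<in> {1..N}" and k: "k \<in> {1..K}" and M2: "M \<ge> 2"
  shows "(\<integral>\<^sup>+\<omega>. ennreal ((cvnorm M (h n k \<omega>))^2 - (cmod (cinner M (h n k \<omega>) (hh n k \<omega>)))^2) \<partial>\<Omega>)
    \<le> ennreal (real M * (Gamma (1 + 1 / (real M - 1)) * 2 powr (- real (B n k) / (real M - 1))))"
proof -
  obtain m where m: "M = Suc m" "m \<ge> 1" using M2 by (cases M) auto
  have nk: "(n, k) \<in> users" using n k by (simp add: users_def)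
  let ?C = "Cb n k ` {..<2 ^ B n k}"
  let ?T = "PiM ?C MS"
  let ?R = "\<lambda>\<omega>. restrict (\<lambda>i. X i \<omega>) ?C"
  let ?\<kappa> = "Gamma (1 + 1 / real m) * real (card ?C) powr (- 1 / real m)"
  have CI: "?C \<subseteq> I" using idx_subset[OF nk] by (auto simp: idx_def)
  have Cne: "?C \<noteq> {}" by (simp add: lessThan_empty_iff)
  have hm: "h n k \<in> \<Omega> \<rightarrow>\<^sub>M cvec_space M" by (rule h_meas[OF nk])
  have "indep_var (PiM {Hc n k} MS) (\<lambda>\<omega>. restrict (\<lambda>i. X i \<omega>) {Hc n k}) ?T ?R"
    using CI Hc_mem[OF nk] by (intro indep_var_restrict[OF indep_X]) auto
  then have "indep_pair (cvec_space M) ((\<lambda>Z. Z (Hc n k)) \<circ> (\<lambda>\<omega>. restrict (\<lambda>i. X i \<omega>) {Hc n k})) ?T ((\<lambda>Z. Z) \<circ> ?R)"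
  proof (rule indep_pair_compose)
    show "(\<lambda>Z. Z (Hc n k)) \<in> PiM {Hc n k} MS \<rightarrow>\<^sub>M cvec_space M"
      using measurable_component_singleton[of "Hc n k" "{Hc n k}" MS] by simp
  qed simp
  also have "(\<lambda>Z. Z (Hc n k)) \<circ> (\<lambda>\<omega>. restrict (\<lambda>i. X i \<omega>) {Hc n k}) = h n k"
    by (simp add: fun_eq_iff)
  also have "(\<lambda>Z. Z) \<circ> ?R = ?R" by (simp add: comp_def)
  finally have ind: "indep_pair (cvec_space M) (h n k) ?T ?R" .
  let ?q = "\<lambda>x Z. hhat M (B n k) x (\<lambda>l. Z (Cb n k l))"
  have hq: "hh n k \<omega> = ?q (h n k \<omega>) (?R \<omega>)" for \<omega>
    unfolding hh_def by (intro hhat_cong) auto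
  have Zm: "(\<lambda>Z. Z (Cb n k l)) \<in> ?T \<rightarrow>\<^sub>M cvec_space M" if "l < 2 ^ B n k" for l
    using that measurable_component_singleton[of "Cb n k l" ?C MS] by simp
  have qm: "(\<lambda>z. ?q (fst z) (snd z)) \<in> cvec_space M \<Otimes>\<^sub>M ?T \<rightarrow>\<^sub>M cvec_space M"
    by (intro measurable_hhat measurable_fst measurable_compose[OF measurable_snd Zm])
  have Fm: "(\<lambda>z. ennreal ((cvnorm M (fst z))^2 - (cmod (cinner M (fst z) (?q (fst z) (snd z))))^2))
      \<in> borel_measurable (cvec_space M \<Otimes>\<^sub>M ?T)"
    using qm by measurable
  have "(\<integral>\<^sup>+\<omega>. ennreal ((cvnorm M (h n k \<omega>))^2 - (cmod (cinner M (h n k \<omega>) (hh n k \<omega>)))^2) \<partial>\<Omega>)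
     = (\<integral>\<^sup>+\<omega>. \<integral>\<^sup>+Z. ennreal ((cvnorm M (h n k \<omega>))^2 - (cmod (cinner M (h n k \<omega>) (?q (h n k \<omega>) Z)))^2) \<partial>distr \<Omega> ?T ?R \<partial>\<Omega>)"
    unfolding hq using indep_pair_nn_integral[OF ind Fm] by (simp only: fst_conv snd_conv)
  also have "distr \<Omega> ?T ?R = PiM ?C (\<lambda>i. distr \<Omega> (MS i) (X i))"
    by (rule distr_restrict_X[OF CI Cne])
  also have "(\<integral>\<^sup>+\<omega>. \<integral>\<^sup>+Z. ennreal ((cvnorm M (h n k \<omega>))^2 - (cmod (cinner M (h n k \<omega>) (?q (h n k \<omega>) Z)))^2)
       \<partial>PiM ?C (\<lambda>i. distr \<Omega> (MS i) (X i)) \<partial>\<Omega>)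
     \<le> (\<integral>\<^sup>+\<omega>. ennreal ((cvnorm M (h n k \<omega>))^2) * ennreal ?\<kappa> \<partial>\<Omega>)"
  proof (rule nn_integral_mono)
    fix \<omega> assume \<omega>: "\<omega> \<in> space \<Omega>"
    define x where "x = h n k \<omega>"
    have xs: "x \<in> space (cvec_space M)" unfolding x_def by (rule measurable_space[OF hm \<omega>])
    let ?law = "PiM ?C (\<lambda>i. distr \<Omega> (MS i) (X i))"
    let ?S = "\<lambda>Z. 1 - (cmod (cinner M (htil M x) (?q x Z)))^2"
    show "(\<integral>\<^sup>+Z. ennreal ((cvnorm M (h n k \<omega>))^2 - (cmod (cinner M (h n k \<omega>) (?q (h n k \<omega>) Z)))^2) \<partial>?law)
      \<le> ennreal ((cvnorm M (h n k \<omega>))^2) * ennreal ?\<kappa>"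
      unfolding x_def[symmetric]
    proof (cases "cvnorm M x = 0")
      case True
      then have "ennreal ((cvnorm M x)^2 - (cmod (cinner M x (?q x Z)))^2) = 0" for Z
        by (simp add: ennreal_neg)
      then show "(\<integral>\<^sup>+Z. ennreal ((cvnorm M x)^2 - (cmod (cinner M x (?q x Z)))^2) \<partial>?law) \<le> ennreal ((cvnorm M x)^2) * ennreal ?\<kappa>"
        by simp
    next
      case False
      have eq: "ennreal ((cvnorm M x)^2 - (cmod (cinner M x (?q x Z)))^2) = ennreal ((cvnorm M x)^2) * ennreal (?S Z)" for Z
      proof -
        have "cinner M x (?q x Z) = complex_of_real (cvnorm M x) * cinner M (htil M x) (?q x Z)"
          unfolding cinner_scale_left[symmetric] using False by (simp add: htil_def)
        then have "(cvnorm M x)^2 - (cmod (cinner M x (?q x Z)))^2 = (cvnorm M x)^2 * ?S Z"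
          by (simp add: norm_mult power_mult_distrib algebra_simps)
        then show ?thesis by (simp add: ennreal_mult')
      qed
      have s: "sets ?law = sets ?T" by (intro sets_PiM_cong) auto
      have "(\<lambda>Z. ?q x Z) \<in> ?T \<rightarrow>\<^sub>M cvec_space M"
        by (intro measurable_hhat measurable_const xs Zm)
      then have qx: "(\<lambda>Z. ?q x Z) \<in> ?law \<rightarrow>\<^sub>M cvec_space M"
        using measurable_cong_sets[OF s refl] by blast
      have "(\<lambda>Z. cinner M (htil M x) (?q x Z)) \<in> borel_measurable ?law"
        by (rule borel_measurable_cinner_comp) (auto intro: measurable_compose[OF qx measurable_cvec_component])
      then have [measurable]: "(\<lambda>Z. ennreal (?S Z)) \<in> borel_measurable ?law" by measurable
      have "(\<integral>\<^sup>+Z. ennreal ((cvnorm M x)^2 - (cmod (cinner M x (?q x Z)))^2) \<partial>?law)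
        = ennreal ((cvnorm M x)^2) * (\<integral>\<^sup>+Z. ennreal (?S Z) \<partial>?law)"
        unfolding eq by (rule nn_integral_cmult) measurable
      also have "\<dots> \<le> ennreal ((cvnorm M x)^2) * ennreal ?\<kappa>"
      proof (rule mult_left_mono)
        show "(\<integral>\<^sup>+Z. ennreal (?S Z) \<partial>?law) \<le> ennreal ?\<kappa>"
        proof (rule quantization_error_bound[OF m(2) _ Cne, where u="htil M x"])
          show "isotropic_unit (Suc m) (distr \<Omega> (MS l) (X l))" if "l \<in> ?C" for l
          proof -
            obtain j where j: "j < 2 ^ B n k" "l = Cb n k j" using \<open>l \<in> ?C\<close> by auto
            then show ?thesis using c_iso n k by (simp add: m(1)[symmetric])
          qed
          show "cvnorm (Suc m) (htil M x) = 1" using cvnorm_htil[OF False] m(1) by simp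
          show "?S Z \<le> 1 - (cmod (cinner (Suc m) (htil M x) (Z l)))^2" if "l \<in> ?C" for Z l
          proof -
            obtain j where j: "j < 2 ^ B n k" "l = Cb n k j" using \<open>l \<in> ?C\<close> by auto
            then show ?thesis
              using best_index(2)[OF j(1), of M x "\<lambda>l. Z (Cb n k l)"] m(1)
              by (simp add: hhat_eq power_mono)
          qed
        qed simp
      qed simp
      finally show "(\<integral>\<^sup>+Z. ennreal ((cvnorm M x)^2 - (cmod (cinner M x (?q x Z)))^2) \<partial>?law) \<le> ennreal ((cvnorm M x)^2) * ennreal ?\<kappa>" .
    qed
  qed
  also have "\<dots> = (\<integral>\<^sup>+\<omega>. ennreal ((cvnorm M (h n k \<omega>))^2) \<partial>\<Omega>) * ennreal ?\<kappa>"
    by (rule nn_integral_multc) (use hm nk in measurable)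
  also have "(\<integral>\<^sup>+\<omega>. ennreal ((cvnorm M (h n k \<omega>))^2) \<partial>\<Omega>) = (\<integral>\<^sup>+x. ennreal ((cvnorm M x)^2) \<partial>distr \<Omega> (cvec_space M) (h n k))"
    using hm by (subst nn_integral_distr) (auto simp: nk)
  also have "\<dots> = ennreal (real M)"
    using h_gauss n k nn_integral_cgauss_norm by simp
  also have "card ?C = 2 ^ B n k" by (subst card_image) (auto simp: inj_on_def)
  also have "real (2 ^ B n k) powr (- 1 / real m) = 2 powr (- real (B n k) / real m)"
    by (simp add: powr_powr flip: powr_realpow)
  finally show ?thesis using m by (simp add: ennreal_mult')
qed

lemma nn_integral_interference:
  assumes i: "i \<in> {1..N}" and n: "n \<in> {1..N}" and k: "k \<in> {1..K}" and ne: "i \<noteq> n"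
  shows "(\<integral>\<^sup>+\<omega>. ennreal ((cmod (rmul M (h n k \<omega>) (w i \<omega>)))^2) \<partial>\<Omega>)
    \<le> ennreal (Gamma ((2 * real M - 1) / (real M - 1)) * 2 powr (- real (B n k) / (real M - 1)))"
proof -
  \<comment> \<open>Two distinct clusters force \<open>N \<ge> 2\<close>, hence M > K \<ge> 2. From
    here on M - 1 is positive and can be divided by.\<close>
  have "N \<ge> 2" using i n ne by auto
  then have "(N - 1) * K \<ge> 1 * 2" using K by (intro mult_le_mono) auto
  then have M3: "M \<ge> 3" using M by linarith
  let ?I = "\<integral>\<^sup>+\<omega>. ennreal ((cmod (rmul M (h n k \<omega>) (w i \<omega>)))^2) \<partial>\<Omega>"
  let ?\<kappa> = "Gamma (1 + 1 / (real M - 1)) * 2 powr (- real (B n k) / (real M - 1))"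
  have nk: "(n, k) \<in> users" using n k by (simp add: users_def)
  have m: "(\<lambda>\<omega>. ennreal ((cvnorm M (h n k \<omega>))^2 - (cmod (cinner M (h n k \<omega>) (hh n k \<omega>)))^2)) \<in> borel_measurable \<Omega>"
    using h_meas[OF nk] hh_meas[OF nk] by measurable
  have Gpos: "0 < Gamma (1 + 1 / (real M - 1))" using M3 by (intro Gamma_real_pos) (simp add: add_pos_nonneg)
  have "ennreal (real M - 1) * (ennreal (real L) * ?I)
     = (\<integral>\<^sup>+\<omega>. ennreal (real L * ((cvnorm M (h n k \<omega>))^2 - (cmod (cinner M (h n k \<omega>) (hh n k \<omega>)))^2)) \<partial>\<Omega>)"
    by (simp only: nn_integral_beam[OF i nk] nn_integral_nullspace_gain[OF i n k ne])
  also have "\<dots> = ennreal (real L) * (\<integral>\<^sup>+\<omega>. ennreal ((cvnorm M (h n k \<omega>))^2 - (cmod (cinner M (h n k \<omega>) (hh n k \<omega>)))^2) \<partial>\<Omega>)"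
    by (subst nn_integral_cmult[symmetric, OF m]) (simp add: ennreal_mult')
  also have "\<dots> \<le> ennreal (real L) * ennreal (real M * ?\<kappa>)"
    using M3 by (intro mult_left_mono nn_integral_quantization n k) auto
  finally have "ennreal (real L) * (ennreal (real M - 1) * ?I) \<le> ennreal (real L) * ennreal (real M * ?\<kappa>)"
    by (simp only: mult.left_commute)
  then have le: "ennreal (real M - 1) * ?I \<le> ennreal (real M * ?\<kappa>)"
    using L_pos by (subst (asm) ennreal_mult_le_mult_iff) auto
  have "real M * ?\<kappa> = (real M - 1) * (Gamma ((2 * real M - 1) / (real M - 1)) * 2 powr (- real (B n k) / (real M - 1)))"
  proof -
    \<comment> \<open>The factor M/(M-1) left over from the two averages equals 1 + 1/(M-1), so the
      functional equation of Gamma absorbs it.\<close>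
    have e: "(2 * real M - 1) / (real M - 1) = (1 + 1 / (real M - 1)) + 1"
      using M3 by (simp add: field_simps)
    have "Gamma ((1 + 1 / (real M - 1)) + 1) = (1 + 1 / (real M - 1)) * Gamma (1 + 1 / (real M - 1))"
      using M3 by (intro Gamma_plus1) (auto simp: nonpos_Ints_def add_pos_nonneg dest!: arg_cong[where f="\<lambda>x. x > (0::real)"])
    moreover have "(real M - 1) * (1 + 1 / (real M - 1)) = real M" using M3 by (simp add: field_simps)
    ultimately show ?thesis unfolding e by (metis mult.assoc)
  qed
  then have "ennreal (real M - 1) * ?I \<le> ennreal (real M - 1) * ennreal (Gamma ((2 * real M - 1) / (real M - 1)) * 2 powr (- real (B n k) / (real M - 1)))"
    using le M3 by (simp only: ennreal_mult'[symmetric])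
  then show ?thesis using M3 by (subst (asm) ennreal_mult_le_mult_iff) auto
qed

end

section \<open>The rate loss\<close>

lemma rmul_diff_scale: "rmul M (\<lambda>i. x i - z * y i) v = rmul M x v - z * rmul M y v"
  by (simp add: rmul_def left_diff_distrib sum_subtractf sum_distrib_left mult.assoc)

lemma rmul_scale: "rmul M (\<lambda>i. z * x i) v = z * rmul M x v"
  by (simp add: rmul_def sum_distrib_left mult.assoc)

text \<open>A beamformer that annihilates the quantised channel sees the error vector exactly as it sees
  the channel; the division by a vanishing error norm is harmless.\<close>
lemma sin2_etil:
  assumes "rmul M g v = 0"
  shows "sin2 M x g * (cvnorm M x)^2 * (cmod (rmul M (etil M x g) v))^2 = (cmod (rmul M x v))^2"
proof -
  let ?e = "errv M x g" and ?r = "cvnorm M x"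
  have e: "rmul M ?e v = rmul M (htil M x) v"
    unfolding errv_def rmul_diff_scale using assms by simp
  have x: "rmul M x v = complex_of_real ?r * rmul M (htil M x) v"
  proof (cases "?r = 0")
    case True
    then have "rmul M x v = 0" by (simp add: cvnorm_eq_0_iff rmul_def)
    then show ?thesis using True by simp
  next
    case False
    then show ?thesis unfolding rmul_scale[symmetric] by (simp add: htil_def)
  qed
  have t: "rmul M (etil M x g) v = rmul M ?e v / complex_of_real (cvnorm M ?e)"
    by (simp add: etil_def rmul_def sum_divide_distrib)
  show ?thesis
  proof (cases "cvnorm M ?e = 0")
    case True
    then have "rmul M ?e v = 0" by (simp add: cvnorm_eq_0_iff rmul_def)
    then show ?thesis unfolding x using True e by (simp add: sin2_def)
  next
    case False
    then show ?thesis unfolding x t e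
      by (simp add: sin2_def norm_mult norm_divide power_mult_distrib power_divide)
  qed
qed

section \<open>Measurability of the SINR and estimates for the logarithm\<close>

lemma borel_measurable_rmul_comp:
  assumes "\<And>i. i < n \<Longrightarrow> (\<lambda>w. f w i) \<in> borel_measurable N" "\<And>i. i < n \<Longrightarrow> (\<lambda>w. g w i) \<in> borel_measurable N"
  shows "(\<lambda>w. rmul n (f w) (g w)) \<in> borel_measurable N"
  unfolding rmul_def using assms by (intro borel_measurable_sum borel_measurable_times) auto

lemma borel_measurable_errv:
  assumes "x \<in> N \<rightarrow>\<^sub>M cvec_space M" "g \<in> N \<rightarrow>\<^sub>M cvec_space M" "i < M"
  shows "(\<lambda>z. errv M (x z) (g z) i) \<in> borel_measurable N"
proof -
  note [measurable] = assms(1,2)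
  have [measurable]: "(\<lambda>z. cinner M (htil M (x z)) (g z)) \<in> borel_measurable N"
    by (rule borel_measurable_cinner_comp) measurable
  show ?thesis using assms(3) unfolding errv_def by measurable
qed

lemma borel_measurable_cvnorm_errv:
  assumes "x \<in> N \<rightarrow>\<^sub>M cvec_space M" "g \<in> N \<rightarrow>\<^sub>M cvec_space M"
  shows "(\<lambda>z. cvnorm M (errv M (x z) (g z))) \<in> borel_measurable N"
proof -
  have [measurable]: "(\<lambda>z. errv M (x z) (g z) i) \<in> borel_measurable N" if "i < M" for i
    by (rule borel_measurable_errv[OF assms that])
  show ?thesis unfolding cvnorm_def by measurable
qed

lemma borel_measurable_rmul_etil:
  assumes "x \<in> N \<rightarrow>\<^sub>M cvec_space M" "g \<in> N \<rightarrow>\<^sub>M cvec_space M" "v \<in> N \<rightarrow>\<^sub>M cvec_space M"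
  shows "(\<lambda>z. rmul M (etil M (x z) (g z)) (v z)) \<in> borel_measurable N"
proof (rule borel_measurable_rmul_comp)
  fix i assume i: "i < M"
  have [measurable]: "(\<lambda>z. errv M (x z) (g z) i) \<in> borel_measurable N"
    "(\<lambda>z. cvnorm M (errv M (x z) (g z))) \<in> borel_measurable N"
    by (rule borel_measurable_errv[OF assms(1,2) i] borel_measurable_cvnorm_errv[OF assms(1,2)])+
  show "(\<lambda>z. etil M (x z) (g z) i) \<in> borel_measurable N"
    unfolding etil_def by measurable
  show "(\<lambda>z. v z i) \<in> borel_measurable N"
    by (rule measurable_compose[OF assms(3) measurable_cvec_component[OF i]])
qed

lemma log2_one_plus_le: "0 \<le> x \<Longrightarrow> log 2 (1 + x) \<le> x / ln 2"
  using ln_add_one_self_le_self[of x] by (simp add: log_def divide_right_mono)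

text \<open>Concavity in the form in which it will be integrated: a tangent at a freely chosen point
  \<open>a\<close> takes the place of Jensen's inequality.\<close>

lemma log2_tangent:
  assumes "0 < (x::real)" "0 < a"
  shows "log 2 x \<le> log 2 a + (x - a) / (a * ln 2)"
proof -
  have "ln (x / a) \<le> x / a - 1" using assms by (intro ln_le_minus_one) simp
  then have "ln x \<le> ln a + (x - a) / a" using assms by (simp add: ln_div diff_divide_distrib)
  then have "ln x / ln 2 \<le> (ln a + (x - a) / a) / ln 2" by (intro divide_right_mono) auto
  then show ?thesis by (simp add: log_def add_divide_distrib)
qed

lemma E1_nonneg: "0 \<le> E1 x"
  unfolding E1_def set_lebesgue_integral_def by (intro Bochner_Integration.integral_nonneg) (auto split: split_indicator)

context noma
begin

lemma AE_zero_forcing: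
  assumes i: "i \<in> {1..N}" and n: "n \<in> {1..N}" and k: "k \<in> {1..K}" and ne: "i \<noteq> n"
  shows "AE \<omega> in \<Omega>. rmul M (hh n k \<omega>) (w i \<omega>) = 0"
  using Vsel_onb
proof eventually_elim
  case (elim \<omega>)
  have "hh n k \<omega> \<in> {hh m j \<omega> |m j. m \<in> {1..N} - {i} \<and> j \<in> {1..K}}" using n k ne by blast
  with bspec[OF elim i] have "(\<Sum>q<M. hh n k \<omega> q * V i \<omega> q l) = 0" if "l < L" for l
    using that unfolding onb_null_def by blast
  then show ?case by (simp add: w_def rmul_bf)
qed

lemma rate_loss_bound:
  assumes n: "n \<in> {1..N}" and k: "k \<in> {1..K}"
    and a: "0 \<le> snr d \<alpha> \<sigma>2 n k"
    and P_nonneg: "\<forall>m\<in>{1..N}. \<forall>j\<in>{1..K}. P m j \<ge> 0"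
  defines "G \<equiv> \<lambda>\<omega>. (cmod (rmul M (h n k \<omega>) (w n \<omega>)))^2"
  shows "(\<integral>\<omega>. log 2 ((1 + S1 d \<alpha> \<sigma>2 P n k * G \<omega>) / (1 + S2 d \<alpha> \<sigma>2 P n k * G \<omega>)) \<partial>\<Omega>)
       - (\<integral>\<omega>. log 2 (1 + sinr M N K d \<alpha> \<sigma>2 P n k (h n k \<omega>) (hh n k \<omega>) (\<lambda>i. w i \<omega>)) \<partial>\<Omega>)
     \<le> log 2 (1 + S2 d \<alpha> \<sigma>2 P n k
              + Gamma ((2 * real M - 1) / (real M - 1)) * 2 powr (- real (B n k) / (real M - 1))
                * S3 N K d \<alpha> \<sigma>2 P n k)
       - (if S2 d \<alpha> \<sigma>2 P n k = 0 then 0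
          else log 2 (exp 1) * exp (1 / S2 d \<alpha> \<sigma>2 P n k) * E1 (1 / S2 d \<alpha> \<sigma>2 P n k))"
proof -
  let ?a = "snr d \<alpha> \<sigma>2 n k"
  define s1 where "s1 = S1 d \<alpha> \<sigma>2 P n k"
  define s2 where "s2 = S2 d \<alpha> \<sigma>2 P n k"
  define s3 where "s3 = S3 N K d \<alpha> \<sigma>2 P n k"
  define \<kappa> where "\<kappa> = Gamma ((2 * real M - 1) / (real M - 1)) * 2 powr (- real (B n k) / (real M - 1))"
  define Q where "Q i = (\<Sum>l\<in>{1..K}. P i l)" for i
  \<comment> \<open>The interference with the true channel in place of the quantisation error. It
    agrees with the term in \<open>sinr\<close> almost surely, namely wherever the beams of the
    other clusters annihilate \<open>hh n k\<close>.\<close>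
  define J where "J \<omega> = ?a * (\<Sum>i\<in>{1..N} - {n}. (cmod (rmul M (h n k \<omega>) (w i \<omega>)))^2 * Q i)" for \<omega>
  define R where "R \<omega> = sinr M N K d \<alpha> \<sigma>2 P n k (h n k \<omega>) (hh n k \<omega>) (\<lambda>i. w i \<omega>)" for \<omega>
  have nk: "(n, k) \<in> users" using n k by (simp add: users_def)
  have P0: "0 \<le> P n k" using P_nonneg n k by blast
  have Q0: "0 \<le> Q i" if "i \<in> {1..N}" for i
    unfolding Q_def using P_nonneg that by (intro sum_nonneg) blast
  have s2_0: "0 \<le> s2"
    unfolding s2_def S2_def using a P_nonneg n k by (intro mult_nonneg_nonneg sum_nonneg) auto
  have s1_eq: "s1 = s2 + ?a * P n k"
  proof -
    have "{1..k} = insert k {1..<k}" using k by auto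
    then show ?thesis by (simp add: s1_def s2_def S1_def S2_def distrib_left add.commute)
  qed
  have s1_ge: "s2 \<le> s1" using a P0 by (simp add: s1_eq)
  have s3_eq: "s3 = ?a * (\<Sum>i\<in>{1..N} - {n}. Q i)" by (simp add: s3_def S3_def Q_def)
  have s3_0: "0 \<le> s3" unfolding s3_eq using a Q0 by (intro mult_nonneg_nonneg sum_nonneg) auto
  have G0: "0 \<le> G \<omega>" for \<omega> by (simp add: G_def)
  have J0: "0 \<le> J \<omega>" for \<omega>
    unfolding J_def using a Q0 by (intro mult_nonneg_nonneg sum_nonneg) auto
  have hm [measurable]: "h n k \<in> \<Omega> \<rightarrow>\<^sub>M cvec_space M" by (rule h_meas[OF nk])
  have hhm [measurable]: "hh n k \<in> \<Omega> \<rightarrow>\<^sub>M cvec_space M" by (rule hh_meas[OF nk])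
  have wn [measurable]: "w n \<in> \<Omega> \<rightarrow>\<^sub>M cvec_space M" by (rule w_meas[OF n])
  have Gm [measurable]: "G \<in> borel_measurable \<Omega>" unfolding G_def by measurable
  have bm: "(\<lambda>\<omega>. (cmod (rmul M (h n k \<omega>) (w i \<omega>)))^2) \<in> borel_measurable \<Omega>" if "i \<in> {1..N} - {n}" for i
  proof -
    have [measurable]: "w i \<in> \<Omega> \<rightarrow>\<^sub>M cvec_space M" using that by (intro w_meas) simp
    show ?thesis by measurable
  qed
  have Jm [measurable]: "J \<in> borel_measurable \<Omega>"
    unfolding J_def by (intro borel_measurable_times borel_measurable_sum borel_measurable_const bm)
  have Rm [measurable]: "R \<in> borel_measurable \<Omega>"
  proof -
    have em [measurable]: "(\<lambda>\<omega>. cvnorm M (errv M (h n k \<omega>) (hh n k \<omega>))) \<in> borel_measurable \<Omega>"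
      by (rule borel_measurable_cvnorm_errv[OF hm hhm])
    have [measurable]: "(\<lambda>\<omega>. \<Sum>i\<in>{1..N} - {n}. (cmod (rmul M (etil M (h n k \<omega>) (hh n k \<omega>)) (w i \<omega>)))^2 * (\<Sum>l\<in>{1..K}. P i l)) \<in> borel_measurable \<Omega>"
    proof (intro borel_measurable_times borel_measurable_sum borel_measurable_const)
      fix i assume "i \<in> {1..N} - {n}"
      then have [measurable]: "(\<lambda>\<omega>. rmul M (etil M (h n k \<omega>) (hh n k \<omega>)) (w i \<omega>)) \<in> borel_measurable \<Omega>"
        by (intro borel_measurable_rmul_etil hm hhm w_meas) simp
      show "(\<lambda>\<omega>. (cmod (rmul M (etil M (h n k \<omega>) (hh n k \<omega>)) (w i \<omega>)))^2) \<in> borel_measurable \<Omega>"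
        by measurable
    qed
    show ?thesis unfolding R_def sinr_def sin2_def by measurable
  qed
  have R_eq: "AE \<omega> in \<Omega>. R \<omega> = ?a * G \<omega> * P n k / (1 + s2 * G \<omega> + J \<omega>)"
  proof -
    have "AE \<omega> in \<Omega>. \<forall>i\<in>{1..N} - {n}. rmul M (hh n k \<omega>) (w i \<omega>) = 0"
      using AE_zero_forcing[OF _ n k] by (intro AE_finite_allI) auto
    then show ?thesis
    proof eventually_elim
      case (elim \<omega>)
      have "?a * sin2 M (h n k \<omega>) (hh n k \<omega>) * (cvnorm M (h n k \<omega>))^2 *
        (\<Sum>i\<in>{1..N} - {n}. (cmod (rmul M (etil M (h n k \<omega>) (hh n k \<omega>)) (w i \<omega>)))^2 * (\<Sum>l\<in>{1..K}. P i l))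
        = ?a * (\<Sum>i\<in>{1..N} - {n}. (sin2 M (h n k \<omega>) (hh n k \<omega>) * (cvnorm M (h n k \<omega>))^2 *
            (cmod (rmul M (etil M (h n k \<omega>) (hh n k \<omega>)) (w i \<omega>)))^2) * Q i)"
        by (simp only: sum_distrib_left mult.assoc Q_def)
      also have "\<dots> = J \<omega>"
        unfolding J_def using elim
        by (intro arg_cong2[where f="(*)"] sum.cong refl) (simp add: sin2_etil)
      finally have "?a * sin2 M (h n k \<omega>) (hh n k \<omega>) * (cvnorm M (h n k \<omega>))^2 *
        (\<Sum>i\<in>{1..N} - {n}. (cmod (rmul M (etil M (h n k \<omega>) (hh n k \<omega>)) (w i \<omega>)))^2 * (\<Sum>l\<in>{1..K}. P i l)) = J \<omega>" .
      then show ?case unfolding R_def sinr_def by (simp only: G_def s2_def)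
    qed
  qed
  have nnG: "(\<integral>\<^sup>+\<omega>. ennreal (G \<omega>) \<partial>\<Omega>) = 1"
    unfolding G_def using nn_integral_gain[OF n k, of ennreal] by (simp add: expo1_mean)
  have Gi: "integrable \<Omega> G"
    by (rule integrableI_nonneg) (auto simp: G0 nnG)
  have EG: "(\<integral>\<omega>. G \<omega> \<partial>\<Omega>) = 1"
    using integral_eq_nn_integral[of G \<Omega>] by (simp add: G0 nnG)
  \<comment> \<open>With a single cluster M = 1 is allowed, and then the argument of Gamma is a
    division by zero. In that case there is no interferer and \<open>s3\<close> is an empty sum, so
    the product with \<kappa> is 0 whatever \<kappa> is.\<close>
  have \<kappa>0: "0 \<le> \<kappa> \<or> {1..N} - {n} = {}"
  proof (cases "{1..N} - {n} = {}")
    case False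
    then obtain i where i: "i \<in> {1..N}" "i \<noteq> n" by blast
    have "N \<ge> 2" using i n by auto
    then have "(N - 1) * K \<ge> 1 * 2" using K by (intro mult_le_mono) auto
    then have "M \<ge> 3" using M by linarith
    then have "0 < Gamma ((2 * real M - 1) / (real M - 1))" by (intro Gamma_real_pos divide_pos_pos) auto
    then show ?thesis by (simp add: \<kappa>_def)
  qed simp
  have nnJ: "(\<integral>\<^sup>+\<omega>. ennreal (J \<omega>) \<partial>\<Omega>) \<le> ennreal (\<kappa> * s3)"
  proof -
    have "(\<integral>\<^sup>+\<omega>. ennreal (J \<omega>) \<partial>\<Omega>)
      = (\<integral>\<^sup>+\<omega>. (\<Sum>i\<in>{1..N} - {n}. ennreal (?a * Q i) * ennreal ((cmod (rmul M (h n k \<omega>) (w i \<omega>)))^2)) \<partial>\<Omega>)"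
    proof (rule nn_integral_cong)
      fix \<omega>
      have "J \<omega> = (\<Sum>i\<in>{1..N} - {n}. (?a * Q i) * (cmod (rmul M (h n k \<omega>) (w i \<omega>)))^2)"
        by (simp add: J_def sum_distrib_left mult_ac)
      then have "ennreal (J \<omega>) = (\<Sum>i\<in>{1..N} - {n}. ennreal ((?a * Q i) * (cmod (rmul M (h n k \<omega>) (w i \<omega>)))^2))"
        using a Q0 by (simp only:) (rule sum_ennreal[symmetric], auto)
      also have "\<dots> = (\<Sum>i\<in>{1..N} - {n}. ennreal (?a * Q i) * ennreal ((cmod (rmul M (h n k \<omega>) (w i \<omega>)))^2))"
        using a Q0 by (intro sum.cong refl ennreal_mult) auto
      finally show "ennreal (J \<omega>) = (\<Sum>i\<in>{1..N} - {n}. ennreal (?a * Q i) * ennreal ((cmod (rmul M (h n k \<omega>) (w i \<omega>)))^2))" .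
    qed
    also have "\<dots> = (\<Sum>i\<in>{1..N} - {n}. ennreal (?a * Q i) * (\<integral>\<^sup>+\<omega>. ennreal ((cmod (rmul M (h n k \<omega>) (w i \<omega>)))^2) \<partial>\<Omega>))"
    proof (subst nn_integral_sum)
      show "(\<lambda>\<omega>. ennreal (?a * Q i) * ennreal ((cmod (rmul M (h n k \<omega>) (w i \<omega>)))^2)) \<in> borel_measurable \<Omega>"
        if "i \<in> {1..N} - {n}" for i
        using bm[OF that] by measurable
      show "(\<Sum>i\<in>{1..N} - {n}. \<integral>\<^sup>+\<omega>. ennreal (?a * Q i) * ennreal ((cmod (rmul M (h n k \<omega>) (w i \<omega>)))^2) \<partial>\<Omega>)
        = (\<Sum>i\<in>{1..N} - {n}. ennreal (?a * Q i) * (\<integral>\<^sup>+\<omega>. ennreal ((cmod (rmul M (h n k \<omega>) (w i \<omega>)))^2) \<partial>\<Omega>))"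
        by (intro sum.cong refl nn_integral_cmult measurable_compose[OF bm measurable_ennreal])
    qed
    also have "\<dots> \<le> (\<Sum>i\<in>{1..N} - {n}. ennreal (?a * Q i) * ennreal \<kappa>)"
      unfolding \<kappa>_def using nn_integral_interference[OF _ n k] by (intro sum_mono mult_left_mono) auto
    also have "\<dots> = (\<Sum>i\<in>{1..N} - {n}. ennreal (?a * Q i * \<kappa>))"
      using a Q0 by (intro sum.cong refl ennreal_mult'[symmetric]) auto
    also have "\<dots> = ennreal (\<Sum>i\<in>{1..N} - {n}. ?a * Q i * \<kappa>)"
      using \<kappa>0 a Q0 by (intro sum_ennreal) auto
    also have "(\<Sum>i\<in>{1..N} - {n}. ?a * Q i * \<kappa>) = \<kappa> * s3"
      by (simp add: s3_eq sum_distrib_left mult_ac)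
    finally show ?thesis .
  qed
  have Ji: "integrable \<Omega> J"
    using nnJ by (intro integrableI_nonneg) (auto simp: J0 intro: le_less_trans)
  have \<kappa>s3: "0 \<le> \<kappa> * s3" using \<kappa>0
  proof
    assume "{1..N} - {n} = {}"
    then have "s3 = 0" by (simp only: s3_eq sum.empty mult_zero_right)
    then show ?thesis by simp
  qed (use s3_0 in simp)
  have EJ: "(\<integral>\<omega>. J \<omega> \<partial>\<Omega>) \<le> \<kappa> * s3"
    using nnJ nn_integral_eq_integral[OF Ji] \<kappa>s3 by (simp add: J0)
  define A where "A \<omega> = log 2 ((1 + s1 * G \<omega>) / (1 + s2 * G \<omega>))" for \<omega>
  define C where "C \<omega> = log 2 (1 + (s2 * G \<omega> + J \<omega>))" for \<omega>
  define D where "D \<omega> = log 2 (1 + s2 * G \<omega>)" for \<omega>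
  have g2: "0 \<le> s2 * G \<omega>" and g12: "s2 * G \<omega> \<le> s1 * G \<omega>" for \<omega>
    using s2_0 G0 s1_ge by (auto intro: mult_right_mono)
  have [measurable]: "A \<in> borel_measurable \<Omega>" "C \<in> borel_measurable \<Omega>" "D \<in> borel_measurable \<Omega>"
    unfolding A_def[abs_def] C_def[abs_def] D_def[abs_def] by measurable
  \<comment> \<open>A Bochner integral of a non-integrable function is 0, so the difference of the
    rates may be taken under the integral only after integrability is known. All four logarithms are
    dominated by linear expressions in \<open>G\<close> and \<open>J\<close>.\<close>
  have Ai: "integrable \<Omega> A"
  proof (rule Bochner_Integration.integrable_bound[of _ "\<lambda>\<omega>. s1 * G \<omega> / ln 2"])
    show "AE \<omega> in \<Omega>. norm (A \<omega>) \<le> norm (s1 * G \<omega> / ln 2)"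
    proof (intro AE_I2)
      fix \<omega>
      have "1 \<le> (1 + s1 * G \<omega>) / (1 + s2 * G \<omega>)" using g2[of \<omega>] g12[of \<omega>] by (simp add: field_simps)
      moreover have "(1 + s1 * G \<omega>) / (1 + s2 * G \<omega>) \<le> 1 + s1 * G \<omega>"
        using g2[of \<omega>] g12[of \<omega>] by (simp add: divide_le_eq mult_le_cancel_left1)
      ultimately have "0 \<le> A \<omega>" "A \<omega> \<le> log 2 (1 + s1 * G \<omega>)" by (auto simp: A_def)
      moreover have "log 2 (1 + s1 * G \<omega>) \<le> s1 * G \<omega> / ln 2"
        using g2[of \<omega>] g12[of \<omega>] by (intro log2_one_plus_le) linarith
      ultimately show "norm (A \<omega>) \<le> norm (s1 * G \<omega> / ln 2)"
        unfolding real_norm_def by linarith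
    qed
  qed (use Gi in auto)
  have Ci: "integrable \<Omega> C"
  proof (rule Bochner_Integration.integrable_bound[of _ "\<lambda>\<omega>. (s2 * G \<omega> + J \<omega>) / ln 2"])
    show "AE \<omega> in \<Omega>. norm (C \<omega>) \<le> norm ((s2 * G \<omega> + J \<omega>) / ln 2)"
    proof (intro AE_I2)
      fix \<omega>
      have "0 \<le> C \<omega>" using g2[of \<omega>] J0[of \<omega>] by (simp add: C_def)
      moreover have "C \<omega> \<le> (s2 * G \<omega> + J \<omega>) / ln 2"
        unfolding C_def using g2[of \<omega>] J0[of \<omega>] by (intro log2_one_plus_le) linarith
      ultimately show "norm (C \<omega>) \<le> norm ((s2 * G \<omega> + J \<omega>) / ln 2)"
        unfolding real_norm_def by linarith
    qed
  qed (use Gi Ji in auto)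
  have Di: "integrable \<Omega> D"
  proof (rule Bochner_Integration.integrable_bound[of _ "\<lambda>\<omega>. s2 * G \<omega> / ln 2"])
    show "AE \<omega> in \<Omega>. norm (D \<omega>) \<le> norm (s2 * G \<omega> / ln 2)"
    proof (intro AE_I2)
      fix \<omega>
      have "0 \<le> D \<omega>" using g2[of \<omega>] by (simp add: D_def)
      then show "norm (D \<omega>) \<le> norm (s2 * G \<omega> / ln 2)"
        using log2_one_plus_le[OF g2[of \<omega>]] unfolding real_norm_def D_def by linarith
    qed
  qed (use Gi in auto)
  have R1: "1 + R \<omega> = (1 + s1 * G \<omega> + J \<omega>) / (1 + s2 * G \<omega> + J \<omega>)"
    if "R \<omega> = ?a * G \<omega> * P n k / (1 + s2 * G \<omega> + J \<omega>)" for \<omega>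
  proof -
    have "0 < 1 + s2 * G \<omega> + J \<omega>" using g2[of \<omega>] J0[of \<omega>] by linarith
    then show ?thesis unfolding that s1_eq by (simp add: field_simps)
  qed
  have Ri: "integrable \<Omega> (\<lambda>\<omega>. log 2 (1 + R \<omega>))"
  proof (rule Bochner_Integration.integrable_bound[of _ "\<lambda>\<omega>. ?a * P n k * G \<omega> / ln 2"])
    show "AE \<omega> in \<Omega>. norm (log 2 (1 + R \<omega>)) \<le> norm (?a * P n k * G \<omega> / ln 2)"
      using R_eq
    proof eventually_elim
      case (elim \<omega>)
      have p: "1 \<le> 1 + s2 * G \<omega> + J \<omega>" using g2[of \<omega>] J0[of \<omega>] by linarith
      have q: "0 \<le> ?a * P n k * G \<omega>" using a P0 G0 by simp
      have R0: "0 \<le> R \<omega>" unfolding elim using p a P0 G0 by (intro divide_nonneg_nonneg mult_nonneg_nonneg) auto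
      have "R \<omega> = (?a * P n k * G \<omega>) / (1 + s2 * G \<omega> + J \<omega>)" unfolding elim by (simp only: mult_ac)
      also have "\<dots> \<le> (?a * P n k * G \<omega>) / 1" using p q by (intro divide_left_mono) auto
      finally have "log 2 (1 + R \<omega>) \<le> log 2 (1 + ?a * P n k * G \<omega>)" using R0 by simp
      also have "\<dots> \<le> ?a * P n k * G \<omega> / ln 2" by (rule log2_one_plus_le[OF q])
      finally have "log 2 (1 + R \<omega>) \<le> ?a * P n k * G \<omega> / ln 2" .
      moreover have "0 \<le> log 2 (1 + R \<omega>)" using R0 by simp
      ultimately show ?case unfolding real_norm_def by linarith
    qed
  qed (use Gi in auto)
  have pw: "AE \<omega> in \<Omega>. A \<omega> - log 2 (1 + R \<omega>) \<le> C \<omega> - D \<omega>"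
    using R_eq
  proof eventually_elim
    case (elim \<omega>)
    have p: "0 < 1 + s2 * G \<omega>" "0 < 1 + s1 * G \<omega>" "0 < 1 + s2 * G \<omega> + J \<omega>" "0 < 1 + s1 * G \<omega> + J \<omega>"
      using g2[of \<omega>] g12[of \<omega>] J0[of \<omega>] by linarith+
    \<comment> \<open>The pointwise estimate gives something away here only: the interference is
      added to the numerator of the ideal rate.\<close>
    have "log 2 (1 + s1 * G \<omega>) \<le> log 2 (1 + s1 * G \<omega> + J \<omega>)" using p J0[of \<omega>] by simp
    moreover have "A \<omega> = log 2 (1 + s1 * G \<omega>) - log 2 (1 + s2 * G \<omega>)"
      unfolding A_def using p by (intro log_divide_pos)
    moreover have "log 2 (1 + R \<omega>) = log 2 (1 + s1 * G \<omega> + J \<omega>) - log 2 (1 + s2 * G \<omega> + J \<omega>)"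
      unfolding R1[OF elim] using p by (intro log_divide_pos)
    ultimately show ?case by (simp add: C_def D_def add.assoc)
  qed
  have "(\<integral>\<omega>. A \<omega> \<partial>\<Omega>) - (\<integral>\<omega>. log 2 (1 + R \<omega>) \<partial>\<Omega>) = (\<integral>\<omega>. A \<omega> - log 2 (1 + R \<omega>) \<partial>\<Omega>)"
    using Ai Ri by simp
  also have "\<dots> \<le> (\<integral>\<omega>. C \<omega> - D \<omega> \<partial>\<Omega>)"
    using Ai Ri Ci Di pw by (intro integral_mono_AE) auto
  also have "\<dots> = (\<integral>\<omega>. C \<omega> \<partial>\<Omega>) - (\<integral>\<omega>. D \<omega> \<partial>\<Omega>)"
    using Ci Di by simp
  also have "(\<integral>\<omega>. D \<omega> \<partial>\<Omega>) = (if s2 = 0 then 0 else log 2 (exp 1) * exp (1 / s2) * E1 (1 / s2))"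
  \<comment> \<open>The case \<open>s2 = 0\<close> arises for \<open>k = 1\<close> and also when all
    earlier users of the cluster have power zero. Then \<open>D\<close> vanishes, in accordance with
    the limit value 0.\<close>
  proof (cases "s2 = 0")
    case False
    then have s2: "0 < s2" using s2_0 by simp
    have "(\<integral>\<omega>. ln (1 + s2 * G \<omega>) \<partial>\<Omega>) = enn2real (\<integral>\<^sup>+\<omega>. ennreal (ln (1 + s2 * G \<omega>)) \<partial>\<Omega>)"
      using g2 by (intro integral_eq_nn_integral) auto
    also have "(\<integral>\<^sup>+\<omega>. ennreal (ln (1 + s2 * G \<omega>)) \<partial>\<Omega>) = ennreal (exp (1 / s2) * E1 (1 / s2))"
      unfolding G_def using nn_integral_gain[OF n k, of "\<lambda>t. ennreal (ln (1 + s2 * t))"] expo1_ln[OF s2] by simp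
    finally have "(\<integral>\<omega>. ln (1 + s2 * G \<omega>) \<partial>\<Omega>) = exp (1 / s2) * E1 (1 / s2)"
      by (simp add: E1_nonneg)
    then show ?thesis using False by (simp add: D_def log_def)
  qed (simp add: D_def)
  also have "(\<integral>\<omega>. C \<omega> \<partial>\<Omega>) \<le> log 2 (1 + s2 + \<kappa> * s3)"
  proof -
    \<comment> \<open>The tangent is taken at the upper bound \<open>t\<close> for the mean of the
      argument rather than at the mean itself. As its slope is positive, the linear term has
      non-positive mean and log 2 t remains.\<close>
    define t where "t = 1 + s2 + \<kappa> * s3"
    have t: "0 < t" using s2_0 \<kappa>s3 by (simp add: t_def)
    have "(\<integral>\<omega>. C \<omega> \<partial>\<Omega>) \<le> (\<integral>\<omega>. log 2 t + (1 + (s2 * G \<omega> + J \<omega>) - t) / (t * ln 2) \<partial>\<Omega>)"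
    proof (rule integral_mono)
      fix \<omega>
      show "C \<omega> \<le> log 2 t + (1 + (s2 * G \<omega> + J \<omega>) - t) / (t * ln 2)"
        unfolding C_def using g2[of \<omega>] J0[of \<omega>] t by (intro log2_tangent) auto
    qed (use Ci Gi Ji in auto)
    also have "\<dots> = log 2 t + (1 + (s2 * 1 + (\<integral>\<omega>. J \<omega> \<partial>\<Omega>)) - t) / (t * ln 2)"
      using Gi Ji EG by (simp add: prob_space)
    also have "\<dots> \<le> log 2 t"
      using EJ t by (simp add: t_def divide_nonpos_pos)
    finally show ?thesis by (simp add: t_def)
  qed
  finally show ?thesis
    unfolding A_def R_def \<kappa>_def s1_def s2_def s3_def by simp
qed

end

theorem theorem2:
  fixes \<Omega> :: "'w measure" and M N K n k :: nat
    and d \<sigma>2 P :: "nat \<Rightarrow> nat \<Rightarrow> real" and \<alpha> :: real and B :: "nat \<Rightarrow> nat \<Rightarrow> nat"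
    and h :: "nat \<Rightarrow> nat \<Rightarrow> 'w \<Rightarrow> nat \<Rightarrow> complex"
    and c :: "nat \<Rightarrow> nat \<Rightarrow> nat \<Rightarrow> 'w \<Rightarrow> nat \<Rightarrow> complex"
    and p :: "nat \<Rightarrow> 'w \<Rightarrow> nat \<Rightarrow> complex"
    and Vsel :: "nat \<Rightarrow> (nat \<Rightarrow> nat \<Rightarrow> nat \<Rightarrow> complex) \<Rightarrow> nat \<Rightarrow> nat \<Rightarrow> complex"
  defines "L \<equiv> M - (N - 1) * K"
  defines "hh \<equiv> \<lambda>m j \<omega>. hhat M (B m j) (h m j \<omega>) (\<lambda>l. c m j l \<omega>)"
  defines "V \<equiv> \<lambda>i \<omega>. Vsel i (fb_others N K i (\<lambda>m j. hh m j \<omega>))"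
  defines "w \<equiv> \<lambda>i \<omega>. bf M L (V i \<omega>) (p i \<omega>)"
  defines "G \<equiv> \<lambda>\<omega>. (cmod (rmul M (h n k \<omega>) (w n \<omega>)))^2"
  assumes prob: "prob_space \<Omega>"
    and N: "N \<ge> 1" and K: "K \<ge> 2" and M: "M > (N - 1) * K" and \<alpha>: "\<alpha> > 0"
    and d_pos: "\<forall>m\<in>{1..N}. \<forall>j\<in>{1..K}. d m j > 0"
    and \<sigma>_pos: "\<forall>m\<in>{1..N}. \<forall>j\<in>{1..K}. \<sigma>2 m j > 0"
    and P_nonneg: "\<forall>m\<in>{1..N}. \<forall>j\<in>{1..K}. P m j \<ge> 0"
    and indep: "prob_space.indep_vars \<Omega>
        (\<lambda>i. cvec_space (case i of Pv _ \<Rightarrow> L | _ \<Rightarrow> M))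
        (\<lambda>i \<omega>. case i of Hc m j \<Rightarrow> h m j \<omega> | Cb m j l \<Rightarrow> c m j l \<omega> | Pv m \<Rightarrow> p m \<omega>)
        ({Hc m j |m j. m \<in> {1..N} \<and> j \<in> {1..K}} \<union>
         {Cb m j l |m j l. m \<in> {1..N} \<and> j \<in> {1..K} \<and> l < 2 ^ B m j} \<union>
         {Pv m |m. m \<in> {1..N}})"
    and h_gauss: "\<forall>m\<in>{1..N}. \<forall>j\<in>{1..K}. distr \<Omega> (cvec_space M) (h m j) = cgauss_vec M"
    and c_iso: "\<forall>m\<in>{1..N}. \<forall>j\<in>{1..K}. \<forall>l<2 ^ B m j.
                  isotropic_unit M (distr \<Omega> (cvec_space M) (c m j l))"
    and p_iso: "\<forall>m\<in>{1..N}. isotropic_unit L (distr \<Omega> (cvec_space L) (p m))"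
    and Vsel_meas: "\<forall>i\<in>{1..N}. Vsel i \<in> fb_space M N K i \<rightarrow>\<^sub>M cmat_space M L"
    and Vsel_onb: "AE \<omega> in \<Omega>. \<forall>i\<in>{1..N}.
                  onb_null M L {hh m j \<omega> |m j. m \<in> {1..N} - {i} \<and> j \<in> {1..K}} (V i \<omega>)"
    and n: "n \<in> {1..N}" and k: "k \<in> {1..K}"
  shows "(\<integral>\<omega>. log 2 ((1 + S1 d \<alpha> \<sigma>2 P n k * G \<omega>) / (1 + S2 d \<alpha> \<sigma>2 P n k * G \<omega>)) \<partial>\<Omega>)
       - (\<integral>\<omega>. log 2 (1 + sinr M N K d \<alpha> \<sigma>2 P n k (h n k \<omega>) (hh n k \<omega>) (\<lambda>i. w i \<omega>)) \<partial>\<Omega>)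
     \<le> log 2 (1 + S2 d \<alpha> \<sigma>2 P n k
              + Gamma ((2 * real M - 1) / (real M - 1)) * 2 powr (- real (B n k) / (real M - 1))
                * S3 N K d \<alpha> \<sigma>2 P n k)
       - (if S2 d \<alpha> \<sigma>2 P n k = 0 then 0
          else log 2 (exp 1) * exp (1 / S2 d \<alpha> \<sigma>2 P n k) * E1 (1 / S2 d \<alpha> \<sigma>2 P n k))"
proof -
  interpret noma \<Omega> M N K L B h c p Vsel hh V w
    by (intro noma.intro noma_axioms.intro prob)
      (use assms in \<open>auto simp only: hh_def V_def w_def L_def\<close>)
  have "0 \<le> snr d \<alpha> \<sigma>2 n k"
    using \<sigma>_pos n k by (simp add: snr_def less_imp_le)
  from rate_loss_bound[OF n k this P_nonneg] show ?thesis unfolding G_def .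
qed

end
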